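(* Let $D\subset\mathbb{R}^d$ be a bounded open set and let $h:D\to[0,\infty)$ be a harmonic function with respect to the killed process $X^D$. Then there exists a sequence $(\widetilde{f}_k)_{k\ge1}$ of nonnegative, bounded and continuous functions on $D$ such that $G_D\widetilde{f}_k\uparrow h$ (pointwise on $D$, as $k\to\infty$).
   Context: All functions and sets are Borel measurable. Setting: $d\ge2$; $\phi(\lambda)=\int_0^\infty(1-e^{-\lambda t})\mu_\phi(t)\,dt$, $\lambda>0$, is a complete Bernstein function, where $\mu_\phi:(0,\infty)\to(0,\infty)$ is completely monotone with $\int_0^\infty(1\wedge t)\mu_\phi(t)\,dt<\infty$. Weak scaling: there are $R_0>0$, $0<\delta_1\le\delta_2<1$, $a_1,a_2>0$ with $a_1(t/s)^{\delta_1}\le\phi(t)/\phi(s)\le a_2(t/s)^{\delta_2}$ for $t\ge s\ge R_0$. If $d=2$, also $\int_0^1\lambda^{d/2-1}\phi(\lambda)^{-1}d\lambda<\infty$ (transience; automatic for $d\ge3$). $X=(X_t,\mathbb{P}_x)$ is the Lévy process in $\mathbb{R}^d$ with $\mathbb{E}_0e^{i\xi\cdot X_t}=e^{-t\phi(|\xi|^2)}$; its Lévy measure has density $j(|x|)$ with $j(r)=\int_0^\infty(4\pi t)^{-d/2}e^{-r^2/(4t)}\mu_\phi(t)\,dt$. For open $U$, $\tau_U=\inf\{t>0:X_t\notin U\}$. $X^D$ is the process $X$ killed upon exiting $D$, and $G_Df(x)=\mathbb{E}_x\int_0^{\tau_D}f(X_t)\,dt=\int_DG_D(x,y)f(y)\,dy$,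 where $G_D(x,y)$ is its Green function. A function $h:D\to[0,\infty)$ is harmonic with respect to $X^D$ if its extension by $0$ to $\mathbb{R}^d\setminus D$ (still denoted $h$) belongs to $L^1(\mathbb{R}^d,(1\wedge j(|x|))dx)$ and $h(x)=\mathbb{E}_x[h(X_{\tau_U})]$ for every open $U\subset\overline{U}\subset D$ and every $x\in U$. *)

theory Defs
  imports "HOL-Probability.Probability"
begin

definition completely_monotone :: "(real \<Rightarrow> real) \<Rightarrow> bool" where
  "completely_monotone m \<longleftrightarrow>
     (\<forall>n. \<forall>t>0. (deriv ^^ n) m field_differentiable (at t) \<and> 0 \<le> (-1) ^ n * (deriv ^^ n) m t)"

text \<open>The Bernstein function with Levy density \<open>m\<close>, zero killing and zero drift.\<close>

definition bernstein_fun :: "(real \<Rightarrow> real) \<Rightarrow> real \<Rightarrow> real" where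
  "bernstein_fun m l = (LBINT t:{0<..}. (1 - exp (- l * t)) * m t)"

definition weak_scaling :: "(real \<Rightarrow> real) \<Rightarrow> real \<Rightarrow> real \<Rightarrow> real \<Rightarrow> real \<Rightarrow> real \<Rightarrow> bool" where
  "weak_scaling \<phi> R0 \<delta>1 \<delta>2 a1 a2 \<longleftrightarrow>
     (\<forall>s t. R0 \<le> s \<and> s \<le> t \<longrightarrow>
        a1 * (t / s) powr \<delta>1 \<le> \<phi> t / \<phi> s \<and> \<phi> t / \<phi> s \<le> a2 * (t / s) powr \<delta>2)"

text \<open>The radial jump density \<open>j\<close> in dimension \<open>d\<close>. It is extended-real valued because
  \<open>j 0\<close> may be infinite.\<close>

definition jump_density :: "nat \<Rightarrow> (real \<Rightarrow> real) \<Rightarrow> real \<Rightarrow> ennreal" where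
  "jump_density d m r =
     (\<integral>\<^sup>+ t\<in>{0<..}. ennreal ((4 * pi * t) powr (- real d / 2) * exp (- r\<^sup>2 / (4 * t)) * m t) \<partial>lborel)"

definition cadlag :: "(real \<Rightarrow> 'a::topological_space) \<Rightarrow> bool" where
  "cadlag p \<longleftrightarrow>
     (\<forall>t\<ge>0. (p \<longlongrightarrow> p t) (at_right t)) \<and> (\<forall>t>0. \<exists>l. (p \<longlongrightarrow> l) (at_left t))"

text \<open>Levy processes started at the origin; only the times \<open>t \<ge> 0\<close> matter. Stochastic continuity
  follows from the path regularity and the stationarity of the increments.\<close>

definition levy_process :: "'w measure \<Rightarrow> (real \<Rightarrow> 'w \<Rightarrow> 'a::euclidean_space) \<Rightarrow> bool" where
  "levy_process M X \<longleftrightarrow>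
     prob_space M \<and>
     (\<forall>t\<ge>0. X t \<in> borel_measurable M) \<and>
     (AE \<omega> in M. X 0 \<omega> = 0) \<and>
     (\<forall>n (t :: nat \<Rightarrow> real). 0 \<le> t 0 \<and> (\<forall>i<n. t i < t (Suc i)) \<longrightarrow>
        prob_space.indep_vars M (\<lambda>_. borel) (\<lambda>i \<omega>. X (t (Suc i)) \<omega> - X (t i) \<omega>) {..<n}) \<and>
     (\<forall>s\<ge>0. \<forall>t\<ge>0. distr M borel (\<lambda>\<omega>. X (s + t) \<omega> - X s \<omega>) = distr M borel (X t)) \<and>
     (AE \<omega> in M. cadlag (\<lambda>t. X t \<omega>))"

text \<open>The expectation of a nonnegative path functional when the process starts at \<open>x\<close>: the law
  under \<open>P\<^sub>x\<close> is that of the translated process \<open>x + X\<close>. The completion is needed because exit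
  times from open sets are in general measurable only with respect to the completed
  \<open>\<sigma>\<close>-algebra, and the integral of a nonmeasurable function would be a lower integral.\<close>

definition expectation_from ::
    "'w measure \<Rightarrow> (real \<Rightarrow> 'w \<Rightarrow> 'a::euclidean_space) \<Rightarrow> 'a \<Rightarrow> ((real \<Rightarrow> 'a) \<Rightarrow> ennreal) \<Rightarrow> ennreal" where
  "expectation_from M X x F = (\<integral>\<^sup>+ \<omega>. F (\<lambda>t. x + X t \<omega>) \<partial>completion M)"

definition exit_time :: "'a set \<Rightarrow> (real \<Rightarrow> 'a) \<Rightarrow> ereal" where
  "exit_time U p = Inf (ereal ` {t. 0 < t \<and> p t \<notin> U})"

text \<open>The value of \<open>h\<close> at the exit position, with the convention that it is \<open>0\<close> on
  infinite exit times.\<close>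

definition at_exit :: "('a \<Rightarrow> real) \<Rightarrow> 'a set \<Rightarrow> (real \<Rightarrow> 'a) \<Rightarrow> ennreal" where
  "at_exit h U p =
     (if exit_time U p < \<infinity> then ennreal (h (p (real_of_ereal (exit_time U p)))) else 0)"

text \<open>\<open>G\<^sub>D f\<close> for \<open>f\<close> nonnegative on \<open>D\<close>. Since \<open>p t \<in> D\<close> whenever \<open>0 < t < \<tau>\<^sub>D\<close>, values of
  \<open>f\<close> outside \<open>D\<close> are irrelevant.\<close>

definition green_potential ::
    "'w measure \<Rightarrow> (real \<Rightarrow> 'w \<Rightarrow> 'a::euclidean_space) \<Rightarrow> 'a set \<Rightarrow> ('a \<Rightarrow> real) \<Rightarrow> 'a \<Rightarrow> ennreal" where
  "green_potential M X D f x =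
     expectation_from M X x
       (\<lambda>p. \<integral>\<^sup>+ t\<in>{t. 0 < t \<and> ereal t < exit_time D p}. ennreal (f (p t)) \<partial>lborel)"

definition zero_ext :: "'a set \<Rightarrow> ('a \<Rightarrow> real) \<Rightarrow> 'a \<Rightarrow> real" where
  "zero_ext D h x = (if x \<in> D then h x else 0)"

text \<open>Nonnegative functions on \<open>D\<close> that are harmonic for the process killed on exiting \<open>D\<close>;
  values of \<open>h\<close> outside \<open>D\<close> are irrelevant. The parameter \<open>m\<close> is the Levy density of \<open>\<phi>\<close>.\<close>

definition harmonic_killed ::
    "(real \<Rightarrow> real) \<Rightarrow> 'w measure \<Rightarrow> (real \<Rightarrow> 'w \<Rightarrow> 'a::euclidean_space) \<Rightarrow> 'a set \<Rightarrow> ('a \<Rightarrow> real) \<Rightarrow> bool" where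
  "harmonic_killed m M X D h \<longleftrightarrow>
     (\<forall>x\<in>D. 0 \<le> h x) \<and>
     zero_ext D h \<in> borel_measurable borel \<and>
     (\<integral>\<^sup>+ x. ennreal (zero_ext D h x) * min 1 (jump_density DIM('a) m (norm x)) \<partial>lborel) < \<infinity> \<and>
     (\<forall>U. open U \<and> closure U \<subseteq> D \<longrightarrow>
        (\<forall>x\<in>U. ennreal (h x) = expectation_from M X x (at_exit (zero_ext D h) U)))"

end

theory Submission
  imports Defs
begin

text \<open>Let \<open>P\<^sub>t\<close> be the semigroup of the process killed on leaving \<open>D\<close>. The Markov property at time \<open>t\<close>,
  applied to \<open>h x = E\<^sub>x h(X(\<tau>\<^sub>U))\<close> for \<open>U\<close> exhausting \<open>D\<close>, shows that \<open>h\<close> is excessive for \<open>P\<close>. Hence for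
  \<open>h\<^sub>n = min h n\<close> the averages of \<open>P\<^sub>t h\<^sub>n\<close> over \<open>1/n < t < 2/n\<close> increase to \<open>h\<close>. As \<open>P\<^sub>t h\<^sub>n\<close> vanishes for
  \<open>t \<longlonglongrightarrow> \<infinity>\<close>, such an average is, by telescoping, the Green potential of \<open>P\<^bsub>1/n\<^esub> (n (h\<^sub>n - P\<^bsub>1/n\<^esub> h\<^sub>n))\<close>,
  where the outer \<open>P\<^bsub>1/n\<^esub>\<close> makes the function continuous because \<open>P\<close> has the strong Feller property.
  That property and the decay of \<open>P\<^sub>t h\<^sub>n\<close> follow from the continuous bounded densities of \<open>X\<^sub>t\<close> given by
  Fourier inversion, as weak scaling makes the characteristic function integrable.\<close>

text \<open>The obstacle is measurability. The Markov property comes from independent increments as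
  an identity of laws on the product space of all paths, where exit times are not measurable.
  Survival is therefore defined through rational times, as keeping a positive distance from the
  complement of \<open>D\<close>. It may end before the exit time: a path could approach the
  complement from the left and be back in \<open>D\<close> at the limit time. Quasi-left-continuity
  excludes this almost surely. Harmonicity concerns only sets with closure in \<open>D\<close>;
  survival in \<open>D\<close> is the union of survivals in such sets.

  Killing destroys the smooth density, so the strong Feller property is obtained by letting the
  process run freely for a short time, which smooths, and killing it only afterwards; the error is
  the probability of leaving a small ball during that time.

  The window from \<open>1/n\<close> to \<open>2/n\<close> serves two purposes: its lower end
  supplies the outer smoothing operator, and, rescaled, the average becomes an integral over the
  fixed interval from 1 to 2, in which a larger \<open>n\<close> shortens the time and raises the
  truncation, so that the integrand increases.\<close>

section \<open>Fourier inversion in Euclidean space\<close>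

text \<open>Fubini, since \<open>lborel\<close> is the image of a product of one-dimensional
  Lebesgue measures. It serves the Gaussian, its Fourier transform and a product of Cauchy functions
  used as a majorant.\<close>

lemma lborel_integral_Basis_prod:
  fixes f :: "'a::euclidean_space \<Rightarrow> real \<Rightarrow> 'c::{real_normed_field,banach,second_countable_topology}"
  assumes f: "\<And>b. b \<in> Basis \<Longrightarrow> integrable lborel (f b)"
  shows "integrable lborel (\<lambda>x::'a. \<Prod>b\<in>Basis. f b (x \<bullet> b))"
    and "(\<integral>x. (\<Prod>b\<in>Basis. f b (x \<bullet> b)) \<partial>(lborel::'a measure)) = (\<Prod>b\<in>Basis. \<integral>t. f b t \<partial>lborel)"
proof -
  interpret product_sigma_finite "\<lambda>_::'a. lborel :: real measure" ..
  have m: "(\<lambda>x::'a. \<Prod>b\<in>Basis. f b (x \<bullet> b)) \<in> borel_measurable borel"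
  proof (intro borel_measurable_prod)
    fix b :: 'a assume "b \<in> Basis"
    then have [measurable]: "f b \<in> borel_measurable borel" using f by fastforce
    show "(\<lambda>x. f b (x \<bullet> b)) \<in> borel_measurable borel" by measurable
  qed
  have s: "(\<Sum>i\<in>Basis. g i *\<^sub>R i) \<bullet> b = g b" if "b \<in> Basis" for g and b :: 'a
    using that by simp
  show "integrable lborel (\<lambda>x::'a. \<Prod>b\<in>Basis. f b (x \<bullet> b))"
    using product_integrable_prod[OF finite_Basis f] m
    by (subst lborel_eq) (simp add: integrable_distr_eq s cong: prod.cong)
  show "(\<integral>x. (\<Prod>b\<in>Basis. f b (x \<bullet> b)) \<partial>(lborel::'a measure)) = (\<Prod>b\<in>Basis. \<integral>t. f b t \<partial>lborel)"
    using product_integral_prod[OF finite_Basis f] m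
    by (subst lborel_eq) (simp add: integral_distr s cong: prod.cong)
qed

lemma lborel_integral_affine:
  fixes f :: "'a::euclidean_space \<Rightarrow> 'c::{banach,second_countable_topology}" and c :: real
  assumes [measurable]: "f \<in> borel_measurable borel" and c: "c \<noteq> 0"
  shows "(\<integral>x. f x \<partial>lborel) = \<bar>c\<bar> ^ DIM('a) *\<^sub>R (\<integral>x. f (t + c *\<^sub>R x) \<partial>lborel)"
  by (subst lborel_affine[OF c, of t]) (simp add: integral_density integral_distr)

lemma lborel_nn_integral_affine:
  fixes f :: "'a::euclidean_space \<Rightarrow> ennreal" and c :: real
  assumes [measurable]: "f \<in> borel_measurable borel" and c: "c \<noteq> 0"
  shows "(\<integral>\<^sup>+x. f x \<partial>lborel) = ennreal (\<bar>c\<bar> ^ DIM('a)) * (\<integral>\<^sup>+x. f (t + c *\<^sub>R x) \<partial>lborel)"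
  by (subst lborel_affine[OF c, of t]) (simp add: nn_integral_density nn_integral_distr nn_integral_cmult)

section \<open>The Gaussian and its Fourier transform\<close>

definition std_gauss :: "'a::euclidean_space \<Rightarrow> real" where
  "std_gauss x = (\<Prod>b\<in>Basis. std_normal_density (x \<bullet> b))"

lemma std_gauss_eq:
  "std_gauss (x::'a::euclidean_space) = (1 / sqrt (2 * pi)) ^ DIM('a) * exp (- (norm x)\<^sup>2 / 2)"
proof -
  have "std_gauss x = (\<Prod>b\<in>(Basis::'a set). 1 / sqrt (2 * pi)) * (\<Prod>b\<in>Basis. exp (- (x \<bullet> b)\<^sup>2 / 2))"
    unfolding std_gauss_def std_normal_density_def prod.distrib ..
  also have "(\<Prod>b\<in>Basis. exp (- (x \<bullet> b)\<^sup>2 / 2)) = exp (\<Sum>b\<in>Basis. - (x \<bullet> b)\<^sup>2 / 2)"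
    by (simp add: exp_sum)
  also have "(\<Sum>b\<in>Basis. - (x \<bullet> b)\<^sup>2 / 2) = - (norm x)\<^sup>2 / 2"
    unfolding norm_eq_sqrt_inner
    by (simp add: euclidean_inner[of x x] power2_eq_square sum_negf sum_divide_distrib sum_nonneg)
  finally show ?thesis by simp
qed

lemma std_gauss_nonneg [simp]: "0 \<le> std_gauss x"
  unfolding std_gauss_def by (intro prod_nonneg) simp

lemma borel_measurable_std_gauss [measurable]:
  "(std_gauss :: 'a::euclidean_space \<Rightarrow> real) \<in> borel_measurable borel"
  unfolding std_gauss_def[abs_def] by measurable

lemma integrable_std_gauss: "integrable lborel (std_gauss :: 'a::euclidean_space \<Rightarrow> real)"
  and integral_std_gauss: "(\<integral>x. std_gauss (x::'a) \<partial>lborel) = 1"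
  unfolding std_gauss_def[abs_def]
  using lborel_integral_Basis_prod[of "\<lambda>_::'a. std_normal_density"]
  by (simp_all add: integral_normal_density)

lemma nn_integral_std_gauss: "(\<integral>\<^sup>+x. ennreal (std_gauss (x::'a::euclidean_space)) \<partial>lborel) = 1"
  by (subst nn_integral_eq_integral)
     (simp_all add: integrable_std_gauss integral_std_gauss)

lemma char_std_gaussian:
  "(CLINT z|lborel. iexp (w \<bullet> z) * complex_of_real (std_gauss z)) =
     complex_of_real (exp (- (norm (w::'a::euclidean_space))\<^sup>2 / 2))"
proof -
  define f where "f b t = complex_of_real (std_normal_density t) * iexp ((w \<bullet> b) * t)" for b :: 'a and t
  have int: "integrable lborel (f b)" for b
  proof -
    have "integrable lborel (\<lambda>x. std_normal_density x *\<^sub>R iexp ((w \<bullet> b) * x))"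
      using prob_space.integrable_iexp[OF prob_space_normal_density, of 1 "\<lambda>x. (w \<bullet> b) * x" 0]
      by (subst integrable_density[symmetric]) auto
    then show ?thesis by (simp add: f_def[abs_def] scaleR_conv_of_real)
  qed
  have val: "(\<integral>t. f b t \<partial>lborel) = complex_of_real (exp (- (w \<bullet> b)\<^sup>2 / 2))" for b
    using fun_cong[OF char_std_normal_distribution, of "w \<bullet> b"]
    unfolding char_def f_def
    by (subst (asm) integral_density) (auto simp: scaleR_conv_of_real)
  have *: "iexp (w \<bullet> z) * complex_of_real (std_gauss z) = (\<Prod>b\<in>Basis. f b (z \<bullet> b))" for z
    unfolding f_def prod.distrib std_gauss_def of_real_prod
    by (subst euclidean_inner) (simp add: exp_sum sum_distrib_left)
  have "(\<Prod>b\<in>Basis. complex_of_real (exp (- (w \<bullet> b)\<^sup>2 / 2))) = complex_of_real (exp (- (norm w)\<^sup>2 / 2))"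
    unfolding of_real_prod[symmetric] exp_sum[symmetric, OF finite_Basis] norm_eq_sqrt_inner
    by (simp add: euclidean_inner[of w w] power2_eq_square sum_negf sum_divide_distrib sum_nonneg)
  then show ?thesis
    unfolding * lborel_integral_Basis_prod(2)[OF int] val .
qed

lemma integrable_gaussian_exp:
  assumes "s > 0" shows "integrable lborel (\<lambda>\<xi>::'a::euclidean_space. exp (- (s\<^sup>2 * (norm \<xi>)\<^sup>2 / 2)))"
proof -
  have "integrable lborel (\<lambda>\<xi>::'a. std_gauss (0 + s *\<^sub>R \<xi>))"
  proof -
    have "integrable (density (distr lborel borel (\<lambda>x. 0 + s *\<^sub>R x)) (\<lambda>_. ennreal (\<bar>s\<bar>^DIM('a)))) (std_gauss::'a\<Rightarrow>real)"
      using assms integrable_std_gauss by (subst lborel_affine[of s "0::'a", symmetric]) auto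
    then show ?thesis using assms
      by (simp add: integrable_density integrable_distr_eq)
  qed
  then show ?thesis by (simp add: std_gauss_eq power_mult_distrib)
qed

text \<open>A Gaussian is, up to scaling, its own Fourier transform, so inversion is explicit for
  it; smoothing carries this case over to general measures.\<close>

lemma gaussian_inversion:
  fixes u :: "'a::euclidean_space"
  assumes s: "s > 0"
  shows "complex_of_real ((1 / s) ^ DIM('a) * std_gauss (u /\<^sub>R s)) =
    complex_of_real ((1 / (2 * pi)) ^ DIM('a)) *
      (CLINT \<xi>|lborel. iexp (- (u \<bullet> \<xi>)) * complex_of_real (exp (- (s\<^sup>2 * (norm \<xi>)\<^sup>2 / 2))))"
proof -
  let ?n = "DIM('a)"
  define A where "A = (1 / sqrt (2 * pi)) ^ ?n"
  have AA: "A * A = (1 / (2 * pi)) ^ ?n"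
    unfolding A_def power_mult_distrib[symmetric] by simp
  have g: "std_gauss z = A * exp (- (norm z)\<^sup>2 / 2)" for z :: 'a
    by (simp only: std_gauss_eq A_def)
  define E where "E = (CLINT \<xi>|lborel. iexp (- (u \<bullet> \<xi>)) * complex_of_real (exp (- (s\<^sup>2 * (norm \<xi>)\<^sup>2 / 2))))"
  have "complex_of_real (std_gauss (u /\<^sub>R s)) = complex_of_real A *
      (CLINT z|lborel. iexp ((u /\<^sub>R s) \<bullet> z) * complex_of_real (std_gauss z))"
    unfolding char_std_gaussian by (simp only: g of_real_mult)
  \<comment> \<open>The substitution \<open>z = (- s) *\<^sub>R \<xi>\<close> cancels the scaling in
    the phase and produces the damping factor.\<close>
  also have "(CLINT z|lborel. iexp ((u /\<^sub>R s) \<bullet> z) * complex_of_real (std_gauss z)) =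
      \<bar>- s\<bar> ^ ?n *\<^sub>R (CLINT \<xi>|lborel. iexp ((u /\<^sub>R s) \<bullet> (0 + (- s) *\<^sub>R \<xi>)) *
         complex_of_real (std_gauss (0 + (- s) *\<^sub>R \<xi>)))"
    using s by (subst lborel_integral_affine[where c="- s" and t=0]) auto
  also have "(\<lambda>\<xi>::'a. iexp ((u /\<^sub>R s) \<bullet> (0 + (- s) *\<^sub>R \<xi>)) * complex_of_real (std_gauss (0 + (- s) *\<^sub>R \<xi>))) =
      (\<lambda>\<xi>. complex_of_real A * (iexp (- (u \<bullet> \<xi>)) * complex_of_real (exp (- (s\<^sup>2 * (norm \<xi>)\<^sup>2 / 2)))))"
  proof
    fix \<xi> :: 'a
    have "(u /\<^sub>R s) \<bullet> (0 + (- s) *\<^sub>R \<xi>) = - (u \<bullet> \<xi>)" using s by simp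
    moreover have "std_gauss (0 + (- s) *\<^sub>R \<xi>) = A * exp (- (s\<^sup>2 * (norm \<xi>)\<^sup>2 / 2))"
      unfolding g by (simp add: power_mult_distrib)
    ultimately show "iexp ((u /\<^sub>R s) \<bullet> (0 + (- s) *\<^sub>R \<xi>)) * complex_of_real (std_gauss (0 + (- s) *\<^sub>R \<xi>)) =
      complex_of_real A * (iexp (- (u \<bullet> \<xi>)) * complex_of_real (exp (- (s\<^sup>2 * (norm \<xi>)\<^sup>2 / 2))))"
      by (simp only: of_real_mult mult_ac)
  qed
  also have "(CLINT \<xi>|lborel. complex_of_real A * (iexp (- (u \<bullet> \<xi>)) *
      complex_of_real (exp (- (s\<^sup>2 * (norm \<xi>)\<^sup>2 / 2))))) = complex_of_real A * E"
    unfolding E_def by (rule integral_mult_right_zero)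
  finally have "complex_of_real (std_gauss (u /\<^sub>R s)) =
      complex_of_real (s ^ ?n) * (complex_of_real (A * A) * E)"
    using s by (simp add: scaleR_conv_of_real mult_ac)
  moreover have "complex_of_real ((1 / s) ^ ?n) * complex_of_real (s ^ ?n) = 1"
  proof -
    have "(1 / s) ^ ?n * s ^ ?n = 1" using s by (simp add: power_mult_distrib[symmetric])
    then show ?thesis by (metis of_real_1 of_real_mult)
  qed
  ultimately show ?thesis unfolding AA E_def[symmetric] of_real_mult
    by (metis mult.assoc mult.left_neutral)
qed

section \<open>Gaussian smoothing of a probability measure\<close>

abbreviation char_fun :: "'a::euclidean_space measure \<Rightarrow> 'a \<Rightarrow> complex" where
  "char_fun N \<xi> \<equiv> CLINT x|N. iexp (\<xi> \<bullet> x)"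

text \<open>The Gaussian factor \<open>e\<close> makes the double integral absolutely convergent
  whatever \<open>N\<close> is, so \<open>gaussian_inversion\<close> can be integrated against
  \<open>N\<close> and the order exchanged.\<close>

lemma gaussian_smoothing_density:
  fixes N :: "'a::euclidean_space measure" and y :: 'a
  assumes "prob_space N" and sets[measurable_cong]: "sets N = sets borel" and s: "s > 0"
  shows "complex_of_real (\<integral>x. (1 / s) ^ DIM('a) * std_gauss ((y - x) /\<^sub>R s) \<partial>N) =
    complex_of_real ((1 / (2 * pi)) ^ DIM('a)) * (CLINT \<xi>|lborel. iexp (- (y \<bullet> \<xi>)) *
       char_fun N \<xi> * complex_of_real (exp (- (s\<^sup>2 * (norm \<xi>)\<^sup>2 / 2))))"
proof -
  interpret N: prob_space N by fact
  interpret L: pair_sigma_finite N "lborel :: 'a measure" ..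
  define e where "e \<xi> = complex_of_real (exp (- (s\<^sup>2 * (norm \<xi>)\<^sup>2 / 2)))" for \<xi> :: 'a
  have [measurable]: "e \<in> borel_measurable borel" unfolding e_def by measurable
  have int_e: "integrable lborel e"
    unfolding e_def using integrable_gaussian_exp[OF s] by (intro integrable_of_real)
  have int2: "integrable (N \<Otimes>\<^sub>M lborel) (\<lambda>(x, \<xi>). iexp (- ((y - x) \<bullet> \<xi>)) * e \<xi>)"
  proof (rule L.Fubini_integrable)
    show "(\<lambda>(x, \<xi>). iexp (- ((y - x) \<bullet> \<xi>)) * e \<xi>) \<in> borel_measurable (N \<Otimes>\<^sub>M lborel)" by measurable
    show "integrable N (\<lambda>x. LINT \<xi>|lborel. norm (case (x, \<xi>) of (x, \<xi>) \<Rightarrow> iexp (- ((y - x) \<bullet> \<xi>)) * e \<xi>))"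
      by (simp add: norm_mult)
    show "AE x in N. integrable lborel (\<lambda>\<xi>. case (x, \<xi>) of (x, \<xi>) \<Rightarrow> iexp (- ((y - x) \<bullet> \<xi>)) * e \<xi>)"
      using int_e by (auto intro!: Bochner_Integration.integrable_bound[OF int_e] simp: norm_mult)
  qed
  have "complex_of_real (\<integral>x. (1 / s) ^ DIM('a) * std_gauss ((y - x) /\<^sub>R s) \<partial>N) =
    (CLINT x|N. complex_of_real ((1 / s) ^ DIM('a) * std_gauss ((y - x) /\<^sub>R s)))"
    by (rule integral_complex_of_real[symmetric])
  also have "\<dots> = complex_of_real ((1 / (2 * pi)) ^ DIM('a)) *
      (CLINT x|N. CLINT \<xi>|lborel. iexp (- ((y - x) \<bullet> \<xi>)) * e \<xi>)"
    unfolding gaussian_inversion[OF s] e_def by (rule integral_mult_right_zero)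
  also have "(CLINT x|N. CLINT \<xi>|lborel. iexp (- ((y - x) \<bullet> \<xi>)) * e \<xi>) =
      (CLINT \<xi>|lborel. CLINT x|N. iexp (- ((y - x) \<bullet> \<xi>)) * e \<xi>)"
    using L.Fubini_integral[OF int2] by simp
  also have "(\<lambda>\<xi>. CLINT x|N. iexp (- ((y - x) \<bullet> \<xi>)) * e \<xi>) =
      (\<lambda>\<xi>. iexp (- (y \<bullet> \<xi>)) * char_fun N \<xi> * e \<xi>)"
  proof
    fix \<xi>
    have "(\<lambda>x. iexp (- ((y - x) \<bullet> \<xi>)) * e \<xi>) = (\<lambda>x. (iexp (- (y \<bullet> \<xi>)) * e \<xi>) * iexp (\<xi> \<bullet> x))"
      by (auto simp: inner_diff_left exp_add[symmetric] algebra_simps inner_commute exp_diff exp_minus divide_inverse)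
    then show "(CLINT x|N. iexp (- ((y - x) \<bullet> \<xi>)) * e \<xi>) = iexp (- (y \<bullet> \<xi>)) * char_fun N \<xi> * e \<xi>"
      by (simp add: mult_ac)
  qed
  finally show ?thesis unfolding e_def .
qed

text \<open>The inversion formula for densities. When the characteristic function is integrable, the
  integral is already real, being a limit of real integrals obtained by smoothing; \<open>Re\<close>
  only adjusts the type.\<close>

definition fourier_density :: "'a::euclidean_space measure \<Rightarrow> 'a \<Rightarrow> real" where
  "fourier_density N y = (1 / (2 * pi)) ^ DIM('a) *
     Re (CLINT \<xi>|lborel. iexp (- (y \<bullet> \<xi>)) * char_fun N \<xi>)"

lemma std_gauss_le_1: "std_gauss (z::'a::euclidean_space) \<le> 1"
proof -
  have "1 / sqrt (2 * pi) \<le> 1" using pi_gt3 by (simp add: real_le_rsqrt)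
  then have "(1 / sqrt (2 * pi)) ^ DIM('a) \<le> 1" by (intro power_le_one) auto
  then show ?thesis unfolding std_gauss_eq
    by (intro mult_le_one) auto
qed

text \<open>The density of \<open>N\<close> convolved with the centred Gaussian of standard
  deviation \<open>1 / real (Suc k)\<close>.\<close>

definition smoothed :: "'a::euclidean_space measure \<Rightarrow> nat \<Rightarrow> 'a \<Rightarrow> real" where
  "smoothed N k y = (\<integral>x. (real (Suc k)) ^ DIM('a) * std_gauss (real (Suc k) *\<^sub>R (y - x)) \<partial>N)"

text \<open>The right side is the probability that x + z/n lies in \<open>U\<close>, where x has law
  \<open>N\<close> and z is an independent standard Gaussian. Here \<open>n\<close> enters only
  through the point tested, so Fatou's lemma can be used as \<open>n\<close> grows.\<close>

lemma nn_integral_gaussian_smoothing: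
  fixes N :: "'a::euclidean_space measure"
  assumes prob: "prob_space N" and sets_N [measurable_cong]: "sets N = sets borel"
    and [measurable]: "U \<in> sets borel" and n: "n > 0"
  shows "(\<integral>\<^sup>+y\<in>U. ennreal (\<integral>x. n ^ DIM('a) * std_gauss (n *\<^sub>R (y - x)) \<partial>N) \<partial>lborel) =
    (\<integral>\<^sup>+p. indicator U (fst p + (1 / n) *\<^sub>R snd p) * ennreal (std_gauss (snd p)) \<partial>(N \<Otimes>\<^sub>M lborel))"
proof -
  interpret N: prob_space N by (rule prob)
  interpret L: pair_sigma_finite N "lborel :: 'a measure" ..
  define g where "g x y = n ^ DIM('a) * std_gauss (n *\<^sub>R (y - x))" for x y :: 'a
  have [measurable]: "(\<lambda>p. g (fst p) (snd p)) \<in> borel_measurable (borel \<Otimes>\<^sub>M borel)"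
    "(\<lambda>x. g x y) \<in> borel_measurable borel" "(\<lambda>y. g x y) \<in> borel_measurable borel" for x y
    unfolding g_def by measurable
  have g0: "0 \<le> g x y" for x y unfolding g_def using n by simp
  have "(\<integral>\<^sup>+y\<in>U. ennreal (\<integral>x. g x y \<partial>N) \<partial>lborel) =
    (\<integral>\<^sup>+y. (\<integral>\<^sup>+x. ennreal (g x y) * indicator U y \<partial>N) \<partial>lborel)"
  proof (intro nn_integral_cong)
    fix y
    have "integrable N (\<lambda>x. g x y)"
      by (rule N.integrable_const_bound[of _ "n ^ DIM('a)"])
         (use n in \<open>auto simp: g_def std_gauss_le_1 mult_left_le intro!: always_eventually\<close>)
    then have *: "ennreal (\<integral>x. g x y \<partial>N) = (\<integral>\<^sup>+x. ennreal (g x y) \<partial>N)"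
      using g0 by (subst nn_integral_eq_integral) auto
    show "ennreal (\<integral>x. g x y \<partial>N) * indicator U y = (\<integral>\<^sup>+x. ennreal (g x y) * indicator U y \<partial>N)"
      unfolding * by (rule nn_integral_multc[symmetric]) measurable
  qed
  also have "\<dots> = (\<integral>\<^sup>+x. (\<integral>\<^sup>+y. ennreal (g x y) * indicator U y \<partial>lborel) \<partial>N)"
  proof (rule L.Fubini')
    have "(\<lambda>p. ennreal (g (fst p) (snd p)) * indicator U (snd p)) \<in> borel_measurable (N \<Otimes>\<^sub>M lborel)"
      by measurable
    then show "(\<lambda>(x, y). ennreal (g x y) * indicator U y) \<in> borel_measurable (N \<Otimes>\<^sub>M lborel)"
      by (simp add: case_prod_beta')
  qed
  also have "\<dots> = (\<integral>\<^sup>+x. (\<integral>\<^sup>+z. indicator U (x + (1 / n) *\<^sub>R z) * ennreal (std_gauss z) \<partial>lborel) \<partial>N)"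
  proof (rule nn_integral_cong)
    fix x
    let ?h = "\<lambda>z. indicator U (x + (1 / n) *\<^sub>R z) * ennreal (std_gauss z)"
    have "(\<integral>\<^sup>+z. ?h z \<partial>lborel) = ennreal (\<bar>n\<bar> ^ DIM('a)) * (\<integral>\<^sup>+y. ?h (- (n *\<^sub>R x) + n *\<^sub>R y) \<partial>lborel)"
      using n by (intro lborel_nn_integral_affine) auto
    also have "\<dots> = (\<integral>\<^sup>+y. ennreal (\<bar>n\<bar> ^ DIM('a)) * ?h (- (n *\<^sub>R x) + n *\<^sub>R y) \<partial>lborel)"
      by (rule nn_integral_cmult[symmetric]) measurable
    also have "\<dots> = (\<integral>\<^sup>+y. ennreal (g x y) * indicator U y \<partial>lborel)"
    proof (rule nn_integral_cong)
      fix y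
      have 1: "- (n *\<^sub>R x) + n *\<^sub>R y = n *\<^sub>R (y - x)" by (simp add: algebra_simps)
      show "ennreal (\<bar>n\<bar> ^ DIM('a)) * ?h (- (n *\<^sub>R x) + n *\<^sub>R y) = ennreal (g x y) * indicator U y"
        unfolding 1 g_def using n by (simp add: ennreal_mult' mult_ac)
    qed
    finally show "(\<integral>\<^sup>+y. ennreal (g x y) * indicator U y \<partial>lborel) = (\<integral>\<^sup>+z. ?h z \<partial>lborel)" ..
  qed
  also have "\<dots> = (\<integral>\<^sup>+p. indicator U (fst p + (1 / n) *\<^sub>R snd p) * ennreal (std_gauss (snd p)) \<partial>(N \<Otimes>\<^sub>M lborel))"
  proof -
    have "(\<lambda>p. indicator U (fst p + (1 / n) *\<^sub>R snd p) * ennreal (std_gauss (snd p)))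
        \<in> borel_measurable (N \<Otimes>\<^sub>M lborel)"
      by measurable
    from lborel.nn_integral_fst[OF this] show ?thesis by simp
  qed
  finally show ?thesis by (simp only: g_def)
qed

section \<open>Inversion for integrable characteristic functions\<close>

abbreviation damping :: "nat \<Rightarrow> 'a::euclidean_space \<Rightarrow> complex" where
  "damping k \<xi> \<equiv> complex_of_real (exp (- ((1 / real (Suc k))\<^sup>2 * (norm \<xi>)\<^sup>2 / 2)))"

context
  fixes N :: "'a::euclidean_space measure"
  assumes prob: "prob_space N" and sets_N: "sets N = sets borel"
    and int_char: "integrable lborel (\<lambda>\<xi>. char_fun N \<xi>)"
begin

interpretation N: prob_space N by (rule prob)

lemma isCont_fourier_density: "isCont (fourier_density N) y"
proof -
  note [measurable_cong] = sets_N
  have "isCont (\<lambda>y. CLINT \<xi>|lborel. iexp (- (y \<bullet> \<xi>)) * char_fun N \<xi>) y"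
    unfolding continuous_at_sequentially comp_def
  proof (intro allI impI)
    fix u :: "nat \<Rightarrow> 'a" assume u: "u \<longlonglongrightarrow> y"
    show "(\<lambda>i. CLINT \<xi>|lborel. iexp (- (u i \<bullet> \<xi>)) * char_fun N \<xi>) \<longlonglongrightarrow>
      (CLINT \<xi>|lborel. iexp (- (y \<bullet> \<xi>)) * char_fun N \<xi>)"
    proof (rule integral_dominated_convergence[OF _ _ integrable_norm[OF int_char]])
      show "AE \<xi> in lborel. (\<lambda>i. iexp (- (u i \<bullet> \<xi>)) * char_fun N \<xi>)
        \<longlonglongrightarrow> iexp (- (y \<bullet> \<xi>)) * char_fun N \<xi>"
        by (intro always_eventually allI tendsto_intros u)
    qed (measurable, simp add: norm_mult)
  qed
  then show ?thesis
    unfolding fourier_density_def[abs_def] by (intro continuous_mult continuous_const isCont_Re)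
qed

lemma abs_fourier_density_le:
  "\<bar>fourier_density N y\<bar> \<le> (1 / (2 * pi)) ^ DIM('a) * (LINT \<xi>|lborel. cmod (char_fun N \<xi>))"
proof -
  have "\<bar>Re (CLINT \<xi>|lborel. iexp (- (y \<bullet> \<xi>)) * char_fun N \<xi>)\<bar> \<le>
      cmod (CLINT \<xi>|lborel. iexp (- (y \<bullet> \<xi>)) * char_fun N \<xi>)"
    by (rule abs_Re_le_cmod)
  also have "\<dots> \<le> (LINT \<xi>|lborel. cmod (iexp (- (y \<bullet> \<xi>)) * char_fun N \<xi>))"
    by (rule integral_norm_bound)
  finally show ?thesis
    unfolding fourier_density_def abs_mult by (simp add: norm_mult mult_left_mono)
qed

lemma smoothed_eq:
  "smoothed N k y = (1 / (2 * pi)) ^ DIM('a) *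
     Re (CLINT \<xi>|lborel. iexp (- (y \<bullet> \<xi>)) * char_fun N \<xi> *
           damping k \<xi>)"
proof -
  have "smoothed N k y = Re (complex_of_real (smoothed N k y))" by simp
  also have "complex_of_real (smoothed N k y) = complex_of_real ((1 / (2 * pi)) ^ DIM('a)) *
     (CLINT \<xi>|lborel. iexp (- (y \<bullet> \<xi>)) * char_fun N \<xi> *
           damping k \<xi>)"
    using gaussian_smoothing_density[OF prob sets_N, of "1 / real (Suc k)" y]
    unfolding smoothed_def by (simp del: of_nat_Suc)
  finally show ?thesis by (simp del: of_nat_Suc of_real_power of_real_divide)
qed

text \<open>The bound is uniform in \<open>k\<close> and \<open>y\<close>: on a bounded set it
  dominates all smoothed densities.\<close>

lemma smoothed_le:
  "\<bar>smoothed N k y\<bar> \<le> (1 / (2 * pi)) ^ DIM('a) * (LINT \<xi>|lborel. cmod (char_fun N \<xi>))"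
proof -
  note [measurable_cong] = sets_N
  define F where "F \<xi> = iexp (- (y \<bullet> \<xi>)) * char_fun N \<xi> *
           damping k \<xi>" for \<xi>
  have [measurable]: "F \<in> borel_measurable borel"
    unfolding F_def[abs_def] by measurable
  have le: "cmod (F \<xi>) \<le> cmod (char_fun N \<xi>)" for \<xi>
    unfolding F_def by (simp add: norm_mult mult_left_le)
  have int: "integrable lborel F"
    by (rule Bochner_Integration.integrable_bound[OF int_char]) (use le in auto)
  have "\<bar>Re (integral\<^sup>L lborel F)\<bar> \<le> cmod (integral\<^sup>L lborel F)"
    by (rule abs_Re_le_cmod)
  also have "\<dots> \<le> (LINT \<xi>|lborel. cmod (F \<xi>))"
    by (rule integral_norm_bound)
  also have "\<dots> \<le> (LINT \<xi>|lborel. cmod (char_fun N \<xi>))"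
    by (intro integral_mono integrable_norm int int_char le)
  finally show ?thesis
    unfolding smoothed_eq F_def[symmetric] abs_mult by (simp add: mult_left_mono)
qed

lemma smoothed_tendsto: "(\<lambda>k. smoothed N k y) \<longlonglongrightarrow> fourier_density N y"
  unfolding smoothed_eq fourier_density_def
proof (intro tendsto_intros)
  show "(\<lambda>k. CLINT \<xi>|lborel. iexp (- (y \<bullet> \<xi>)) * char_fun N \<xi> *
           damping k \<xi>)
     \<longlonglongrightarrow> (CLINT \<xi>|lborel. iexp (- (y \<bullet> \<xi>)) * char_fun N \<xi>)"
  proof (rule integral_dominated_convergence[OF _ _ integrable_norm[OF int_char]])
    note [measurable_cong] = sets_N
    show "AE \<xi> in lborel. (\<lambda>k. iexp (- (y \<bullet> \<xi>)) * char_fun N \<xi> *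
           damping k \<xi>)
        \<longlonglongrightarrow> iexp (- (y \<bullet> \<xi>)) * char_fun N \<xi>"
    proof (intro always_eventually allI)
      fix \<xi> :: 'a
      have "(\<lambda>k. damping k \<xi>) \<longlonglongrightarrow>
          complex_of_real (exp (- (0\<^sup>2 * (norm \<xi>)\<^sup>2 / 2)))"
        by (intro tendsto_intros LIMSEQ_Suc[OF lim_1_over_n]) auto
      from tendsto_mult[OF tendsto_const[of "iexp (- (y \<bullet> \<xi>)) * char_fun N \<xi>"] this]
      show "(\<lambda>k. iexp (- (y \<bullet> \<xi>)) * char_fun N \<xi> *
           damping k \<xi>)
        \<longlonglongrightarrow> iexp (- (y \<bullet> \<xi>)) * char_fun N \<xi>" by simp
    qed
    show "(\<lambda>\<xi>. iexp (- (y \<bullet> \<xi>)) * char_fun N \<xi>) \<in> borel_measurable lborel"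
      by measurable
    show "(\<lambda>\<xi>. iexp (- (y \<bullet> \<xi>)) * char_fun N \<xi> *
           damping k \<xi>) \<in> borel_measurable lborel" for k
      by measurable
    show "AE \<xi> in lborel. norm (iexp (- (y \<bullet> \<xi>)) * char_fun N \<xi> *
           damping k \<xi>)
         \<le> norm (char_fun N \<xi>)" for k
      by (intro always_eventually allI) (simp add: norm_mult mult_left_le del: of_nat_Suc)
  qed
qed

lemma smoothed_nonneg: "0 \<le> smoothed N k y"
  unfolding smoothed_def by (intro Bochner_Integration.integral_nonneg) simp

lemma fourier_density_nonneg: "0 \<le> fourier_density N y"
  by (rule LIMSEQ_le_const[OF smoothed_tendsto]) (use smoothed_nonneg in auto)

lemma borel_measurable_fourier_density: "fourier_density N \<in> borel_measurable borel"
  by (intro borel_measurable_continuous_onI continuous_at_imp_continuous_on ballI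
      isCont_fourier_density)

lemma borel_measurable_smoothed: "smoothed N k \<in> borel_measurable borel"
proof -
  note [measurable_cong] = sets_N
  have "(\<lambda>(y, x). real (Suc k) ^ DIM('a) * std_gauss (real (Suc k) *\<^sub>R (y - x)))
      \<in> borel_measurable (borel \<Otimes>\<^sub>M N)"
    by measurable
  then show ?thesis
    unfolding smoothed_def[abs_def]
    by (rule N.borel_measurable_lebesgue_integral)
qed

text \<open>All smoothed densities have mass 1, but Fatou's lemma gives only an inequality in the
  limit; equality follows afterwards from \<open>fourier_inversion\<close>.\<close>

lemma nn_integral_fourier_density_le_1: "(\<integral>\<^sup>+y. ennreal (fourier_density N y) \<partial>lborel) \<le> 1"
proof -
  note [measurable_cong] = sets_N
  have "(\<integral>\<^sup>+y. ennreal (fourier_density N y) \<partial>lborel) = (\<integral>\<^sup>+y. liminf (\<lambda>k. ennreal (smoothed N k y)) \<partial>lborel)"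
    by (intro nn_integral_cong lim_imp_Liminf[symmetric] tendsto_intros smoothed_tendsto) auto
  also have "\<dots> \<le> liminf (\<lambda>k. \<integral>\<^sup>+y. ennreal (smoothed N k y) \<partial>lborel)"
    by (rule nn_integral_liminf) (auto intro: measurable_compose[OF borel_measurable_smoothed])
  also have "(\<lambda>k. \<integral>\<^sup>+y. ennreal (smoothed N k y) \<partial>lborel) = (\<lambda>k. 1)"
  proof
    fix k
    have "(\<integral>\<^sup>+y. ennreal (smoothed N k y) \<partial>lborel) =
       (\<integral>\<^sup>+p. ennreal (std_gauss (snd p)) \<partial>(N \<Otimes>\<^sub>M (lborel :: 'a measure)))"
      using nn_integral_gaussian_smoothing[OF prob sets_N, of UNIV "real (Suc k)"]
      by (simp add: smoothed_def del: of_nat_Suc Bochner_Integration.integral_mult_right_zero)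
    also have "\<dots> = 1"
      by (subst lborel.nn_integral_fst[symmetric])
         (measurable, simp add: nn_integral_std_gauss N.emeasure_space_1)
    finally show "(\<integral>\<^sup>+y. ennreal (smoothed N k y) \<partial>lborel) = 1" .
  qed
  finally show ?thesis by (simp add: Liminf_const)
qed

text \<open>The indicator of an open set is lower semicontinuous and the Gaussian perturbation
  vanishes, so Fatou's lemma bounds the mass of \<open>U\<close> by the limit of its smoothed
  masses. Boundedness of \<open>U\<close> permits dominated convergence of the smoothed
  densities.\<close>

lemma emeasure_le_fourier_density_bounded:
  assumes U: "open U" "bounded U"
  shows "emeasure N U \<le> (\<integral>\<^sup>+y\<in>U. ennreal (fourier_density N y) \<partial>lborel)"
proof -
  note [measurable] = borel_measurable_smoothed borel_measurable_fourier_density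
  note [measurable_cong] = sets_N
  have [measurable]: "U \<in> sets borel" using U by simp
  define C where "C = (1 / (2 * pi)) ^ DIM('a) * (LINT \<xi>|lborel. cmod (char_fun N \<xi>))"
  have "emeasure N U = (\<integral>\<^sup>+p. indicator U (fst p) * ennreal (std_gauss (snd p)) \<partial>(N \<Otimes>\<^sub>M (lborel :: 'a measure)))"
    by (subst lborel.nn_integral_fst[symmetric])
       (measurable, simp add: nn_integral_cmult nn_integral_std_gauss sets_N)
  also have "\<dots> \<le> (\<integral>\<^sup>+p. liminf (\<lambda>k. indicator U (fst p + (1 / real (Suc k)) *\<^sub>R snd p) *
       ennreal (std_gauss (snd p))) \<partial>(N \<Otimes>\<^sub>M lborel))"
  proof (rule nn_integral_mono)
    fix p :: "'a \<times> 'a"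
    show "indicator U (fst p) * ennreal (std_gauss (snd p)) \<le>
      liminf (\<lambda>k. indicator U (fst p + (1 / real (Suc k)) *\<^sub>R snd p) * ennreal (std_gauss (snd p)))"
    proof (cases "fst p \<in> U")
      case True
      have "(\<lambda>k. fst p + (1 / real (Suc k)) *\<^sub>R snd p) \<longlonglongrightarrow> fst p + 0 *\<^sub>R snd p"
        by (intro tendsto_intros LIMSEQ_Suc[OF lim_1_over_n])
      then have "eventually (\<lambda>k. fst p + (1 / real (Suc k)) *\<^sub>R snd p \<in> U) sequentially"
        using U True by (auto simp: tendsto_def)
      then have "eventually (\<lambda>k. ennreal (std_gauss (snd p)) \<le>
         indicator U (fst p + (1 / real (Suc k)) *\<^sub>R snd p) * ennreal (std_gauss (snd p))) sequentially"
        by eventually_elim simp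
      then show ?thesis using True by (simp add: Liminf_bounded)
    qed simp
  qed
  also have "\<dots> \<le> liminf (\<lambda>k. \<integral>\<^sup>+p. indicator U (fst p + (1 / real (Suc k)) *\<^sub>R snd p) *
       ennreal (std_gauss (snd p)) \<partial>(N \<Otimes>\<^sub>M lborel))"
    by (rule nn_integral_liminf) (measurable)
  also have "\<dots> = liminf (\<lambda>k. \<integral>\<^sup>+y\<in>U. ennreal (smoothed N k y) \<partial>lborel)"
    unfolding smoothed_def
    by (subst nn_integral_gaussian_smoothing[OF prob sets_N]) auto
  also have "\<dots> = (\<integral>\<^sup>+y\<in>U. ennreal (fourier_density N y) \<partial>lborel)"
  proof (rule lim_imp_Liminf)
    show "(\<lambda>k. \<integral>\<^sup>+y\<in>U. ennreal (smoothed N k y) \<partial>lborel) \<longlonglongrightarrow> (\<integral>\<^sup>+y\<in>U. ennreal (fourier_density N y) \<partial>lborel)"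
    proof (rule nn_integral_dominated_convergence[where w="\<lambda>y. ennreal C * indicator U y"])
      have "emeasure lborel U < \<infinity>" by (rule emeasure_bounded_finite[OF U(2)])
      then show "(\<integral>\<^sup>+x. ennreal C * indicator U x \<partial>lborel) < \<infinity>"
        by (simp add: nn_integral_cmult ennreal_mult_less_top)
      show "AE y in lborel. ennreal (smoothed N k y) * indicator U y \<le> ennreal C * indicator U y" for k
        using smoothed_le[of k] unfolding C_def
        by (intro always_eventually allI mult_right_mono ennreal_leI) (auto intro: order_trans[OF abs_ge_self])
      show "AE y in lborel. (\<lambda>k. ennreal (smoothed N k y) * indicator U y) \<longlonglongrightarrow> ennreal (fourier_density N y) * indicator U y"
      proof (intro always_eventually allI)
        fix y
        show "(\<lambda>k. ennreal (smoothed N k y) * indicator U y) \<longlonglongrightarrow> ennreal (fourier_density N y) * indicator U y"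
          using tendsto_ennrealI[OF smoothed_tendsto[of y]] by (cases "y \<in> U") simp_all
      qed
    qed measurable
  qed simp
  finally show ?thesis .
qed

text \<open>\<open>N\<close> is dominated by \<open>V\<close> on open sets, hence by outer
  regularity on Borel sets. As \<open>V\<close> has mass at most 1, comparing on a set and on its
  complement leaves no room for strict inequality.\<close>

theorem fourier_inversion: "N = density lborel (\<lambda>y. ennreal (fourier_density N y))"
proof -
  note [measurable] = borel_measurable_fourier_density
  define V where "V = density lborel (\<lambda>y. ennreal (fourier_density N y))"
  have V: "emeasure V A = (\<integral>\<^sup>+y\<in>A. ennreal (fourier_density N y) \<partial>lborel)" if "A \<in> sets borel" for A
    unfolding V_def using that by (subst emeasure_density) auto
  have sets_V: "sets V = sets borel" "space V = UNIV" by (simp_all add: V_def)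
  have V1: "emeasure V UNIV \<le> 1" using nn_integral_fourier_density_le_1 V[of UNIV] by simp
  then have V_fin: "emeasure V UNIV \<noteq> \<infinity>" using order_le_less_trans[OF V1 ennreal_one_less_top] by simp
  have le_open: "emeasure N U \<le> emeasure V U" if "open U" for U
  proof -
    have "incseq (\<lambda>n. U \<inter> ball 0 (real n))"
      by (auto simp: incseq_def)
    moreover have "(\<Union>n. U \<inter> ball 0 (real n)) = U"
      by (auto intro: reals_Archimedean2)
    ultimately have "(SUP n. emeasure N (U \<inter> ball 0 (real n))) = emeasure N U"
      using that by (subst SUP_emeasure_incseq) (auto simp: sets_N)
    moreover have "emeasure N (U \<inter> ball 0 (real n)) \<le> emeasure V U" for n
    proof -
      have "emeasure N (U \<inter> ball 0 (real n)) \<le> emeasure V (U \<inter> ball 0 (real n))"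
        using emeasure_le_fourier_density_bounded[of "U \<inter> ball 0 (real n)"] that
        by (subst V) (auto intro: open_Int bounded_Int)
      also have "\<dots> \<le> emeasure V U"
        using that by (intro emeasure_mono) (auto simp: sets_V)
      finally show ?thesis .
    qed
    ultimately show ?thesis by (metis SUP_least)
  qed
  have le: "emeasure N A \<le> emeasure V A" if A: "A \<in> sets borel" for A
  proof -
    have "emeasure V A = (INF U\<in>{U. A \<subseteq> U \<and> open U}. emeasure V U)"
      using A V_fin by (intro outer_regular) (auto simp: sets_V)
    also have "\<dots> \<ge> emeasure N A"
      by (intro INF_greatest) (auto simp: sets_N intro: order_trans[OF emeasure_mono le_open])
    finally show ?thesis .
  qed
  have "N = V"
  proof (rule measure_eqI)
    show "sets N = sets V" by (simp add: sets_N sets_V)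
    fix A assume "A \<in> sets N"
    then have A: "A \<in> sets borel" by (simp add: sets_N)
    have sp: "space N = UNIV" using sets_eq_imp_space_eq[OF sets_N] by simp
    have "emeasure N A + emeasure N (- A) = 1"
      using A N.emeasure_space_1 sp plus_emeasure[of A N "- A"] by (auto simp: sets_N)
    moreover have "emeasure V A + emeasure V (- A) \<le> 1"
      using A V1 plus_emeasure[of A V "- A"] by (auto simp: sets_V)
    moreover have "emeasure N (- A) \<le> emeasure V (- A)" by (rule le) (use A in auto)
    moreover note le[OF A]
    moreover have "emeasure N (- A) \<noteq> \<infinity>" by simp
    ultimately show "emeasure N A = emeasure V A"
      by (metis (no_types, lifting) add_mono antisym ennreal_add_left_cancel_le add.commute order_trans infinity_ennreal_def)
  qed
  then show ?thesis unfolding V_def .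
qed

end

section \<open>Integrability of the characteristic function\<close>

text \<open>A single term of the exponential series, of an order \<open>m\<close> with
  \<open>\<delta> * real m\<close> at least \<open>d\<close>, already beats the polynomial.\<close>

lemma power_le_const_exp_powr:
  fixes a \<delta> :: real
  assumes a: "a > 0" and \<delta>: "\<delta> > 0"
  shows "\<exists>C\<ge>0. \<forall>r\<ge>1. (1 + r) ^ d \<le> C * exp (a * r powr \<delta>)"
proof -
  obtain m :: nat where m: "real d / \<delta> \<le> real m" using real_arch_simple by blast
  define C where "C = 2 ^ d * fact m / a ^ m"
  have "(1 + r) ^ d \<le> C * exp (a * r powr \<delta>)" if r: "r \<ge> 1" for r
  proof -
    have "(1 + r) ^ d \<le> (2 * r) ^ d" using r by (intro power_mono) auto
    also have "\<dots> = 2 ^ d * r powr real d" using r by (simp add: power_mult_distrib powr_realpow)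
    also have "r powr real d \<le> r powr (\<delta> * real m)"
      using m r \<delta> by (intro powr_mono) (auto simp: field_simps)
    also have "r powr (\<delta> * real m) = (r powr \<delta>) ^ m"
      using r by (simp add: powr_powr[symmetric] powr_realpow)
    finally have 1: "(1 + r) ^ d \<le> 2 ^ d * (r powr \<delta>) ^ m" by simp
    have e: "(a * r powr \<delta>) ^ m / fact m \<le> exp (a * r powr \<delta>)"
    proof -
      have "0 \<le> a * r powr \<delta>" using a by simp
      then have "(\<Sum>n\<in>{m}. (a * r powr \<delta>) ^ n /\<^sub>R fact n) \<le> (\<Sum>n. (a * r powr \<delta>) ^ n /\<^sub>R fact n)"
        by (intro sum_le_suminf summable_exp_generic) auto
      then show ?thesis by (simp add: exp_def divide_inverse mult.commute)
    qed
    then have "(r powr \<delta>) ^ m \<le> fact m / a ^ m * exp (a * r powr \<delta>)"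
      using a by (simp add: power_mult_distrib field_simps)
    then have "2 ^ d * (r powr \<delta>) ^ m \<le> 2 ^ d * (fact m / a ^ m * exp (a * r powr \<delta>))"
      by (intro mult_left_mono) auto
    with 1 show ?thesis by (simp add: C_def)
  qed
  moreover have "C \<ge> 0" using a by (simp add: C_def)
  ultimately show ?thesis by blast
qed

text \<open>The growth of \<phi> beats every power of its argument, and the product of
  \<open>1 + (\<xi> \<bullet> b)\<^sup>2\<close> over the coordinates is at most
  \<open>(1 + (norm \<xi>)\<^sup>2) ^ DIM('a)\<close>. So a multiple of a product of Cauchy
  functions is a majorant.\<close>

lemma integrable_exp_neg_radial:
  fixes \<phi> :: "real \<Rightarrow> real"
  assumes meas: "(\<lambda>\<xi>::'a::euclidean_space. exp (- (t * \<phi> ((norm \<xi>)\<^sup>2)))) \<in> borel_measurable borel"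
    and nonneg: "\<And>r. r \<ge> 0 \<Longrightarrow> \<phi> r \<ge> 0" and t: "t > 0" and c: "c > 0" and \<delta>: "\<delta> > 0"
    and growth: "\<And>r. r \<ge> R \<Longrightarrow> c * r powr \<delta> \<le> \<phi> r"
  shows "integrable lborel (\<lambda>\<xi>::'a. exp (- (t * \<phi> ((norm \<xi>)\<^sup>2))))"
proof -
  let ?d = "DIM('a)"
  obtain C where C: "C \<ge> 0" "\<And>r. r \<ge> 1 \<Longrightarrow> (1 + r) ^ ?d \<le> C * exp ((t * c) * r powr \<delta>)"
    using power_le_const_exp_powr[of "t * c" \<delta> ?d] t c \<delta> by auto
  define R' where "R' = max 1 R"
  \<comment> \<open>The first summand bounds the range where the growth of \<phi> is known, the
    second the range below \<open>R'\<close>, where \<phi> is only known to be nonnegative.\<close>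
  define K where "K = C + (1 + R') ^ ?d"
  have R': "R' \<ge> 1" by (simp add: R'_def)
  have K: "K \<ge> 0" using C R' by (simp add: K_def)
  have bound: "exp (- (t * \<phi> r)) * (1 + r) ^ ?d \<le> K" if r: "r \<ge> 0" for r
  proof (cases "r \<ge> R'")
    case True
    then have "(1 + r) ^ ?d \<le> C * exp ((t * c) * r powr \<delta>)" using C(2) R' by auto
    also have "\<dots> \<le> C * exp (t * \<phi> r)"
      using growth[of r] True t C(1) by (intro mult_left_mono) (auto simp: R'_def mult.assoc)
    finally have "exp (- (t * \<phi> r)) * (1 + r) ^ ?d \<le> exp (- (t * \<phi> r)) * (C * exp (t * \<phi> r))"
      by (intro mult_left_mono) auto
    also have "\<dots> = C" by (simp add: exp_minus)
    finally show ?thesis using R' by (simp add: K_def add_increasing2)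
  next
    case False
    have "exp (- (t * \<phi> r)) * (1 + r) ^ ?d \<le> 1 * (1 + R') ^ ?d"
      using False r nonneg[OF r] t by (intro mult_mono power_mono) auto
    then show ?thesis using C by (simp add: K_def)
  qed
  have cauchy: "integrable lborel (\<lambda>x::real. 1 / (1 + x\<^sup>2))"
    using integrable_inverse_1_plus_square by (simp add: set_integrable_def inverse_eq_divide)
  have int: "integrable lborel (\<lambda>\<xi>::'a. K * (\<Prod>b\<in>Basis. 1 / (1 + (\<xi> \<bullet> b)\<^sup>2)))"
    using lborel_integral_Basis_prod(1)[of "\<lambda>_::'a. \<lambda>x. 1 / (1 + x\<^sup>2)", OF cauchy] by auto
  show ?thesis
  proof (rule Bochner_Integration.integrable_bound[OF int])
    show "AE \<xi>::'a in lborel. norm (exp (- (t * \<phi> ((norm \<xi>)\<^sup>2)))) \<le> norm (K * (\<Prod>b\<in>Basis. 1 / (1 + (\<xi> \<bullet> b)\<^sup>2)))"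
    proof (intro always_eventually allI)
      fix \<xi> :: 'a
      define P where "P = (\<Prod>b\<in>(Basis::'a set). 1 + (\<xi> \<bullet> b)\<^sup>2)"
      have P: "P > 0" unfolding P_def by (intro prod_pos) (auto simp: add_pos_nonneg)
      have "P \<le> (\<Prod>b\<in>(Basis::'a set). 1 + (norm \<xi>)\<^sup>2)"
        unfolding P_def by (intro prod_mono) (auto intro!: power_mono simp: Basis_le_norm abs_le_square_iff[symmetric])
      also have "\<dots> = (1 + (norm \<xi>)\<^sup>2) ^ ?d" by simp
      finally have "exp (- (t * \<phi> ((norm \<xi>)\<^sup>2))) * P \<le> exp (- (t * \<phi> ((norm \<xi>)\<^sup>2))) * (1 + (norm \<xi>)\<^sup>2) ^ ?d"
        by (intro mult_left_mono) auto
      also have "\<dots> \<le> K" by (rule bound) simp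
      finally have "exp (- (t * \<phi> ((norm \<xi>)\<^sup>2))) \<le> K / P" using P by (simp add: field_simps)
      also have "K / P = K * (\<Prod>b\<in>Basis. 1 / (1 + (\<xi> \<bullet> b)\<^sup>2))"
        unfolding P_def by (simp add: prod_dividef)
      finally show "norm (exp (- (t * \<phi> ((norm \<xi>)\<^sup>2)))) \<le> norm (K * (\<Prod>b\<in>Basis. 1 / (1 + (\<xi> \<bullet> b)\<^sup>2)))"
        by simp
    qed
  qed (use meas in auto)
qed

lemma bernstein_fun_nonneg:
  assumes "\<And>t. t > 0 \<Longrightarrow> \<mu> t > 0" "l \<ge> 0"
  shows "bernstein_fun \<mu> l \<ge> 0"
  unfolding bernstein_fun_def set_lebesgue_integral_def using assms
  by (intro Bochner_Integration.integral_nonneg) (auto simp: indicator_def less_imp_le)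

text \<open>The integrand is positive on the half-line, but a divergent Bochner integral would be 0
  by default, so integrability comes first. It rests on the bound of
  \<open>1 - exp (- l * t)\<close> by \<open>max 1 l * min 1 t\<close>.\<close>

lemma bernstein_fun_pos:
  assumes pos: "\<And>t. t > 0 \<Longrightarrow> \<mu> t > 0" and int: "set_integrable lborel {0<..} (\<lambda>t. min 1 t * \<mu> t)"
    and l: "l > 0"
  shows "bernstein_fun \<mu> l > 0"
proof -
  define g where "g t = indicator {0<..} t *\<^sub>R (min 1 t * \<mu> t)" for t :: real
  define f where "f t = indicator {0<..} t *\<^sub>R ((1 - exp (- l * t)) * \<mu> t)" for t :: real
  have g: "integrable lborel g" using int unfolding set_integrable_def g_def .
  then have [measurable]: "g \<in> borel_measurable borel" by auto
  \<comment> \<open>Writing \<open>f\<close> as a measurable factor times the integrable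
    \<open>g\<close> yields its measurability.\<close>
  have fg: "f t = (1 - exp (- l * t)) / min 1 t * g t" for t
    by (auto simp: f_def g_def indicator_def)
  have [measurable]: "f \<in> borel_measurable borel"
    unfolding fg[abs_def] by measurable
  have le: "\<bar>f t\<bar> \<le> \<bar>max 1 l * g t\<bar>" for t
  proof (cases "t > 0")
    case True
    have "1 - exp (- l * t) \<le> l * t" using exp_ge_add_one_self[of "- l * t"] by simp
    moreover have "1 - exp (- l * t) \<le> max 1 l" by (rule order_trans[of _ 1]) auto
    moreover have "l * t \<le> max 1 l * t" using True by (intro mult_right_mono) auto
    ultimately have "1 - exp (- l * t) \<le> max 1 l * min 1 t"
      by (cases "t \<le> 1") (auto simp: min_def)
    then have "(1 - exp (- l * t)) * \<mu> t \<le> max 1 l * min 1 t * \<mu> t"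
      using pos[OF True] by (intro mult_right_mono) auto
    moreover have "0 \<le> (1 - exp (- l * t)) * \<mu> t" using pos[OF True] l True by simp
    ultimately show ?thesis using True by (simp add: f_def g_def mult.assoc)
  qed (simp add: f_def g_def)
  have f: "integrable lborel f"
    by (rule Bochner_Integration.integrable_bound[of _ "\<lambda>t. max 1 l * g t"]) (use g le in auto)
  have f0: "f t \<ge> 0" for t using pos[of t] l by (auto simp: f_def indicator_def)
  have "integral\<^sup>L lborel f \<noteq> 0"
  proof
    assume "integral\<^sup>L lborel f = 0"
    then have "AE t in lborel. f t = 0"
      using integral_nonneg_eq_0_iff_AE[OF f] f0 by auto
    then have "AE t in lborel. t \<notin> {0<..<1::real}"
    proof eventually_elim
      case (elim t) then show ?case using pos[of t] l by (auto simp: f_def indicator_def split: if_splits)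
    qed
    then have "emeasure lborel {0<..<1::real} = 0"
      by (subst (asm) AE_iff_null_sets[symmetric]) auto
    then show False by simp
  qed
  moreover have "integral\<^sup>L lborel f \<ge> 0" using f0 by (intro Bochner_Integration.integral_nonneg)
  ultimately show ?thesis
    unfolding bernstein_fun_def set_lebesgue_integral_def f_def by simp
qed

lemma weak_scaling_growth:
  assumes "weak_scaling \<phi> R0 \<delta>1 \<delta>2 a1 a2" "R0 > 0" "a1 > 0" "\<phi> R0 > 0" "R0 \<le> r"
  shows "a1 * \<phi> R0 * R0 powr (- \<delta>1) * r powr \<delta>1 \<le> \<phi> r"
proof -
  have "a1 * (r / R0) powr \<delta>1 \<le> \<phi> r / \<phi> R0"
    using assms unfolding weak_scaling_def by blast
  then have "a1 * (r / R0) powr \<delta>1 * \<phi> R0 \<le> \<phi> r"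
    using assms by (simp add: pos_le_divide_eq)
  moreover have "(r / R0) powr \<delta>1 = R0 powr (- \<delta>1) * r powr \<delta>1"
    using assms by (simp add: powr_divide powr_minus field_simps)
  ultimately show ?thesis by (simp add: mult_ac)
qed

text \<open>The explicit upper bound is kept because, for the process at time \<open>t\<close>, it
  tends to 0 as \<open>t\<close> grows; this drives the extinction of the killed process.\<close>

lemma density_of_integrable_char:
  fixes Y :: "'w \<Rightarrow> 'a::euclidean_space" and c :: "'a \<Rightarrow> real"
  assumes "prob_space M" and Y[measurable]: "Y \<in> borel_measurable M"
    and char: "\<And>\<xi>. (CLINT w|M. iexp (\<xi> \<bullet> Y w)) = complex_of_real (c \<xi>)"
    and int: "integrable lborel c" and c0: "\<And>\<xi>. c \<xi> \<ge> 0"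
  shows "\<exists>q. (\<forall>y. isCont q y \<and> 0 \<le> q y \<and> q y \<le> (1 / (2 * pi)) ^ DIM('a) * (LINT \<xi>|lborel. c \<xi>)) \<and>
     distr M borel Y = density lborel (\<lambda>y. ennreal (q y))"
proof -
  interpret prob_space M by fact
  define N where "N = distr M borel Y"
  have N: "prob_space N" "sets N = sets borel" by (auto simp: N_def intro: prob_space_distr)
  have char': "char_fun N \<xi> = complex_of_real (c \<xi>)" for \<xi>
    unfolding N_def by (subst integral_distr) (auto simp: char)
  have int': "integrable lborel (\<lambda>\<xi>. char_fun N \<xi>)"
    unfolding char' using int by (rule integrable_of_real)
  have "(LINT \<xi>|lborel. cmod (char_fun N \<xi>)) = (LINT \<xi>|lborel. c \<xi>)"
    unfolding char' using c0 by (intro Bochner_Integration.integral_cong) auto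
  then have "fourier_density N y \<le> (1 / (2 * pi)) ^ DIM('a) * (LINT \<xi>|lborel. c \<xi>)" for y
    using abs_fourier_density_le[OF N int', of y] by simp
  then show ?thesis
    using isCont_fourier_density[OF N int'] fourier_density_nonneg[OF N int'] fourier_inversion[OF N int']
    by (intro exI[of _ "fourier_density N"]) (auto simp: N_def)
qed

text \<open>The function at time 1 dominates; pointwise convergence holds where \<phi> is positive,
  that is, off the origin, a null set.\<close>

lemma integral_exp_neg_radial_tendsto_0:
  fixes \<phi> :: "real \<Rightarrow> real"
  assumes int: "integrable lborel (\<lambda>\<xi>::'a::euclidean_space. exp (- (1 * \<phi> ((norm \<xi>)\<^sup>2))))"
    and meas: "\<And>n. (\<lambda>\<xi>::'a. exp (- (real (Suc n) * \<phi> ((norm \<xi>)\<^sup>2)))) \<in> borel_measurable borel"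
    and nonneg: "\<And>r. r \<ge> 0 \<Longrightarrow> \<phi> r \<ge> 0" and pos: "\<And>r. r > 0 \<Longrightarrow> \<phi> r > 0"
  shows "(\<lambda>n. LINT \<xi>::'a|lborel. exp (- (real (Suc n) * \<phi> ((norm \<xi>)\<^sup>2)))) \<longlonglongrightarrow> 0"
proof -
  have "(\<lambda>n. LINT \<xi>::'a|lborel. exp (- (real (Suc n) * \<phi> ((norm \<xi>)\<^sup>2)))) \<longlonglongrightarrow> (LINT \<xi>::'a|lborel. 0)"
  proof (rule integral_dominated_convergence[OF _ _ int])
    have "AE \<xi>::'a in lborel. \<xi> \<noteq> 0" by (rule AE_lborel_singleton)
    then show "AE \<xi>::'a in lborel. (\<lambda>n. exp (- (real (Suc n) * \<phi> ((norm \<xi>)\<^sup>2)))) \<longlonglongrightarrow> 0"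
    proof eventually_elim
      case (elim \<xi>)
      then have p: "\<phi> ((norm \<xi>)\<^sup>2) > 0" by (intro pos) simp
      have "(\<lambda>n. exp (- \<phi> ((norm \<xi>)\<^sup>2)) ^ n) \<longlonglongrightarrow> 0"
        using p by (intro LIMSEQ_realpow_zero) auto
      then have "(\<lambda>n. exp (- \<phi> ((norm \<xi>)\<^sup>2)) ^ Suc n) \<longlonglongrightarrow> 0" by (rule LIMSEQ_Suc)
      then show ?case
        unfolding exp_of_nat_mult[symmetric] by (simp add: mult.commute)
    qed
    show "AE \<xi>::'a in lborel. norm (exp (- (real (Suc n) * \<phi> ((norm \<xi>)\<^sup>2)))) \<le> exp (- (1 * \<phi> ((norm \<xi>)\<^sup>2)))" for n
    proof (intro always_eventually allI)
      fix \<xi> :: 'a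
      have "1 * \<phi> ((norm \<xi>)\<^sup>2) \<le> real (Suc n) * \<phi> ((norm \<xi>)\<^sup>2)"
        using nonneg[of "(norm \<xi>)\<^sup>2"] by (intro mult_right_mono) auto
      then show "norm (exp (- (real (Suc n) * \<phi> ((norm \<xi>)\<^sup>2)))) \<le> exp (- (1 * \<phi> ((norm \<xi>)\<^sup>2)))" by simp
    qed
  qed (use meas in auto)
  then show ?thesis by simp
qed

section \<open>The Markov property\<close>

abbreviation path_space :: "(real \<Rightarrow> 'a::euclidean_space) measure" where
  "path_space \<equiv> PiM UNIV (\<lambda>_. borel)"

definition stopped :: "real \<Rightarrow> (real \<Rightarrow> 'a) \<Rightarrow> real \<Rightarrow> 'a" where
  "stopped s p t = p (min t s)"

text \<open>The truncation \<open>max t 0\<close> makes the shifted path vanish at times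
  \<open>t \<le> 0\<close>, as \<open>path\<close> does, so that the two can have the same law on
  all of \<open>path_space\<close>.\<close>

definition shifted :: "real \<Rightarrow> (real \<Rightarrow> 'a::euclidean_space) \<Rightarrow> real \<Rightarrow> 'a" where
  "shifted s p t = p (s + max t 0) - p s"

lemma space_path_space [simp]: "space path_space = UNIV"
  by (simp add: space_PiM)

text \<open>Independence of increments is stated along strictly increasing time sequences, so a
  finite set of times is listed in order. The list determines \<open>t\<close> up to index
  \<open>n\<close> only, hence the bound in the last clause.\<close>

lemma ex_time_grid:
  fixes T :: "real set"
  assumes "finite T" "0 \<in> T" and nonneg: "\<And>u. u \<in> T \<Longrightarrow> 0 \<le> u"
  obtains n t where "\<And>i. i < n \<Longrightarrow> t i < t (Suc i)" "T = t ` {..n::nat}" "t 0 = 0"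
    "\<And>i j. i \<le> j \<Longrightarrow> j \<le> n \<Longrightarrow> t i \<le> t j"
proof -
  define l where "l = sorted_list_of_set T"
  have l: "set l = T" "sorted_wrt (<) l" using assms by (auto simp: l_def strict_sorted_iff)
  have ne: "l \<noteq> []" using assms l by auto
  define n t where "n = length l - 1" and "t = (!) l"
  have step: "t i < t (Suc i)" if "i < n" for i
    using that l(2) unfolding n_def t_def by (auto intro: sorted_wrt_nth_less)
  have "{..n} = {..<length l}" using ne unfolding n_def by (cases l) auto
  then have T: "T = t ` {..n}"
    using l(1) by (auto simp: t_def set_conv_nth image_iff)
  have mono: "t i \<le> t j" if "i \<le> j" "j \<le> n" for i j
    using that by (induction rule: dec_induct) (auto intro: order_trans[OF _ less_imp_le[OF step]])
  obtain i where "i \<le> n" "t i = 0" using assms(2) unfolding T by force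
  then have "t 0 = 0" using mono[of 0 i] nonneg[of "t 0"] T by fastforce
  then show thesis using step T mono by (intro that)
qed

text \<open>Right continuity and the value 0 at times \<open>t \<le> 0\<close> hold for every
  outcome, so path arguments need no exceptional set. \<open>levy_process_rc_version\<close>
  provides such a version of a given process.\<close>

locale rc_levy = prob_space M for M :: "'w measure" +
  fixes X :: "real \<Rightarrow> 'w \<Rightarrow> 'a::euclidean_space"
  assumes X_meas [measurable]: "\<And>t. X t \<in> borel_measurable M"
    and X_nonpos: "\<And>t w. t \<le> 0 \<Longrightarrow> X t w = 0"
    and X_rc: "\<And>t w. 0 \<le> t \<Longrightarrow> ((\<lambda>s. X s w) \<longlongrightarrow> X t w) (at_right t)"
    and indep_increments: "\<And>n t. 0 \<le> t 0 \<Longrightarrow> (\<And>i. i < n \<Longrightarrow> t i < t (Suc i)) \<Longrightarrow>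
        indep_vars (\<lambda>_. borel) (\<lambda>i w. X (t (Suc i)) w - X (t i) w) {..<n::nat}"
    and stationary: "\<And>s t. 0 \<le> s \<Longrightarrow> 0 \<le> t \<Longrightarrow>
        distr M borel (\<lambda>w. X (s + t) w - X s w) = distr M borel (X t)"
begin

definition path :: "'w \<Rightarrow> real \<Rightarrow> 'a" where "path w t = X t w"

lemma measurable_path [measurable]: "path \<in> M \<rightarrow>\<^sub>M path_space"
  and measurable_stopped_path [measurable]: "(\<lambda>w. stopped s (path w)) \<in> M \<rightarrow>\<^sub>M path_space"
  and measurable_shifted_path [measurable]: "(\<lambda>w. shifted s (path w)) \<in> M \<rightarrow>\<^sub>M path_space"
  unfolding path_def[abs_def] stopped_def[abs_def] shifted_def[abs_def]
  by (intro measurable_PiM_single'; simp)+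

lemma measurable_path_eval [measurable]: "(\<lambda>w. path w r) \<in> borel_measurable M"
  unfolding path_def by measurable

lemma sum_increments: "i \<le> j \<Longrightarrow> (\<Sum>l\<in>{i..<j}. X (t (Suc l)) w - X (t l) w) = X (t j) w - X (t i) w"
  by (rule sum_Suc_diff'[of i j "\<lambda>l. X (t l) w"])

text \<open>On one time grid through \<open>s\<close>, stopped values are sums of increments before
  \<open>s\<close> and shifted values are sums of increments after \<open>s\<close>; disjoint blocks
  of independent increments are independent.\<close>

lemma finite_dim_indep:
  assumes s: "s \<ge> 0" and J: "finite J" and K: "finite K"
  shows "indep_var (PiM J (\<lambda>_. borel)) (\<lambda>w. \<lambda>j\<in>J. stopped s (path w) j)
    (PiM K (\<lambda>_. borel)) (\<lambda>w. \<lambda>k\<in>K. shifted s (path w) k)"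
proof -
  \<comment> \<open>The grid starts at 0, where the process vanishes, so that every stopped value is
    a sum of increments.\<close>
  define T where "T = insert 0 (insert s ((\<lambda>j. max 0 (min j s)) ` J \<union> (\<lambda>k. s + max k 0) ` K))"
  obtain n t where t: "\<And>i. i < n \<Longrightarrow> t i < t (Suc i)" and T_eq: "T = t ` {..n::nat}" and t0: "t 0 = 0"
    and mono: "\<And>i j. i \<le> j \<Longrightarrow> j \<le> n \<Longrightarrow> t i \<le> t j"
    by (rule ex_time_grid[of T]) (use J K s in \<open>auto simp: T_def\<close>)
  have smono: "t i < t j" if "i < j" "j \<le> n" for i j
  proof -
    have "t i < t (Suc i)" using that by (intro t) auto
    also have "\<dots> \<le> t j" using that by (intro mono) auto
    finally show ?thesis .
  qed
  have "s \<in> T" by (simp add: T_def)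
  then obtain i0 where i0: "i0 \<le> n" "t i0 = s" unfolding T_eq by force
  define D where "D i w = X (t (Suc i)) w - X (t i) w" for i w
  have ind: "indep_vars (\<lambda>_. borel) D {..<n}"
    unfolding D_def[abs_def] by (rule indep_increments) (use t t0 in auto)
  have blocks: "indep_var (PiM {..<i0} (\<lambda>_. borel)) (\<lambda>w. \<lambda>i\<in>{..<i0}. D i w)
      (PiM {i0..<n} (\<lambda>_. borel)) (\<lambda>w. \<lambda>i\<in>{i0..<n}. D i w)"
    by (rule indep_var_restrict[OF ind]) (use i0 in auto)
  have "\<exists>i. i \<le> i0 \<and> t i = max 0 (min j s)" if "j \<in> J" for j
  proof -
    have "max 0 (min j s) \<in> T" using that by (auto simp: T_def)
    then obtain i where i: "i \<le> n" "t i = max 0 (min j s)" unfolding T_eq by force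
    have "i \<le> i0"
    proof (rule ccontr)
      assume "\<not> i \<le> i0" then have "t i0 < t i" using i by (intro smono) auto
      then show False using i i0 s by auto
    qed
    then show ?thesis using i by blast
  qed
  then obtain a where a: "\<And>j. j \<in> J \<Longrightarrow> a j \<le> i0" "\<And>j. j \<in> J \<Longrightarrow> t (a j) = max 0 (min j s)"
    by metis
  have "\<exists>i. i0 \<le> i \<and> i \<le> n \<and> t i = s + max k 0" if "k \<in> K" for k
  proof -
    have "s + max k 0 \<in> T" using that by (auto simp: T_def)
    then obtain i where i: "i \<le> n" "t i = s + max k 0" unfolding T_eq by force
    have "i0 \<le> i"
    proof (rule ccontr)
      assume "\<not> i0 \<le> i" then have "t i < t i0" using i0 by (intro smono) auto
      then show False using i i0 s by auto
    qed
    then show ?thesis using i by blast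
  qed
  then obtain b where b: "\<And>k. k \<in> K \<Longrightarrow> i0 \<le> b k" "\<And>k. k \<in> K \<Longrightarrow> b k \<le> n" "\<And>k. k \<in> K \<Longrightarrow> t (b k) = s + max k 0"
    by metis
  define f where "f v = (\<lambda>j\<in>J. \<Sum>i<a j. v i)" for v :: "nat \<Rightarrow> 'a"
  define g where "g v = (\<lambda>k\<in>K. \<Sum>i\<in>{i0..<b k}. v i)" for v :: "nat \<Rightarrow> 'a"
  have f: "f \<in> PiM {..<i0} (\<lambda>_. borel) \<rightarrow>\<^sub>M PiM J (\<lambda>_. borel)"
    unfolding f_def
    by (rule measurable_restrict) (auto dest!: a(1) intro!: borel_measurable_sum measurable_component_singleton)
  have g: "g \<in> PiM {i0..<n} (\<lambda>_. borel) \<rightarrow>\<^sub>M PiM K (\<lambda>_. borel)"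
    unfolding g_def
    by (rule measurable_restrict) (auto dest!: b(2) intro!: borel_measurable_sum measurable_component_singleton)
  have "indep_var (PiM J (\<lambda>_. borel)) (f \<circ> (\<lambda>w. \<lambda>i\<in>{..<i0}. D i w))
      (PiM K (\<lambda>_. borel)) (g \<circ> (\<lambda>w. \<lambda>i\<in>{i0..<n}. D i w))"
    by (rule indep_var_compose[OF blocks f g])
  moreover have "f \<circ> (\<lambda>w. \<lambda>i\<in>{..<i0}. D i w) = (\<lambda>w. \<lambda>j\<in>J. stopped s (path w) j)"
  proof
    fix w
    have "(\<Sum>i<a j. (\<lambda>i\<in>{..<i0}. D i w) i) = stopped s (path w) j" if "j \<in> J" for j
    proof -
      have "(\<Sum>i<a j. (\<lambda>i\<in>{..<i0}. D i w) i) = (\<Sum>i\<in>{0..<a j}. D i w)"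
        using a(1)[OF that] by (intro sum.cong) auto
      also have "\<dots> = X (max 0 (min j s)) w"
        unfolding D_def by (subst sum_increments) (auto simp: t0 X_nonpos a(2)[OF that])
      also have "\<dots> = stopped s (path w) j"
        by (cases "min j s \<ge> 0") (auto simp: stopped_def path_def X_nonpos max_def)
      finally show ?thesis .
    qed
    then show "(f \<circ> (\<lambda>w. \<lambda>i\<in>{..<i0}. D i w)) w = (\<lambda>j\<in>J. stopped s (path w) j)"
      by (auto simp: f_def intro!: restrict_ext)
  qed
  moreover have "g \<circ> (\<lambda>w. \<lambda>i\<in>{i0..<n}. D i w) = (\<lambda>w. \<lambda>k\<in>K. shifted s (path w) k)"
  proof
    fix w
    have "(\<Sum>i\<in>{i0..<b k}. (\<lambda>i\<in>{i0..<n}. D i w) i) = shifted s (path w) k" if "k \<in> K" for k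
    proof -
      have "(\<Sum>i\<in>{i0..<b k}. (\<lambda>i\<in>{i0..<n}. D i w) i) = (\<Sum>i\<in>{i0..<b k}. D i w)"
        using b(2)[OF that] by (intro sum.cong) auto
      also have "\<dots> = shifted s (path w) k"
        unfolding D_def using b[OF that] by (subst sum_increments) (auto simp: i0 shifted_def path_def)
      finally show ?thesis .
    qed
    then show "(g \<circ> (\<lambda>w. \<lambda>i\<in>{i0..<n}. D i w)) w = (\<lambda>k\<in>K. shifted s (path w) k)"
      by (auto simp: g_def intro!: restrict_ext)
  qed
  ultimately show ?thesis by simp
qed

text \<open>The increments along a grid translated by \<open>r\<close> have a product law whose
  factors depend only on the step lengths, and the shifted values are the same function
  \<open>g\<close> of them for every \<open>r\<close>. Compare \<open>r = s\<close> with
  \<open>r = 0\<close>.\<close>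

lemma finite_dim_stationary:
  assumes s: "s \<ge> 0" and K: "finite K"
  shows "distr M (PiM K (\<lambda>_. borel)) (\<lambda>w. \<lambda>k\<in>K. shifted s (path w) k) =
    distr M (PiM K (\<lambda>_. borel)) (\<lambda>w. \<lambda>k\<in>K. path w k)"
proof -
  \<comment> \<open>The extra time 1 guarantees at least one increment, so that the index set in the
    product characterisation of independence is nonempty.\<close>
  define T where "T = insert 0 (insert 1 ((\<lambda>k. max k 0) ` K))"
  obtain n t where t: "\<And>i. i < n \<Longrightarrow> t i < t (Suc i)" and T_eq: "T = t ` {..n::nat}" and t0: "t 0 = 0"
    and mono: "\<And>i j. i \<le> j \<Longrightarrow> j \<le> n \<Longrightarrow> t i \<le> t j"
    by (rule ex_time_grid[of T]) (use K in \<open>auto simp: T_def\<close>)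
  have n: "n > 0"
  proof (rule ccontr)
    assume "\<not> n > 0" then have "T = {0}" using T_eq t0 by auto
    moreover have "1 \<in> T" by (simp add: T_def)
    ultimately show False by simp
  qed
  have tn: "t i \<ge> 0" if "i \<le> n" for i using mono[of 0 i] that t0 by simp
  define D where "D r i w = X (r + t (Suc i)) w - X (r + t i) w" for r i w
  have [measurable]: "D r i \<in> borel_measurable M" for r i unfolding D_def[abs_def] by measurable
  have ind: "indep_vars (\<lambda>_. borel) (D r) {..<n}" if "r \<ge> 0" for r
    unfolding D_def[abs_def] using indep_increments[of "\<lambda>i. r + t i" n] t t0 that by simp
  have marg: "distr M borel (D r i) = distr M borel (X (t (Suc i) - t i))" if "r \<ge> 0" "i < n" for r i
    using stationary[of "r + t i" "t (Suc i) - t i"] that t[of i] tn[of i]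
    unfolding D_def[abs_def] by simp
  have joint: "distr M (PiM {..<n} (\<lambda>_. borel)) (\<lambda>w. \<lambda>i\<in>{..<n}. D r i w) =
      PiM {..<n} (\<lambda>i. distr M borel (X (t (Suc i) - t i)))" if r: "r \<ge> 0" for r
  proof -
    have "distr M (PiM {..<n} (\<lambda>_. borel)) (\<lambda>w. \<lambda>i\<in>{..<n}. D r i w) = PiM {..<n} (\<lambda>i. distr M borel (D r i))"
      using indep_vars_iff_distr_eq_PiM[of "{..<n}" "D r" "\<lambda>_. borel"] ind[OF r] n by auto
    also have "\<dots> = PiM {..<n} (\<lambda>i. distr M borel (X (t (Suc i) - t i)))"
      using marg[OF r] by (intro PiM_cong) auto
    finally show ?thesis .
  qed
  have "\<exists>i. i \<le> n \<and> t i = max k 0" if "k \<in> K" for k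
  proof -
    have "max k 0 \<in> T" using that by (auto simp: T_def)
    then show ?thesis unfolding T_eq by force
  qed
  then obtain b where b: "\<And>k. k \<in> K \<Longrightarrow> b k \<le> n" "\<And>k. k \<in> K \<Longrightarrow> t (b k) = max k 0"
    by metis
  define g where "g v = (\<lambda>k\<in>K. \<Sum>i<b k. v i)" for v :: "nat \<Rightarrow> 'a"
  have g: "g \<in> PiM {..<n} (\<lambda>_. borel) \<rightarrow>\<^sub>M PiM K (\<lambda>_. borel)"
    unfolding g_def
    by (rule measurable_restrict) (auto dest!: b(1) intro!: borel_measurable_sum measurable_component_singleton)
  have gD: "g (\<lambda>i\<in>{..<n}. D r i w) = (\<lambda>k\<in>K. shifted r (path w) k)" for r w
  proof -
    have "(\<Sum>i<b k. (\<lambda>i\<in>{..<n}. D r i w) i) = shifted r (path w) k" if "k \<in> K" for k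
    proof -
      have "(\<Sum>i<b k. (\<lambda>i\<in>{..<n}. D r i w) i) = (\<Sum>i\<in>{0..<b k}. D r i w)"
        using b(1)[OF that] by (intro sum.cong) auto
      also have "\<dots> = shifted r (path w) k"
        unfolding D_def using sum_increments[of 0 "b k" "\<lambda>i. r + t i" w]
        by (simp add: t0 b(2)[OF that] shifted_def path_def)
      finally show ?thesis .
    qed
    then show ?thesis by (auto simp: g_def intro!: restrict_ext)
  qed
  have m: "(\<lambda>w. \<lambda>i\<in>{..<n}. D r i w) \<in> M \<rightarrow>\<^sub>M PiM {..<n} (\<lambda>_. borel)" for r
    by (rule measurable_restrict) simp
  have law: "distr M (PiM K (\<lambda>_. borel)) (\<lambda>w. \<lambda>k\<in>K. shifted r (path w) k) =
      distr (PiM {..<n} (\<lambda>i. distr M borel (X (t (Suc i) - t i)))) (PiM K (\<lambda>_. borel)) g" if "r \<ge> 0" for r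
    unfolding joint[OF that, symmetric] using distr_distr[OF g m, of r] by (simp add: comp_def gD)
  have "shifted 0 (path w) k = path w k" for w k
    by (cases "k \<ge> 0") (auto simp: shifted_def path_def X_nonpos max_def)
  then show ?thesis using law[OF s] law[of 0] by simp
qed

lemma law_shifted: 
  assumes s: "s \<ge> 0"
  shows "distr M path_space (\<lambda>w. shifted s (path w)) = distr M path_space path"
proof (rule measure_eqI_PiM_infinite)
  fix A :: "real \<Rightarrow> 'a set" and J :: "real set"
  assume J: "finite J" and A: "\<And>i. i \<in> J \<Longrightarrow> A i \<in> sets borel"
  have *: "emeasure (distr M path_space f) (prod_emb UNIV (\<lambda>_. borel) J (Pi\<^sub>E J A)) =
     emeasure (distr M (PiM J (\<lambda>_. borel)) (\<lambda>w. \<lambda>j\<in>J. f w j)) (Pi\<^sub>E J A)"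
    if [measurable]: "f \<in> M \<rightarrow>\<^sub>M path_space" for f
  proof -
    have "Pi\<^sub>E J A \<in> sets (PiM J (\<lambda>_. borel))" using J A by (intro sets_PiM_I_finite) auto
    moreover have "(\<lambda>w. \<lambda>j\<in>J. f w j) \<in> M \<rightarrow>\<^sub>M PiM J (\<lambda>_. borel)"
      by (intro measurable_restrict) measurable
    moreover have "prod_emb UNIV (\<lambda>_. borel) J (Pi\<^sub>E J A) \<in> sets path_space"
      using J A by (intro sets_PiM_I) auto
    ultimately show ?thesis
      by (subst (1 2) emeasure_distr) (auto simp: prod_emb_def intro!: arg_cong[where f="emeasure M"])
  qed
  show "emeasure (distr M path_space (\<lambda>w. shifted s (path w))) (prod_emb UNIV (\<lambda>_. borel) J (Pi\<^sub>E J A)) =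
     emeasure (distr M path_space path) (prod_emb UNIV (\<lambda>_. borel) J (Pi\<^sub>E J A))"
    by (subst (1 2) *) (simp_all add: finite_dim_stationary[OF s J])
qed (auto intro!: finite_measure.finite_measure_distr prob_space.finite_measure prob_space_distr)

text \<open>Cylinder events are stable under intersection and generate both \<sigma>-algebras, so
  \<open>finite_dim_indep\<close> suffices.\<close>

lemma indep_stopped_shifted:
  assumes s: "s \<ge> 0"
  shows "indep_var path_space (\<lambda>w. stopped s (path w)) path_space (\<lambda>w. shifted s (path w))"
proof -
  let ?X = "\<lambda>w. stopped s (path w)" and ?Y = "\<lambda>w. shifted s (path w)"
  let ?G = "\<lambda>f :: 'w \<Rightarrow> real \<Rightarrow> 'a. {f -` A \<inter> space M | A. A \<in> prod_algebra UNIV (\<lambda>_. borel)}"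
  have gen: "{f -` A \<inter> space M | A. A \<in> sets path_space} = sigma_sets (space M) (?G f)"
    for f :: "'w \<Rightarrow> real \<Rightarrow> 'a"
    unfolding sets_PiM by (rule sigma_sets_vimage_commute) auto
  have ss: "sigma_sets (space M) (sigma_sets (space M) (?G f)) = sigma_sets (space M) (?G f)"
    for f :: "'w \<Rightarrow> real \<Rightarrow> 'a"
    by (rule sigma_sets_sigma_sets_eq) auto
  have int: "Int_stable (?G f)" for f :: "'w \<Rightarrow> real \<Rightarrow> 'a"
  proof (rule Int_stableI, safe)
    fix A B :: "(real \<Rightarrow> 'a) set"
    assume "A \<in> prod_algebra UNIV (\<lambda>_. borel)" "B \<in> prod_algebra UNIV (\<lambda>_. borel)"
    then have "A \<inter> B \<in> prod_algebra UNIV (\<lambda>_. borel)"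
      using Int_stable_prod_algebra unfolding Int_stable_def by blast
    then show "\<exists>C. f -` A \<inter> space M \<inter> (f -` B \<inter> space M) = f -` C \<inter> space M \<and> C \<in> prod_algebra UNIV (\<lambda>_. borel)"
      by (intro exI[of _ "A \<inter> B"]) auto
  qed
  have sub: "?G f \<subseteq> events" if "f \<in> M \<rightarrow>\<^sub>M path_space" for f
    using measurable_sets[OF that] by (auto simp: sets_PiM)
  have "indep_set (?G ?X) (?G ?Y)"
  proof (rule indep_setI)
    show "?G ?X \<subseteq> events" by (rule sub) measurable
    show "?G ?Y \<subseteq> events" by (rule sub) measurable
    fix a b assume "a \<in> ?G ?X" "b \<in> ?G ?Y"
    then obtain A B where A: "A \<in> prod_algebra UNIV (\<lambda>_. borel)" "a = ?X -` A \<inter> space M"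
      and B: "B \<in> prod_algebra UNIV (\<lambda>_. borel)" "b = ?Y -` B \<inter> space M"
      by blast
    obtain J E where J: "A = prod_emb UNIV (\<lambda>_. borel) J (Pi\<^sub>E J E)" "finite J" "\<And>j. j \<in> J \<Longrightarrow> E j \<in> sets borel"
      using A(1) by (rule prod_algebraE) blast
    obtain K F where K: "B = prod_emb UNIV (\<lambda>_. borel) K (Pi\<^sub>E K F)" "finite K" "\<And>j. j \<in> K \<Longrightarrow> F j \<in> sets borel"
      using B(1) by (rule prod_algebraE) blast
    let ?f = "\<lambda>w. \<lambda>j\<in>J. stopped s (path w) j" and ?g = "\<lambda>w. \<lambda>k\<in>K. shifted s (path w) k"
    have a: "a = ?f -` Pi\<^sub>E J E \<inter> space M" unfolding A(2) J(1) by (auto simp: prod_emb_def)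
    have b: "b = ?g -` Pi\<^sub>E K F \<inter> space M" unfolding B(2) K(1) by (auto simp: prod_emb_def)
    have ab: "a \<inter> b = (\<lambda>w. (?f w, ?g w)) -` (Pi\<^sub>E J E \<times> Pi\<^sub>E K F) \<inter> space M"
      unfolding a b by auto
    show "prob (a \<inter> b) = prob a * prob b"
      unfolding ab unfolding a b
      by (rule indep_varD[OF finite_dim_indep[OF s J(2) K(2)]])
         (use J K in \<open>auto intro!: sets_PiM_I_finite\<close>)
  qed
  from indep_set_sigma_sets[OF this int int]
  show ?thesis
    unfolding indep_var_eq gen ss by simp
qed

text \<open>Independence and \<open>law_shifted\<close> make the joint law of past and future a
  product, so Fubini applies. Because \<Phi> sees both parts, events of the past and the position at
  time \<open>s\<close> are covered at once.\<close>

theorem markov_property: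
  assumes s: "s \<ge> 0" and \<Phi>: "\<Phi> \<in> borel_measurable (path_space \<Otimes>\<^sub>M path_space)"
  shows "(\<integral>\<^sup>+w. \<Phi> (stopped s (path w), shifted s (path w)) \<partial>M) =
    (\<integral>\<^sup>+w. (\<integral>\<^sup>+w'. \<Phi> (stopped s (path w), path w') \<partial>M) \<partial>M)"
proof -
  let ?Z = "\<lambda>w. (stopped s (path w), shifted s (path w))"
  let ?P = "distr M path_space (\<lambda>w. stopped s (path w))" and ?Q = "distr M path_space path"
  interpret Q: prob_space ?Q by (rule prob_space_distr) measurable
  have "distr M (path_space \<Otimes>\<^sub>M path_space) ?Z =
      ?P \<Otimes>\<^sub>M distr M path_space (\<lambda>w. shifted s (path w))"
    using indep_stopped_shifted[OF s] unfolding indep_var_distribution_eq by simp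
  also have "\<dots> = ?P \<Otimes>\<^sub>M ?Q" unfolding law_shifted[OF s] ..
  finally have *: "distr M (path_space \<Otimes>\<^sub>M path_space) ?Z = ?P \<Otimes>\<^sub>M ?Q" .
  have "(\<integral>\<^sup>+w. \<Phi> (?Z w) \<partial>M) =
     (\<integral>\<^sup>+z. \<Phi> z \<partial>distr M (path_space \<Otimes>\<^sub>M path_space) ?Z)"
    by (subst nn_integral_distr) (use \<Phi> in auto)
  also have "\<dots> = (\<integral>\<^sup>+p. (\<integral>\<^sup>+q. \<Phi> (p, q) \<partial>?Q) \<partial>?P)"
    unfolding * by (rule Q.nn_integral_fst[symmetric]) (use \<Phi> in \<open>simp cong: measurable_cong_sets\<close>)
  also have "\<dots> = (\<integral>\<^sup>+w. (\<integral>\<^sup>+q. \<Phi> (stopped s (path w), q) \<partial>?Q) \<partial>M)"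
    by (rule nn_integral_distr) (use \<Phi> in \<open>auto intro!: Q.borel_measurable_nn_integral_fst\<close>)
  also have "\<dots> = (\<integral>\<^sup>+w. (\<integral>\<^sup>+w'. \<Phi> (stopped s (path w), path w') \<partial>M) \<partial>M)"
    by (intro nn_integral_cong nn_integral_distr) (use \<Phi> in auto)
  finally show ?thesis .
qed

end

section \<open>Lifetimes and exit times\<close>

abbreviation recip :: "nat \<Rightarrow> real" where "recip n \<equiv> 1 / real (Suc n)"

definition right_cont :: "(real \<Rightarrow> 'a::topological_space) \<Rightarrow> bool" where
  "right_cont p \<longleftrightarrow> (\<forall>t\<ge>0. (p \<longlongrightarrow> p t) (at_right t))"

lemma right_contD: "right_cont p \<Longrightarrow> 0 \<le> t \<Longrightarrow> (p \<longlongrightarrow> p t) (at_right t)"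
  by (simp add: right_cont_def)

lemma right_cont_ex:
  assumes p: "right_cont p" and t: "0 \<le> t" and U: "open U" "p t \<in> U"
  shows "\<exists>b>t. \<forall>u. t \<le> u \<and> u < b \<longrightarrow> p u \<in> U"
proof -
  have "eventually (\<lambda>u. p u \<in> U) (at_right t)"
    using topological_tendstoD[OF right_contD[OF p t] U] .
  then obtain b where "b > t" "\<And>u. u > t \<Longrightarrow> u < b \<Longrightarrow> p u \<in> U"
    unfolding eventually_at_right_field by blast
  then show ?thesis using U(2) by (intro exI[of _ b]) (auto simp: le_less)
qed

text \<open>The lifetime of a path in \<open>D\<close> is encoded by rational times only, so that survival is an event of
  the product \<open>\<sigma>\<close>-algebra of the path space; for the exit time this fails. Since \<open>infdist y {} = 0\<close>, these notions are
  meaningful only for \<open>- D \<noteq> {}\<close>.\<close>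

definition alive_in :: "'a::euclidean_space set \<Rightarrow> nat \<Rightarrow> real \<Rightarrow> (real \<Rightarrow> 'a) \<Rightarrow> bool" where
  "alive_in D n t p \<longleftrightarrow> recip n \<le> infdist (p t) (- D) \<and>
     (\<forall>q::rat. 0 \<le> real_of_rat q \<and> real_of_rat q \<le> t \<longrightarrow> recip n \<le> infdist (p (real_of_rat q)) (- D))"

text \<open>One \<open>n\<close> serves all times up to \<open>t\<close>, so for a right-continuous
  path any left limits keep away from the complement too. This is stronger than remaining in
  \<open>D\<close>.\<close>

definition alive :: "'a::euclidean_space set \<Rightarrow> real \<Rightarrow> (real \<Rightarrow> 'a) \<Rightarrow> bool" where
  "alive D t p \<longleftrightarrow> (\<exists>n. alive_in D n t p)"

lemma open_infdist_less: "open {y. infdist y A < c}" and open_infdist_greater: "open {y. c < infdist y A}"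
  by (intro open_Collect_less continuous_intros)+

lemma borel_measurable_infdist [measurable]:
  "(\<lambda>x. infdist x A) \<in> borel_measurable borel"
  by (intro borel_measurable_continuous_onI continuous_intros)

lemma measurable_alive [measurable (raw)]:
  assumes [measurable]: "\<And>r. (\<lambda>z. P z r) \<in> borel_measurable N"
  shows "Measurable.pred N (\<lambda>z. alive D t (P z))"
  unfolding alive_def alive_in_def by measurable

text \<open>A visit to the open set of points closer than \<open>recip n\<close> lasts for a while
  by right continuity and is seen at a rational time. Only a visit at the endpoint \<open>t\<close>
  can be missed, which is why \<open>alive_in\<close> tests \<open>t\<close> separately.\<close>

lemma alive_in_iff:
  assumes p: "right_cont p" and t: "0 \<le> t"
  shows "alive_in D n t p \<longleftrightarrow> (\<forall>r\<in>{0..t}. recip n \<le> infdist (p r) (- D))"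
proof
  assume a: "alive_in D n t p"
  show "\<forall>r\<in>{0..t}. recip n \<le> infdist (p r) (- D)"
  proof (safe, rule ccontr)
    fix r assume r: "r \<in> {0..t}" "\<not> recip n \<le> infdist (p r) (- D)"
    then have rt: "r < t" using a by (cases "r = t") (auto simp: alive_in_def)
    obtain b where b: "b > r" "\<And>u. r \<le> u \<Longrightarrow> u < b \<Longrightarrow> infdist (p u) (- D) < recip n"
      using right_cont_ex[OF p _ open_infdist_less, of r "- D" "recip n"] r by auto
    obtain q where q: "r < real_of_rat q" "real_of_rat q < min b t"
      using of_rat_dense[of r "min b t"] b(1) rt by auto
    then have "infdist (p (real_of_rat q)) (- D) < recip n" "0 \<le> real_of_rat q" "real_of_rat q \<le> t"
      using b(2)[of "real_of_rat q"] r by (simp_all del: zero_le_of_rat_iff)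
    then show False using a unfolding alive_in_def by (meson not_less)
  qed
qed (use t in \<open>auto simp: alive_in_def\<close>)

lemma alive_iff:
  assumes "right_cont p" "0 \<le> t"
  shows "alive D t p \<longleftrightarrow> (\<exists>n. \<forall>r\<in>{0..t}. recip n \<le> infdist (p r) (- D))"
  unfolding alive_def alive_in_iff[OF assms] ..

lemma alive_cong:
  assumes "\<And>r. 0 \<le> r \<Longrightarrow> r \<le> t \<Longrightarrow> p r = p' r" "0 \<le> t"
  shows "alive D t p = alive D t p'"
  using assms unfolding alive_def alive_in_def by auto

lemma alive_mono: 
  assumes "right_cont p" "alive D t p" "0 \<le> s" "s \<le> t" shows "alive D s p"
  using assms by (fastforce simp: alive_iff)

lemma alive_imp_in:
  assumes "right_cont p" "alive D t p" "0 \<le> s" "s \<le> t" shows "p s \<in> D"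
proof (rule ccontr)
  assume "p s \<notin> D"
  then have "infdist (p s) (- D) = 0" by simp
  moreover obtain n where "recip n \<le> infdist (p s) (- D)"
    using assms alive_iff[of p t D] by (metis atLeastAtMost_iff order_trans)
  moreover have "recip n > 0" by simp
  ultimately show False by linarith
qed

text \<open>Passing from level \<open>n\<close> to \<open>Suc n\<close> turns the weak inequality at
  time \<open>t\<close> into a strict one, which persists by right continuity. Hence there is no
  last time of survival.\<close>

lemma alive_in_extend:
  assumes p: "right_cont p" and a: "alive_in D n t p" and t: "0 \<le> t"
  shows "\<exists>u>t. alive_in D (Suc n) u p"
proof -
  have le: "recip (Suc n) < recip n" by (simp add: divide_strict_left_mono)
  have "recip (Suc n) < infdist (p t) (- D)"
    using a le t unfolding alive_in_def by linarith
  then obtain b where b: "b > t" "\<And>u. t \<le> u \<Longrightarrow> u < b \<Longrightarrow> recip (Suc n) < infdist (p u) (- D)"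
    using right_cont_ex[OF p t open_infdist_greater, of "recip (Suc n)" "- D"] by auto
  obtain u where u: "t < u" "u < b" using dense b(1) by blast
  have "alive_in D (Suc n) u p"
    unfolding alive_in_iff[OF p order_trans[OF t less_imp_le[OF u(1)]]]
  proof
    fix r assume r: "r \<in> {0..u}"
    show "recip (Suc n) \<le> infdist (p r) (- D)"
    proof (cases "r \<le> t")
      case True
      then have "recip n \<le> infdist (p r) (- D)"
        using a r unfolding alive_in_iff[OF p t] by auto
      then show ?thesis using le by linarith
    qed (use b(2)[of r] r u in \<open>auto intro: less_imp_le\<close>)
  qed
  then show ?thesis using u by blast
qed

lemma alive_extend:
  assumes "right_cont p" "alive D t p" "0 \<le> t"
  shows "\<exists>u>t. alive D u p"
  using assms alive_in_extend unfolding alive_def by blast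

lemma alive_0:
  assumes "open D" "- D \<noteq> {}" "p 0 \<in> D"
  shows "alive D 0 p"
proof -
  have "infdist (p 0) (- D) > 0"
    using assms infdist_nonneg[of "p 0" "- D"] in_closed_iff_infdist_zero[of "- D" "p 0"] by (auto simp: order_less_le)
  then obtain n where n: "recip n < infdist (p 0) (- D)" using nat_approx_posE by blast
  have "alive_in D n 0 p" unfolding alive_in_def
  proof (intro conjI allI impI)
    fix q :: rat assume "0 \<le> real_of_rat q \<and> real_of_rat q \<le> 0"
    then have "real_of_rat q = 0" by linarith
    then show "recip n \<le> infdist (p (real_of_rat q)) (- D)" using n by simp
  qed (use n in simp)
  then show ?thesis unfolding alive_def by blast
qed

lemma right_cont_shift: "right_cont p \<Longrightarrow> 0 \<le> s \<Longrightarrow> right_cont (\<lambda>r. p (s + max r 0))"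
  unfolding right_cont_def
proof (intro allI impI)
  fix t :: real assume p: "\<forall>t\<ge>0. (p \<longlongrightarrow> p t) (at_right t)" and s: "0 \<le> s" and t: "0 \<le> t"
  have "((\<lambda>r. s + max r 0) \<longlongrightarrow> s + max t 0) (at_right t)" by (intro tendsto_intros)
  moreover have "eventually (\<lambda>r. s + max r 0 > s + t) (at_right t)"
    using t by (auto simp: eventually_at_right_field intro!: exI[of _ "t + 1"])
  ultimately have "filterlim (\<lambda>r. s + max r 0) (at_right (s + t)) (at_right t)"
    using t by (auto simp: filterlim_at max_def elim: eventually_mono)
  moreover have "(p \<longlongrightarrow> p (s + t)) (at_right (s + t))" using p s t by auto
  ultimately show "((\<lambda>r. p (s + max r 0)) \<longlongrightarrow> p (s + max t 0)) (at_right t)"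
    using t by (auto intro: filterlim_compose)
qed

lemma alive_add_iff:
  assumes p: "right_cont p" and s: "0 \<le> s" and t: "0 \<le> t"
  shows "alive D (s + t) p \<longleftrightarrow> alive D s p \<and> alive D t (\<lambda>r. p (s + max r 0))"
proof
  assume "alive D (s + t) p"
  then obtain n where n: "\<forall>r\<in>{0..s+t}. recip n \<le> infdist (p r) (- D)"
    using s t by (auto simp: alive_iff[OF p])
  then have "\<forall>r\<in>{0..s}. recip n \<le> infdist (p r) (- D)"
    "\<forall>r\<in>{0..t}. recip n \<le> infdist (p (s + max r 0)) (- D)" using s t by auto
  then show "alive D s p \<and> alive D t (\<lambda>r. p (s + max r 0))"
    using alive_iff[OF p s] alive_iff[OF right_cont_shift[OF p s] t] by blast
next
  assume "alive D s p \<and> alive D t (\<lambda>r. p (s + max r 0))"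
  then obtain n m where n: "\<forall>r\<in>{0..s}. recip n \<le> infdist (p r) (- D)"
    and m: "\<forall>r\<in>{0..t}. recip m \<le> infdist (p (s + max r 0)) (- D)"
    using alive_iff[OF p s] alive_iff[OF right_cont_shift[OF p s] t] by blast
  have "1 / real (Suc (max n m)) \<le> infdist (p r) (- D)" if r: "r \<in> {0..s+t}" for r
  proof (cases "r \<le> s")
    case True
    have "1 / real (Suc (max n m)) \<le> recip n" by (intro divide_left_mono) auto
    also have "\<dots> \<le> infdist (p r) (- D)" using n True r by auto
    finally show ?thesis .
  next
    case False
    have "1 / real (Suc (max n m)) \<le> recip m" by (intro divide_left_mono) auto
    also have "\<dots> \<le> infdist (p r) (- D)" using m[rule_format, of "r - s"] False r by auto
    finally show ?thesis .
  qed
  then show "alive D (s + t) p" using alive_iff[OF p add_nonneg_nonneg[OF s t], of D] by blast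
qed

section \<open>Entrance times near the complement and the lifetime\<close>

definition hit_set :: "'a::euclidean_space set \<Rightarrow> nat \<Rightarrow> (real \<Rightarrow> 'a) \<Rightarrow> real set" where
  "hit_set D n p = {r. 0 \<le> r \<and> infdist (p r) (- D) < recip n}"

text \<open>The first entrance time into a neighbourhood of the complement. A real infimum, hence
  meaningful only for nonempty \<open>hit_set\<close>.\<close>

definition hit :: "'a::euclidean_space set \<Rightarrow> nat \<Rightarrow> (real \<Rightarrow> 'a) \<Rightarrow> real" where
  "hit D n p = Inf (hit_set D n p)"

lemma hit_set_bdd_below [simp]: "bdd_below (hit_set D n p)"
  by (auto simp: hit_set_def bdd_below_def)

lemma alive_in_iff_hit:
  assumes "right_cont p" "0 \<le> t"
  shows "alive_in D n t p \<longleftrightarrow> hit_set D n p \<inter> {..t} = {}"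
  unfolding alive_in_iff[OF assms] hit_set_def by (force simp: not_less)

lemma hit_nonneg: "hit_set D n p \<noteq> {} \<Longrightarrow> 0 \<le> hit D n p"
  unfolding hit_def by (rule cInf_greatest) (auto simp: hit_set_def)

lemma hit_less_iff:
  assumes "hit_set D n p \<noteq> {}" shows "hit D n p < c \<longleftrightarrow> (\<exists>r\<in>hit_set D n p. r < c)"
  unfolding hit_def by (rule cInf_less_iff) (use assms in auto)

text \<open>By right continuity an entrance before \<open>c\<close> into an open set is witnessed at
  a rational time before \<open>c\<close>. So the event is measurable and depends only on the path
  before \<open>c\<close>.\<close>

lemma hit_less_rat_iff:
  assumes p: "right_cont p"
  shows "(\<exists>q::rat. 0 \<le> real_of_rat q \<and> real_of_rat q < c \<and> infdist (p (real_of_rat q)) (- D) < recip n) \<longleftrightarrow>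
     (hit_set D n p \<noteq> {} \<and> hit D n p < c)"
proof
  assume "\<exists>q::rat. 0 \<le> real_of_rat q \<and> real_of_rat q < c \<and> infdist (p (real_of_rat q)) (- D) < recip n"
  then obtain q :: rat where "real_of_rat q \<in> hit_set D n p" "real_of_rat q < c" by (auto simp: hit_set_def)
  then show "hit_set D n p \<noteq> {} \<and> hit D n p < c" using hit_less_iff[of D n p c] by auto
next
  assume "hit_set D n p \<noteq> {} \<and> hit D n p < c"
  then obtain r where r: "r \<in> hit_set D n p" "r < c" using hit_less_iff[of D n p c] by auto
  obtain b where b: "b > r" "\<And>u. r \<le> u \<Longrightarrow> u < b \<Longrightarrow> infdist (p u) (- D) < recip n"
    using right_cont_ex[OF p _ open_infdist_less, of r "- D" "recip n"] r by (auto simp: hit_set_def)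
  obtain q where "r < real_of_rat q" "real_of_rat q < min b c"
    using of_rat_dense[of r "min b c"] b(1) r by auto
  then have "infdist (p (real_of_rat q)) (- D) < recip n" "0 \<le> real_of_rat q" "real_of_rat q < c"
    using b(2)[of "real_of_rat q"] r by (simp_all add: hit_set_def del: zero_le_of_rat_iff)
  then show "\<exists>q::rat. 0 \<le> real_of_rat q \<and> real_of_rat q < c \<and> infdist (p (real_of_rat q)) (- D) < recip n"
    by blast
qed

text \<open>The infimum need not be attained in the open neighbourhood; right continuity then gives
  the weak inequality.\<close>

lemma infdist_at_hit:
  assumes p: "right_cont p" and ne: "hit_set D n p \<noteq> {}"
  shows "infdist (p (hit D n p)) (- D) \<le> recip n"
proof (rule ccontr)
  assume "\<not> infdist (p (hit D n p)) (- D) \<le> recip n"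
  then obtain b where b: "b > hit D n p" "\<And>u. hit D n p \<le> u \<Longrightarrow> u < b \<Longrightarrow> recip n < infdist (p u) (- D)"
    using right_cont_ex[OF p hit_nonneg[OF ne] open_infdist_greater, of "recip n" "- D"] by auto
  obtain r where r: "r \<in> hit_set D n p" "r < b" using hit_less_iff[OF ne] b(1) by auto
  have "hit D n p \<le> r" unfolding hit_def using r by (intro cInf_lower) auto
  then show False using b(2)[of r] r by (auto simp: hit_set_def)
qed

lemma hit_set_antimono: "n \<le> m \<Longrightarrow> hit_set D m p \<subseteq> hit_set D n p"
proof
  fix r assume "n \<le> m" "r \<in> hit_set D m p"
  moreover have "recip m \<le> recip n" using \<open>n \<le> m\<close> by (intro divide_left_mono) auto
  ultimately show "r \<in> hit_set D n p" by (auto simp: hit_set_def)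
qed

text \<open>The entrance times increase to \<zeta> and so announce it from below. That \<zeta>
  itself is not survived comes from \<open>alive_in_extend\<close>: survival at level
  \<open>n\<close> leaves room before the entrance at level \<open>Suc n\<close>.\<close>

lemma lifetime:
  assumes p: "right_cont p" and D: "open D" "- D \<noteq> {}" "p 0 \<in> D" and t: "0 \<le> t" "\<not> alive D t p"
  defines "\<zeta> \<equiv> (SUP n. hit D n p)"
  shows "\<And>n. hit_set D n p \<noteq> {}" and "\<And>n. hit D n p \<le> \<zeta>" and "(\<lambda>n. hit D n p) \<longlonglongrightarrow> \<zeta>"
    and "\<zeta> > 0" and "\<And>u. 0 \<le> u \<Longrightarrow> alive D u p \<longleftrightarrow> u < \<zeta>"
proof -
  have ne: "hit_set D n p \<inter> {..t} \<noteq> {}" for n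
    using t alive_in_iff_hit[OF p t(1), of D n] unfolding alive_def by blast
  then show ne': "hit_set D n p \<noteq> {}" for n by blast
  have le_t: "hit D n p \<le> t" for n
  proof -
    obtain r where "r \<in> hit_set D n p" "r \<le> t" using ne[of n] by blast
    then show ?thesis unfolding hit_def by (intro cInf_lower2) auto
  qed
  then have bdd: "bdd_above (range (\<lambda>n. hit D n p))" by (auto simp: bdd_above_def)
  show le: "hit D n p \<le> \<zeta>" for n unfolding \<zeta>_def by (rule cSUP_upper[OF _ bdd]) simp
  have inc: "incseq (\<lambda>n. hit D n p)"
    unfolding incseq_def hit_def by (intro allI impI cInf_superset_mono ne' hit_set_antimono) auto
  show "(\<lambda>n. hit D n p) \<longlonglongrightarrow> \<zeta>" unfolding \<zeta>_def by (rule LIMSEQ_incseq_SUP[OF bdd inc])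
  have alive_less: "u < \<zeta>" if u: "0 \<le> u" "alive D u p" for u
  proof -
    obtain n where "alive_in D n u p" using u(2) by (auto simp: alive_def)
    then obtain v where v: "v > u" "alive_in D (Suc n) v p" using alive_in_extend[OF p _ u(1)] by blast
    then have "hit_set D (Suc n) p \<inter> {..v} = {}" using alive_in_iff_hit[OF p, of v D "Suc n"] u by auto
    then have "v \<le> hit D (Suc n) p" unfolding hit_def by (intro cInf_greatest ne') (auto simp: not_le intro: less_imp_le)
    then show ?thesis using v(1) le[of "Suc n"] by linarith
  qed
  show "\<zeta> > 0" using alive_less[of 0] alive_0[of D p] D by simp
  show "alive D u p \<longleftrightarrow> u < \<zeta>" if u: "0 \<le> u" for u
  proof
    assume "u < \<zeta>"
    then obtain n where n: "u < hit D n p" unfolding \<zeta>_def using less_cSUP_iff[OF _ bdd] by auto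
    have "hit_set D n p \<inter> {..u} = {}"
    proof (safe)
      fix r assume "r \<in> hit_set D n p" "r \<le> u"
      then have "hit D n p \<le> u" unfolding hit_def by (intro cInf_lower2) auto
      with n show "r \<in> {}" by simp
    qed
    then show "alive D u p" unfolding alive_def using alive_in_iff_hit[OF p u] by blast
  qed (use alive_less u in blast)
qed

text \<open>Survival always precedes the exit. The converse needs \<open>lim\<close>, which excludes
  a path that approaches the complement from the left and is back in \<open>D\<close> at the
  lifetime; \<open>AE_not_in_at_lifetime\<close> provides it almost surely.\<close>

lemma less_exit_time_iff_alive:
  assumes p: "right_cont p" and D: "open D" "- D \<noteq> {}" "p 0 \<in> D"
    and lim: "\<And>t. 0 \<le> t \<Longrightarrow> \<not> alive D t p \<Longrightarrow> p (SUP n. hit D n p) \<notin> D" and t: "0 \<le> t"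
  shows "ereal t < exit_time D p \<longleftrightarrow> alive D t p"
proof
  assume "alive D t p"
  then obtain u where u: "u > t" "alive D u p" using alive_extend[OF p _ t] by blast
  have "ereal u \<le> exit_time D p"
    unfolding exit_time_def
  proof (rule Inf_greatest)
    fix y assume "y \<in> ereal ` {t. 0 < t \<and> p t \<notin> D}"
    then obtain r where r: "y = ereal r" "0 < r" "p r \<notin> D" by blast
    then show "ereal u \<le> y" using alive_imp_in[OF p u(2), of r] by force
  qed
  then show "ereal t < exit_time D p" using u(1) by (metis ereal_less(2) less_ereal.simps(1) order_less_le_trans)
next
  assume l: "ereal t < exit_time D p"
  show "alive D t p"
  proof (rule ccontr)
    assume na: "\<not> alive D t p"
    define \<zeta> where "\<zeta> = (SUP n. hit D n p)"
    have "\<zeta> > 0" and *: "\<And>u. 0 \<le> u \<Longrightarrow> alive D u p \<longleftrightarrow> u < \<zeta>"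
      using lifetime[OF p D t na] unfolding \<zeta>_def by blast+
    moreover have "p \<zeta> \<notin> D" using lim[OF t na] unfolding \<zeta>_def .
    ultimately have "exit_time D p \<le> ereal \<zeta>"
      unfolding exit_time_def by (intro Inf_lower) auto
    moreover have "\<zeta> \<le> t" using *[OF t] na by simp
    ultimately show False using l by (metis ereal_less_eq(3) leD order_trans)
  qed
qed

section \<open>Quasi-left-continuity\<close>

text \<open>Fatou's lemma for events: the set is their lower limit, an increasing union.\<close>

lemma emeasure_eventually_in_le:
  assumes [measurable]: "\<And>n. A n \<in> sets M" and le: "\<And>n. emeasure M (A n) \<le> c"
  shows "emeasure M (\<Union>N. \<Inter>n\<in>{N::nat..}. A n) \<le> c"
proof -
  have "emeasure M (\<Union>N. \<Inter>n\<in>{N..}. A n) = (SUP N. emeasure M (\<Inter>n\<in>{N..}. A n))"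
    by (rule SUP_emeasure_incseq[symmetric]) (auto simp: incseq_def)
  also have "\<dots> \<le> c"
    by (intro SUP_least order_trans[OF emeasure_mono le]) auto
  finally show ?thesis .
qed

context rc_levy
begin

abbreviation path_from :: "'a \<Rightarrow> 'w \<Rightarrow> real \<Rightarrow> 'a" where
  "path_from x w \<equiv> \<lambda>r. x + path w r"

lemma right_cont_path: "right_cont (path_from x w)"
  unfolding right_cont_def path_def by (auto intro!: tendsto_intros X_rc)

text \<open>The event \<open>hit D n p < c\<close> for the path translated by \<open>x\<close>, in
  the rational form of \<open>hit_less_rat_iff\<close>.\<close>

definition early_hit :: "'a \<Rightarrow> 'a set \<Rightarrow> nat \<Rightarrow> real \<Rightarrow> (real \<Rightarrow> 'a) \<Rightarrow> bool" where
  "early_hit x D n c p \<longleftrightarrow> (\<exists>q::rat. 0 \<le> real_of_rat q \<and> real_of_rat q < c \<and>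
      infdist (x + p (real_of_rat q)) (- D) < recip n)"

text \<open>A strong Markov property in discrete form: the entrance time is replaced by the next
  dyadic point \<open>u j\<close>, and the Markov property is used at each \<open>u j\<close>. The
  event that \<open>u j\<close> is this point is decided before \<open>u j\<close>, and these events
  are disjoint, so their probabilities sum to at most 1.\<close>

lemma emeasure_jump_after_discrete_hit:
  fixes m n :: nat and x :: 'a and D :: "'a set" and \<delta> t :: real
  assumes t: "t \<ge> 0"
  defines "u \<equiv> \<lambda>j. (real j + 1) / 2 ^ m"
  defines "A \<equiv> {w\<in>space M. \<exists>j::nat. early_hit x D n (u j) (path w) \<and> \<not> early_hit x D n (real j / 2 ^ m) (path w) \<and>
      \<delta> < norm (path w (u j + t) - path w (u j))}"
  shows "A \<in> sets M" and "emeasure M A \<le> emeasure M {w\<in>space M. \<delta> < norm (path w t)}"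
proof -
  have [measurable]: "Measurable.pred path_space (early_hit x D n c)" for c
    unfolding early_hit_def by measurable
  define E where "E j p \<longleftrightarrow> early_hit x D n (u j) p \<and> \<not> early_hit x D n (real j / 2 ^ m) p" for j p
  have [measurable]: "Measurable.pred path_space (E j)" for j unfolding E_def[abs_def] by measurable
  define B where "B j = {w\<in>space M. E j (path w) \<and> \<delta> < norm (path w (u j + t) - path w (u j))}" for j
  have B_meas[measurable]: "B j \<in> sets M" for j unfolding B_def by measurable
  have A_eq: "A = (\<Union>j. B j)" unfolding A_def B_def E_def by auto
  then show "A \<in> sets M" by simp
  have u: "u j \<ge> 0" for j by (simp add: u_def)
  \<comment> \<open>\<open>early_hit\<close> reads the path strictly before the given time, so
    stopping at \<open>u j\<close> changes nothing.\<close>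
  have E_stop: "E j (stopped (u j) p) = E j p" for j p
  proof -
    have "real j / 2 ^ m \<le> u j" by (simp add: u_def divide_right_mono)
    then show ?thesis unfolding E_def early_hit_def stopped_def by (auto simp: min_def)
  qed
  define c where "c = emeasure M {w\<in>space M. \<delta> < norm (path w t)}"
  have B_eq: "emeasure M (B j) = emeasure M {w\<in>space M. E j (path w)} * c" for j
  proof -
    define \<Phi> :: "(real \<Rightarrow> 'a) \<times> (real \<Rightarrow> 'a) \<Rightarrow> ennreal" where
      "\<Phi> z = indicator {p. E j p} (fst z) * indicator {q. \<delta> < norm (q t)} (snd z)" for z
    have "{p\<in>space path_space. E j p} \<in> sets path_space"
      "{q\<in>space path_space. \<delta> < norm (q t :: 'a)} \<in> sets path_space" by measurable
    then have [measurable]: "{p. E j p} \<in> sets path_space" "{q. \<delta> < norm (q t :: 'a)} \<in> sets path_space"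
      by simp_all
    have [measurable]: "\<Phi> \<in> borel_measurable (path_space \<Otimes>\<^sub>M path_space)"
      unfolding \<Phi>_def[abs_def] by measurable
    have "emeasure M (B j) = (\<integral>\<^sup>+w. indicator (B j) w \<partial>M)" by simp
    also have "\<dots> = (\<integral>\<^sup>+w. \<Phi> (stopped (u j) (path w), shifted (u j) (path w)) \<partial>M)"
      by (intro nn_integral_cong) (use t in \<open>auto simp: B_def \<Phi>_def E_stop shifted_def indicator_def\<close>)
    also have "\<dots> = (\<integral>\<^sup>+w. (\<integral>\<^sup>+w'. \<Phi> (stopped (u j) (path w), path w') \<partial>M) \<partial>M)"
      by (rule markov_property[OF u]) measurable
    also have "\<dots> = (\<integral>\<^sup>+w. (\<integral>\<^sup>+w'. indicator {w\<in>space M. E j (path w)} w *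
        indicator {w\<in>space M. \<delta> < norm (path w t)} w' \<partial>M) \<partial>M)"
      by (intro nn_integral_cong) (auto simp: \<Phi>_def E_stop indicator_def)
    also have "\<dots> = emeasure M {w\<in>space M. E j (path w)} * c"
      unfolding c_def by (simp add: nn_integral_cmult nn_integral_multc)
    finally show ?thesis .
  qed
  have H_mono: "early_hit x D n c p \<Longrightarrow> c \<le> c' \<Longrightarrow> early_hit x D n c' p" for c c' p
    unfolding early_hit_def by force
  have disj: "disjoint_family (\<lambda>j. {w\<in>space M. E j (path w)})"
  proof (unfold disjoint_family_on_def, safe)
    have *: False if "i < j" "E i p" "E j p" for i j :: nat and p
    proof -
      have "u i \<le> real j / 2 ^ m" using that(1) by (simp add: u_def divide_right_mono)
      then show False using that(2,3) H_mono[of "u i" p "real j / 2 ^ m"] unfolding E_def by blast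
    qed
    fix i j :: nat and w assume "i \<noteq> j" "E i (path w)" "E j (path w)"
    then show "w \<in> {}" using *[of i j] *[of j i] by (cases i j rule: linorder_cases) auto
  qed
  have "emeasure M A \<le> (\<Sum>j. emeasure M (B j))"
    unfolding A_eq by (rule emeasure_subadditive_countably) auto
  also have "\<dots> = (\<Sum>j. emeasure M {w\<in>space M. E j (path w)}) * c"
    unfolding B_eq by simp
  also have "(\<Sum>j. emeasure M {w\<in>space M. E j (path w)}) = emeasure M (\<Union>j. {w\<in>space M. E j (path w)})"
    by (rule suminf_emeasure[OF _ disj]) auto
  also have "\<dots> * c \<le> 1 * c" by (intro mult_right_mono emeasure_le_1) auto
  finally show "emeasure M A \<le> emeasure M {w\<in>space M. \<delta> < norm (path w t)}" unfolding c_def by simp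
qed

lemma emeasure_small_time_tendsto_0:
  assumes \<delta>: "\<delta> > 0"
  shows "(\<lambda>i. emeasure M {w\<in>space M. \<delta> < norm (path w (recip i))}) \<longlonglongrightarrow> 0"
proof -
  let ?N = "\<lambda>i. {w\<in>space M. \<delta> < norm (path w (recip i))}"
  have "(\<lambda>i. \<integral>\<^sup>+w. indicator (?N i) w \<partial>M) \<longlonglongrightarrow> (\<integral>\<^sup>+w. 0 \<partial>M)"
  proof (rule nn_integral_dominated_convergence[where w="\<lambda>_. 1"])
    show "AE w in M. (\<lambda>i. indicator (?N i) w) \<longlonglongrightarrow> (0::ennreal)"
    proof (intro always_eventually allI)
      fix w
      have "path w 0 \<in> ball 0 \<delta>" using \<delta> by (simp add: path_def X_nonpos)
      then obtain b where b: "b > 0" "\<And>u. 0 \<le> u \<Longrightarrow> u < b \<Longrightarrow> path w u \<in> ball 0 \<delta>"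
        using right_cont_ex[OF right_cont_path[of 0 w], of 0 "ball 0 \<delta>"] by auto
      have "eventually (\<lambda>i. recip i < b) sequentially"
        using order_tendstoD(2)[OF LIMSEQ_Suc[OF lim_1_over_n] b(1)] by simp
      then have "eventually (\<lambda>i. indicator (?N i) w = (0::ennreal)) sequentially"
      proof eventually_elim
        case (elim i)
        then have "path w (recip i) \<in> ball 0 \<delta>" by (intro b(2)) auto
        then show ?case by (simp add: indicator_def)
      qed
      then show "(\<lambda>i. indicator (?N i) w) \<longlonglongrightarrow> (0::ennreal)"
        by (rule tendsto_eventually)
    qed
  qed (auto simp: emeasure_space_1 indicator_def)
  then show ?thesis by simp
qed

text \<open>Quasi-left-continuity: the hitting times of the shrinking neighbourhoods of the complement
  announce the lifetime, and by the strong Markov property \<open>X\<close> moves little right after each of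
  them; hence \<open>X\<close> cannot jump back into \<open>D\<close> at the lifetime.\<close>

theorem AE_not_in_at_lifetime:
  assumes D: "open D" "- D \<noteq> {}" "x \<in> D"
  shows "AE w in M. \<forall>t\<ge>0. \<not> alive D t (path_from x w) \<longrightarrow>
     x + path w (SUP n. hit D n (path_from x w)) \<notin> D"
proof -
  \<comment> \<open>Here \<open>n\<close> is the level of the neighbourhood, \<open>m\<close> the
    dyadic mesh and \<open>recip i\<close> the delay after the entrance. The threshold is half of
    \<open>recip k\<close>, where \<open>recip k\<close> is a distance from the complement exceeded
    at the lifetime.\<close>
  define B where "B k i n m = {w\<in>space M. \<exists>j::nat. early_hit x D n ((real j + 1) / 2 ^ m) (path w) \<and> \<not> early_hit x D n (real j / 2 ^ m) (path w) \<and>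
      1 / (2 * real (Suc k)) < norm (path w ((real j + 1) / 2 ^ m + recip i) - path w ((real j + 1) / 2 ^ m))}"
    for k i n m :: nat
  define c where "c k i = emeasure M {w\<in>space M. 1 / (2 * real (Suc k)) < norm (path w (recip i))}" for k i
  have B_meas[measurable]: "B k i n m \<in> sets M" and B_le: "emeasure M (B k i n m) \<le> c k i" for k i n m
    using emeasure_jump_after_discrete_hit[where t = "recip i" and n = n and x = x and D = D and m = m and \<delta> = "1 / (2 * real (Suc k))"]
    unfolding B_def c_def by auto
  \<comment> \<open>The nesting of the lower limits reflects the choices below: the level depends on
    the delay, and the mesh on both.\<close>
  define L where "L k i = (\<Union>N. \<Inter>n\<in>{N..}. \<Union>M. \<Inter>m\<in>{M..}. B k i n m)" for k i
  have L_meas[measurable]: "L k i \<in> sets M" for k i unfolding L_def by measurable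
  have L_le: "emeasure M (L k i) \<le> c k i" for k i
    unfolding L_def by (intro emeasure_eventually_in_le B_le) measurable
  define Z where "Z = (\<Union>k. \<Union>I. \<Inter>i\<in>{I..}. L k i)"
  have null: "Z \<in> null_sets M"
    unfolding Z_def
  proof (intro null_sets_UN)
    fix k I
    \<comment> \<open>The bound \<open>c k i\<close> is uniform in level and mesh, so it survives
      both lower limits; then the delay tends to 0.\<close>
    have "emeasure M (\<Inter>i\<in>{I..}. L k i) \<le> 0"
    proof (rule LIMSEQ_le_const)
      show "c k \<longlonglongrightarrow> 0" unfolding c_def[abs_def] by (rule emeasure_small_time_tendsto_0) simp
      show "\<exists>N. \<forall>i\<ge>N. emeasure M (\<Inter>i\<in>{I..}. L k i) \<le> c k i"
        by (intro exI[of _ I] allI impI order_trans[OF emeasure_mono L_le]) auto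
    qed
    then show "(\<Inter>i\<in>{I..}. L k i) \<in> null_sets M" by (intro null_setsI) auto
  qed
  show ?thesis
  proof (rule AE_I'[OF null], rule subsetI)
    fix w
    assume "w \<in> {w \<in> space M. \<not> (\<forall>t\<ge>0. \<not> alive D t (path_from x w) \<longrightarrow>
       x + path w (SUP n. hit D n (path_from x w)) \<notin> D)}"
    then obtain t where w: "w \<in> space M" and t: "0 \<le> t" "\<not> alive D t (path_from x w)"
      and in_D: "x + path w (SUP n. hit D n (path_from x w)) \<in> D"
      by blast
    define p where "p r = x + path w r" for r
    define \<zeta> where "\<zeta> = (SUP n. hit D n p)"
    have p: "right_cont p" unfolding p_def by (rule right_cont_path)
    have p0: "p 0 \<in> D" using D by (simp add: p_def path_def X_nonpos)
    note life = lifetime[OF p D(1,2) p0 t[folded p_def], folded \<zeta>_def]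
    have "infdist (p \<zeta>) (- D) > 0"
      using in_D D in_closed_iff_infdist_zero[of "- D" "p \<zeta>"] infdist_nonneg[of "p \<zeta>" "- D"]
      unfolding p_def[symmetric] \<zeta>_def[symmetric] by (auto simp: order_less_le)
    then obtain k where k: "recip k < infdist (p \<zeta>) (- D)" using nat_approx_posE by blast
    \<comment> \<open>From the lifetime up to \<open>b\<close> the path stays farther than
      \<open>recip k\<close> from the complement; short delays after late entrances land in this
      interval.\<close>
    obtain b where b: "b > \<zeta>" "\<And>u. \<zeta> \<le> u \<Longrightarrow> u < b \<Longrightarrow> recip k < infdist (p u) (- D)"
      using right_cont_ex[OF p _ open_infdist_greater, of \<zeta> "recip k" "- D"] k life(4) by auto
    obtain I where I: "recip I < b - \<zeta>" using nat_approx_posE[of "b - \<zeta>"] b(1) by auto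
    have "w \<in> L k i" if i: "i \<ge> I" for i
    proof -
      define \<tau> where "\<tau> = recip i"
      have \<tau>: "\<tau> > 0" "\<tau> < b - \<zeta>"
      proof -
        have "\<tau> \<le> recip I" unfolding \<tau>_def using i by (intro divide_left_mono) auto
        then show "\<tau> < b - \<zeta>" using I by linarith
      qed (simp add: \<tau>_def)
      have "eventually (\<lambda>n. hit D n p > \<zeta> - \<tau>) sequentially"
        using order_tendstoD(1)[OF life(3), of "\<zeta> - \<tau>"] \<tau> by simp
      then obtain N where N: "\<And>n. n \<ge> N \<Longrightarrow> hit D n p > \<zeta> - \<tau>" by (auto simp: eventually_sequentially)
      \<comment> \<open>The bound \<open>2 * k + 2\<close> makes \<open>recip n\<close> at most half
        of \<open>recip k\<close>.\<close>
      have "\<exists>M. \<forall>m\<ge>M. w \<in> B k i n m" if n: "n \<ge> max N (2 * k + 2)" for n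
      proof -
        define S where "S = hit D n p"
        have S: "\<zeta> - \<tau> < S" "S \<le> \<zeta>" "S \<ge> 0"
          using N[of n] n life(2)[of n] hit_nonneg[OF life(1), of n] by (auto simp: S_def)
        have "infdist (p S) (- D) \<le> recip n" unfolding S_def by (rule infdist_at_hit[OF p life(1)])
        also have "\<dots> \<le> 1 / (2 * real (Suc k))" using n by (intro divide_left_mono) auto
        finally have 1: "infdist (p S) (- D) \<le> 1 / (2 * real (Suc k))" .
        have 2: "recip k < infdist (p (S + \<tau>)) (- D)" using b(2)[of "S + \<tau>"] S \<tau> by auto
        have 3: "recip k = 1 / (2 * real (Suc k)) + 1 / (2 * real (Suc k))"
          by (simp add: field_simps)
        \<comment> \<open>During the delay the distance to the complement grows from at most half of
          \<open>recip k\<close> to more than \<open>recip k\<close>, so the path moves by more than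
          the difference.\<close>
        have gt: "1 / (2 * real (Suc k)) < dist (p (S + \<tau>)) (p S)"
        proof -
          have "c < d" if "i \<le> a + d" "a \<le> c" "b < i" "b = c + c" for a b c d i :: real
            using that by linarith
          from this[OF infdist_triangle 1 2 3] show ?thesis .
        qed
        \<comment> \<open>Half of the excess over the threshold: replacing \<open>S\<close> by a
          dyadic time costs less than \<open>e\<close> at each end of the delay.\<close>
        define e where "e = (dist (p (S + \<tau>)) (p S) - 1 / (2 * real (Suc k))) / 2"
        have e: "e > 0" using gt by (simp add: e_def)
        obtain b1 where b1: "b1 > S" "\<And>u. S \<le> u \<Longrightarrow> u < b1 \<Longrightarrow> p u \<in> ball (p S) e"
          using right_cont_ex[OF p S(3), of "ball (p S) e"] e by auto
        obtain b2 where b2: "b2 > S + \<tau>" "\<And>u. S + \<tau> \<le> u \<Longrightarrow> u < b2 \<Longrightarrow> p u \<in> ball (p (S + \<tau>)) e"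
          using right_cont_ex[OF p, of "S + \<tau>" "ball (p (S + \<tau>)) e"] e S(3) \<tau> by auto
        define v where "v = min (b1 - S) (b2 - (S + \<tau>))"
        have v: "v > 0" using b1 b2 by (simp add: v_def)
        obtain M0 where M0: "(1 / 2) ^ M0 < v" using real_arch_pow_inv[OF v, of "1/2"] by auto
        have "w \<in> B k i n m" if m: "m \<ge> M0" for m
        proof -
          have "(1 / 2) ^ m \<le> (1 / 2 :: real) ^ M0" using m by (intro power_decreasing) auto
          then have vm: "1 / 2 ^ m < v" using M0 by (simp add: power_one_over)
          \<comment> \<open>The dyadic cell of mesh \<open>m\<close> containing the entrance time
            \<open>S\<close>.\<close>
          define j where "j = nat \<lfloor>S * 2 ^ m\<rfloor>"
          have j: "real j \<le> S * 2 ^ m" "S * 2 ^ m < real j + 1"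
            unfolding j_def using S(3) by (auto simp: of_nat_nat)
          define u where "u = (real j + 1) / 2 ^ m"
          have u: "S < u" "u \<le> S + 1 / 2 ^ m" "real j / 2 ^ m \<le> S"
            using j by (auto simp: u_def field_simps)
          have H_iff: "early_hit x D n c (path w) \<longleftrightarrow> S < c" for c
            using hit_less_rat_iff[OF p, of c D n] life(1)[of n] unfolding early_hit_def S_def p_def by simp
          have 4: "dist (p S) (p u) < e" using b1(2)[of u] u vm by (auto simp: v_def)
          have 5: "dist (p (S + \<tau>)) (p (u + \<tau>)) < e" using b2(2)[of "u + \<tau>"] u vm by (auto simp: v_def)
          have 6: "dist (p (S + \<tau>)) (p S) \<le> dist (p (S + \<tau>)) (p (u + \<tau>)) + dist (p (u + \<tau>)) (p u) + dist (p S) (p u)"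
            using dist_triangle[of "p (S + \<tau>)" "p S" "p (u + \<tau>)"] dist_triangle[of "p (u + \<tau>)" "p S" "p u"]
            by (simp add: dist_commute)
          have 7: "e + e = dist (p (S + \<tau>)) (p S) - 1 / (2 * real (Suc k))" unfolding e_def by (rule field_sum_of_halves)
          have "c' < d'" if "g' \<le> a' + d' + b'" "a' < e'" "b' < e'" "e' + e' = g' - c'" for a' b' c' d' e' g' :: real
            using that by linarith
          from this[OF 6 5 4 7] have "1 / (2 * real (Suc k)) < dist (p (u + \<tau>)) (p u)" .
          then have "1 / (2 * real (Suc k)) < norm (path w (u + \<tau>) - path w u)"
            by (simp add: p_def dist_norm)
          moreover have "early_hit x D n u (path w)" "\<not> early_hit x D n (real j / 2 ^ m) (path w)"
            unfolding H_iff using u by linarith+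
          ultimately show ?thesis unfolding B_def u_def \<tau>_def using w by blast
        qed
        then show ?thesis by blast
      qed
      then have "w \<in> (\<Union>M. \<Inter>m\<in>{M..}. B k i n m)" if "n \<ge> max N (2 * k + 2)" for n
        unfolding UN_iff INT_iff using that by (metis UNIV_I atLeast_iff)
      then show ?thesis unfolding L_def by blast
    qed
    then show "w \<in> Z" unfolding Z_def by blast
  qed
qed

text \<open>The bridge by which Green potentials and exit positions are rewritten in terms of
  survival.\<close>

corollary AE_less_exit_time_iff_alive:
  assumes D: "open D" "- D \<noteq> {}" "x \<in> D"
  shows "AE w in M. \<forall>t\<ge>0. ereal t < exit_time D (path_from x w) \<longleftrightarrow> alive D t (path_from x w)"
  using AE_not_in_at_lifetime[OF D]
proof eventually_elim
  case (elim w)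
  have "x + path w 0 \<in> D" using D by (simp add: path_def X_nonpos)
  then show ?case using elim less_exit_time_iff_alive[OF right_cont_path D(1,2)] by blast
qed

end

section \<open>The killed semigroup\<close>

context rc_levy
begin

text \<open>Invariance of \<open>A\<close> under stopping expresses that the event is decided by
  time \<open>s\<close>; the functional then sees the current position and the future
  increments.\<close>

lemma stopped_Markov:
  assumes s: "s \<ge> 0" and [measurable]: "Measurable.pred path_space A"
    and A: "\<And>p. A (stopped s p) = A p"
    and [measurable]: "\<Psi> \<in> borel_measurable (borel \<Otimes>\<^sub>M path_space)"
  shows "(\<integral>\<^sup>+w. (if A (path w) then \<Psi> (x + path w s, shifted s (path w)) else 0) \<partial>M) =
    (\<integral>\<^sup>+w. (if A (path w) then \<integral>\<^sup>+w'. \<Psi> (x + path w s, path w') \<partial>M else 0) \<partial>M)"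
proof -
  define \<Phi> where "\<Phi> z = (if A (fst z) then \<Psi> (x + fst z s, snd z) else 0)" for z
  have [measurable]: "\<Phi> \<in> borel_measurable (path_space \<Otimes>\<^sub>M path_space)"
    unfolding \<Phi>_def[abs_def] by measurable
  have ss: "stopped s p s = p s" for p :: "real \<Rightarrow> 'a" by (simp add: stopped_def)
  have "(\<integral>\<^sup>+w. (if A (path w) then \<Psi> (x + path w s, shifted s (path w)) else 0) \<partial>M) =
      (\<integral>\<^sup>+w. \<Phi> (stopped s (path w), shifted s (path w)) \<partial>M)"
    unfolding \<Phi>_def fst_conv snd_conv A ss ..
  also have "\<dots> = (\<integral>\<^sup>+w. (\<integral>\<^sup>+w'. \<Phi> (stopped s (path w), path w') \<partial>M) \<partial>M)"
    by (rule markov_property[OF s]) measurable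
  also have "\<dots> = (\<integral>\<^sup>+w. (if A (path w) then \<integral>\<^sup>+w'. \<Psi> (x + path w s, path w') \<partial>M else 0) \<partial>M)"
    unfolding \<Phi>_def fst_conv snd_conv A ss by (intro nn_integral_cong) simp
  finally show ?thesis .
qed

text \<open>Survival is a measurable event, so the integral is taken over \<open>M\<close> itself.
  For open \<open>D\<close> with nonempty complement and \<open>x \<in> D\<close> this is killing at
  the exit time, by \<open>AE_less_exit_time_iff_alive\<close>.\<close>

definition killed :: "'a set \<Rightarrow> real \<Rightarrow> ('a \<Rightarrow> ennreal) \<Rightarrow> 'a \<Rightarrow> ennreal" where
  "killed D t f x = (\<integral>\<^sup>+w. (if alive D t (path_from x w) then f (x + path w t) else 0) \<partial>M)"

lemma measurable_killed [measurable]: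
  assumes [measurable]: "f \<in> borel_measurable borel"
  shows "killed D t f \<in> borel_measurable borel"
  unfolding killed_def[abs_def] by measurable

lemma alive_shifted:
  "alive D t (\<lambda>r. x + path w s + shifted s (path w) r) = alive D t (\<lambda>r. x + path w (s + max r 0))"
  by (simp add: shifted_def add.assoc)

lemma alive_add_path:
  assumes "0 \<le> s" "0 \<le> t"
  shows "alive D (s + t) (path_from x w) \<longleftrightarrow> alive D s (path_from x w) \<and>
     alive D t (\<lambda>r. x + path w s + shifted s (path w) r)"
  unfolding alive_shifted by (rule alive_add_iff[OF right_cont_path assms])

lemma alive_stopped: "0 \<le> s \<Longrightarrow> alive D s (\<lambda>r. x + stopped s p r) = alive D s (\<lambda>r. x + p r)"
  by (rule alive_cong) (auto simp: stopped_def)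

lemma killed_Markov:
  assumes s: "s \<ge> 0" and [measurable]: "\<Psi> \<in> borel_measurable (borel \<Otimes>\<^sub>M path_space)"
  shows "(\<integral>\<^sup>+w. (if alive D s (path_from x w) then \<Psi> (x + path w s, shifted s (path w)) else 0) \<partial>M) =
    killed D s (\<lambda>y. \<integral>\<^sup>+w. \<Psi> (y, path w) \<partial>M) x"
  unfolding killed_def
  by (rule stopped_Markov[OF s, of "\<lambda>p. alive D s (\<lambda>r. x + p r)"]) (measurable, simp add: alive_stopped[OF s], measurable)

text \<open>Survival up to \<open>s + t\<close> splits into survival up to \<open>s\<close> and
  survival of the future path up to \<open>t\<close>, to which the Markov property applies.\<close>

lemma killed_semigroup:
  assumes s: "0 \<le> s" and t: "0 \<le> t" and [measurable]: "f \<in> borel_measurable borel"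
  shows "killed D (s + t) f x = killed D s (killed D t f) x"
proof -
  define \<Psi> where "\<Psi> z = (if alive D t (\<lambda>r. fst z + snd z r) then f (fst z + snd z t) else 0)"
    for z :: "'a \<times> (real \<Rightarrow> 'a)"
  have [measurable]: "\<Psi> \<in> borel_measurable (borel \<Otimes>\<^sub>M path_space)"
    unfolding \<Psi>_def[abs_def] by measurable
  have "killed D (s + t) f x =
    (\<integral>\<^sup>+w. (if alive D s (path_from x w) then \<Psi> (x + path w s, shifted s (path w)) else 0) \<partial>M)"
    unfolding killed_def \<Psi>_def
    by (intro nn_integral_cong) (use t in \<open>simp add: alive_add_path[OF s t], simp add: shifted_def\<close>)
  also have "\<dots> = killed D s (\<lambda>y. \<integral>\<^sup>+w. \<Psi> (y, path w) \<partial>M) x"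
    by (rule killed_Markov[OF s]) measurable
  also have "(\<lambda>y. \<integral>\<^sup>+w. \<Psi> (y, path w) \<partial>M) = killed D t f"
    unfolding \<Psi>_def killed_def[abs_def] fst_conv snd_conv ..
  finally show ?thesis .
qed

lemma alive_path_imp_in: "alive D t (path_from x w) \<Longrightarrow> 0 \<le> s \<Longrightarrow> s \<le> t \<Longrightarrow> x + path w s \<in> D"
  using alive_imp_in[OF right_cont_path] by blast

lemma killed_mono:
  assumes "0 \<le> t" "\<And>y. y \<in> D \<Longrightarrow> f y \<le> g y" shows "killed D t f x \<le> killed D t g x"
  unfolding killed_def using assms alive_path_imp_in by (intro nn_integral_mono) auto

lemma killed_cong:
  assumes "0 \<le> t" "\<And>y. y \<in> D \<Longrightarrow> f y = g y" shows "killed D t f x = killed D t g x"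
  using killed_mono[OF assms(1), of D f g x] killed_mono[OF assms(1), of D g f x] assms(2) by (simp add: antisym)

lemma killed_le:
  assumes "\<And>y. f y \<le> c" shows "killed D t f x \<le> c"
proof -
  have "killed D t f x \<le> (\<integral>\<^sup>+w. c \<partial>M)"
    unfolding killed_def using assms by (intro nn_integral_mono) auto
  then show ?thesis by (simp add: emeasure_space_1)
qed

lemma killed_outside: "x \<notin> D \<Longrightarrow> 0 \<le> t \<Longrightarrow> killed D t f x = 0"
proof -
  assume x: "x \<notin> D" and t: "0 \<le> t"
  have "\<not> alive D t (path_from x w)" for w
    using alive_path_imp_in[of D t x w 0] x t by (auto simp: path_def X_nonpos)
  then show ?thesis by (simp add: killed_def)
qed

lemma killed_cmult:
  assumes [measurable]: "f \<in> borel_measurable borel"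
  shows "killed D t (\<lambda>y. c * f y) x = c * killed D t f x"
proof -
  have "killed D t (\<lambda>y. c * f y) x =
    (\<integral>\<^sup>+w. c * (if alive D t (path_from x w) then f (x + path w t) else 0) \<partial>M)"
    unfolding killed_def by (intro nn_integral_cong) auto
  then show ?thesis unfolding killed_def by (simp add: nn_integral_cmult)
qed

lemma killed_diff:
  assumes [measurable]: "f \<in> borel_measurable borel" "g \<in> borel_measurable borel"
    and le: "\<And>y. g y \<le> f y" and fin: "\<And>y. g y \<le> c" "c < \<infinity>"
  shows "killed D t (\<lambda>y. f y - g y) x = killed D t f x - killed D t g x"
proof -
  have "killed D t g x < \<infinity>" using killed_le[where f = g and c = c, OF fin(1)] fin(2) by (rule order_le_less_trans)
  then have fin': "(\<integral>\<^sup>+w. (if alive D t (path_from x w) then g (x + path w t) else 0) \<partial>M) \<noteq> \<infinity>"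
    unfolding killed_def by simp
  have "killed D t (\<lambda>y. f y - g y) x =
    (\<integral>\<^sup>+w. (if alive D t (path_from x w) then f (x + path w t) else 0) -
       (if alive D t (path_from x w) then g (x + path w t) else 0) \<partial>M)"
    unfolding killed_def by (intro nn_integral_cong) auto
  also have "\<dots> = killed D t f x - killed D t g x"
    unfolding killed_def by (rule nn_integral_diff[OF _ _ fin']) (measurable, auto simp: le)
  finally show ?thesis .
qed

text \<open>A lower semicontinuous function whose difference to a constant is lower semicontinuous
  is continuous; both functions here are integrals against a continuous density, so Fatou's lemma
  applies.\<close>

lemma free_strong_Feller:
  assumes q: "\<And>y. isCont q y" "\<And>y. 0 \<le> q y" "distr M borel (X t) = density lborel (\<lambda>y. ennreal (q y))"
    and g[measurable]: "g \<in> borel_measurable borel" and gB: "\<And>y. g y \<le> ennreal B" and B: "B \<ge> 0"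
    and u: "u \<longlonglongrightarrow> x"
  shows "(\<lambda>n. enn2real (\<integral>\<^sup>+w. g (u n + path w t) \<partial>M)) \<longlonglongrightarrow> enn2real (\<integral>\<^sup>+w. g (x + path w t) \<partial>M)"
proof -
  have [measurable]: "q \<in> borel_measurable borel"
    by (intro borel_measurable_continuous_onI continuous_at_imp_continuous_on ballI q(1))
  have rep: "(\<integral>\<^sup>+w. f (y + path w t) \<partial>M) = (\<integral>\<^sup>+z. ennreal (q (z - y)) * f z \<partial>lborel)"
    if [measurable]: "f \<in> borel_measurable borel" for f y
  proof -
    have "(\<integral>\<^sup>+w. f (y + path w t) \<partial>M) = (\<integral>\<^sup>+z. f (y + z) \<partial>distr M borel (X t))"
      unfolding path_def by (rule nn_integral_distr[symmetric]) measurable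
    also have "\<dots> = (\<integral>\<^sup>+z. ennreal (q z) * f (y + z) \<partial>lborel)"
      unfolding q(3) by (rule nn_integral_density) measurable
    also have "\<dots> = (\<integral>\<^sup>+z. ennreal (q (z - y)) * f z \<partial>lborel)"
      using lborel_nn_integral_affine[of "\<lambda>z. ennreal (q (z - y)) * f z" 1 y] by simp
    finally show ?thesis .
  qed
  define F where "F f y = (\<integral>\<^sup>+w. f (y + path w t) \<partial>M)" for f :: "'a \<Rightarrow> ennreal" and y
  have lsc: "F f x \<le> liminf (\<lambda>n. F f (u n))" if [measurable]: "f \<in> borel_measurable borel" and "\<And>y. f y \<le> ennreal B" for f
  proof -
    have "F f x = (\<integral>\<^sup>+z. liminf (\<lambda>n. ennreal (q (z - u n)) * f z) \<partial>lborel)"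
      unfolding F_def rep[OF that(1)]
    proof (intro nn_integral_cong)
      fix z
      have "(\<lambda>n. q (z - u n)) \<longlonglongrightarrow> q (z - x)"
        by (rule isCont_tendsto_compose[OF q(1)]) (intro tendsto_intros u)
      then have "(\<lambda>n. ennreal (q (z - u n))) \<longlonglongrightarrow> ennreal (q (z - x))" by (rule tendsto_ennrealI)
      have "f z \<noteq> \<infinity>" using that(2)[of z] by (auto simp: top_unique)
      then have "(\<lambda>n. ennreal (q (z - u n)) * f z) \<longlonglongrightarrow> ennreal (q (z - x)) * f z"
        using \<open>(\<lambda>n. ennreal (q (z - u n))) \<longlonglongrightarrow> ennreal (q (z - x))\<close>
        using ennreal_tendsto_cmult[of "f z" "\<lambda>n. ennreal (q (z - u n))" "ennreal (q (z - x))" sequentially]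
        by (simp add: mult.commute less_top)
      then show "ennreal (q (z - x)) * f z = liminf (\<lambda>n. ennreal (q (z - u n)) * f z)"
        by (intro lim_imp_Liminf[symmetric]) auto
    qed
    also have "\<dots> \<le> liminf (\<lambda>n. \<integral>\<^sup>+z. ennreal (q (z - u n)) * f z \<partial>lborel)"
      by (rule nn_integral_liminf) measurable
    finally show ?thesis unfolding F_def rep[OF that(1)] .
  qed
  define g' where "g' y = ennreal B - g y" for y
  have [measurable]: "g' \<in> borel_measurable borel" unfolding g'_def by measurable
  have g'B: "g' y \<le> ennreal B" for y unfolding g'_def by (rule diff_le_self_ennreal)
  have sum: "F g y + F g' y = ennreal B" for y
  proof -
    have "F g y + F g' y = (\<integral>\<^sup>+w. g (y + path w t) + g' (y + path w t) \<partial>M)"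
      unfolding F_def by (rule nn_integral_add[symmetric]) measurable
    also have "\<dots> = (\<integral>\<^sup>+w. ennreal B \<partial>M)" unfolding g'_def using gB by (simp add: add_diff_inverse_ennreal)
    finally show ?thesis by (simp add: emeasure_space_1)
  qed
  have "F g y \<le> ennreal B" "F g' y \<le> ennreal B" for y
    using sum[of y] by (metis le_iff_add, metis le_iff_add add.commute)
  then have F_fin: "F g y < top" "F g' y < top" for y
    using order_le_less_trans[OF _ ennreal_less_top] by blast+
  define a where "a f y = enn2real (F f y)" for f y
  have aF: "F g y = ennreal (a g y)" "F g' y = ennreal (a g' y)" for y
    unfolding a_def using F_fin by simp_all
  have a0: "a f y \<ge> 0" for f y unfolding a_def by simp
  have aa: "a g y + a g' y = B" for y
  proof -
    have "ennreal (a g y + a g' y) = ennreal B"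
      using sum[of y] a0 unfolding aF by simp
    then show ?thesis using B a0 by (simp add: ennreal_inj del: ennreal_plus)
  qed
  have lsc_real: "eventually (\<lambda>n. c < a f (u n)) sequentially"
    if c: "c < a f x" and f: "f \<in> borel_measurable borel" "\<And>y. f y \<le> ennreal B" "\<And>y. F f y = ennreal (a f y)" for f c
  proof (cases "c < 0")
    case True
    then show ?thesis using a0 order_less_le_trans by (intro always_eventually allI) blast
  next
    case False
    then have "ennreal c < F f x" unfolding f(3) using c by (simp add: ennreal_less_iff)
    also have "\<dots> \<le> liminf (\<lambda>n. F f (u n))" by (rule lsc[OF f(1,2)])
    finally have "eventually (\<lambda>n. ennreal c < F f (u n)) sequentially" by (rule less_LiminfD)
    then show ?thesis unfolding f(3) using False by (simp add: ennreal_less_iff)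
  qed
  have "(\<lambda>n. a g (u n)) \<longlonglongrightarrow> a g x"
  proof (rule order_tendstoI)
    fix c assume "c < a g x"
    then show "eventually (\<lambda>n. c < a g (u n)) sequentially" by (rule lsc_real[OF _ g gB aF(1)])
  next
    fix c assume "c > a g x"
    then have "B - c < a g' x" using aa[of x] by linarith
    then have "eventually (\<lambda>n. B - c < a g' (u n)) sequentially"
      by (rule lsc_real[OF _ _ g'B aF(2)]) measurable
    then show "eventually (\<lambda>n. a g (u n) < c) sequentially"
    proof eventually_elim
      case (elim n) then show ?case using aa[of "u n"] by linarith
    qed
  qed
  then show ?thesis unfolding a_def F_def .
qed

text \<open>A margin \<open>2 * c\<close> at the start and a displacement below \<open>c\<close>
  leave a margin \<open>c\<close> throughout.\<close>

lemma alive_translate: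
  assumes "0 \<le> s" "alive (ball 0 c) s (path w)" and x: "2 * c \<le> infdist x (- D)" and c: "c > 0"
  shows "alive D s (path_from x w)"
proof -
  obtain n where n: "recip n < c" using nat_approx_posE[OF c] by blast
  have "recip n \<le> infdist (x + path w r) (- D)" if r: "r \<in> {0..s}" for r
  proof -
    have "path w r \<in> ball 0 c" using alive_imp_in[OF right_cont_path[of 0 w], of "ball 0 c" s r] assms r by simp
    moreover have "infdist x (- D) \<le> infdist (x + path w r) (- D) + dist x (x + path w r)"
      by (rule infdist_triangle)
    ultimately show ?thesis using x n by (simp add: dist_norm)
  qed
  then show ?thesis using alive_iff[OF right_cont_path assms(1)] by blast
qed

lemma measure_not_alive_tendsto_0:
  assumes c: "c > 0"
  shows "(\<lambda>i. measure M {w\<in>space M. \<not> alive (ball 0 c) (recip i) (path w)}) \<longlonglongrightarrow> 0"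
proof -
  let ?N = "\<lambda>i. {w\<in>space M. \<not> alive (ball 0 c) (recip i) (path w)}"
  have bd: "- ball 0 c \<noteq> ({} :: 'a set)"
  proof -
    have "bounded (ball (0::'a) c)" by simp
    then show ?thesis using not_bounded_UNIV[where 'a='a] by (metis double_compl Compl_empty_eq)
  qed
  have "(\<lambda>i. \<integral>w. indicator (?N i) w \<partial>M) \<longlonglongrightarrow> (\<integral>w. (0::real) \<partial>M)"
  proof (rule integral_dominated_convergence[where w="\<lambda>_. 1"])
    show "AE w in M. (\<lambda>i. indicator (?N i) w) \<longlonglongrightarrow> (0::real)"
    proof (intro always_eventually allI)
      fix w
      have rc: "right_cont (path w)" using right_cont_path[of 0 w] by simp
      have "alive (ball 0 c) 0 (path w)"
        by (rule alive_0) (use bd c in \<open>auto simp: path_def X_nonpos\<close>)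
      then obtain u where u: "u > 0" "alive (ball 0 c) u (path w)" using alive_extend[OF rc] by blast
      have "eventually (\<lambda>i. recip i < u) sequentially"
        using order_tendstoD(2)[OF LIMSEQ_Suc[OF lim_1_over_n] u(1)] by simp
      then have "eventually (\<lambda>i. indicator (?N i) w = (0::real)) sequentially"
      proof eventually_elim
        case (elim i)
        then have "alive (ball 0 c) (recip i) (path w)" by (intro alive_mono[OF rc u(2)]) auto
        then show ?case by (simp add: indicator_def)
      qed
      then show "(\<lambda>i. indicator (?N i) w) \<longlonglongrightarrow> (0::real)"
        by (rule tendsto_eventually)
    qed
  qed (auto simp: indicator_def)
  then show ?thesis by simp
qed

text \<open>The integral in the middle lets the process run freely up to \<open>s\<close> and kills
  it only afterwards. It differs from \<open>killed D t g\<close> only on paths that die by time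
  \<open>s\<close>, and these leave the ball of radius \<open>c\<close>.\<close>

lemma killed_free_bounds:
  assumes s: "0 \<le> s" "s \<le> t" and g[measurable]: "g \<in> borel_measurable borel" and gB: "\<And>y. g y \<le> ennreal B"
    and y: "2 * c \<le> infdist y (- D)" and c: "c > 0"
  shows "killed D t g y \<le> (\<integral>\<^sup>+w. killed D (t - s) g (y + path w s) \<partial>M)"
    and "(\<integral>\<^sup>+w. killed D (t - s) g (y + path w s) \<partial>M) \<le>
      killed D t g y + ennreal B * emeasure M {w\<in>space M. \<not> alive (ball 0 c) s (path w)}"
proof -
  let ?N = "{w\<in>space M. \<not> alive (ball 0 c) s (path w)}"
  let ?A = "\<lambda>w. alive D (t - s) (\<lambda>r. y + path w s + shifted s (path w) r)"
  define \<Psi> where "\<Psi> z = (if alive D (t - s) (\<lambda>r. fst z + snd z r) then g (fst z + snd z (t - s)) else 0)"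
    for z :: "'a \<times> (real \<Rightarrow> 'a)"
  have [measurable]: "\<Psi> \<in> borel_measurable (borel \<Otimes>\<^sub>M path_space)"
    unfolding \<Psi>_def[abs_def] by measurable
  have "(\<integral>\<^sup>+w. killed D (t - s) g (y + path w s) \<partial>M) = (\<integral>\<^sup>+w. (\<integral>\<^sup>+w'. \<Psi> (y + path w s, path w') \<partial>M) \<partial>M)"
    unfolding \<Psi>_def killed_def fst_conv snd_conv ..
  also have "\<dots> = (\<integral>\<^sup>+w. \<Psi> (y + path w s, shifted s (path w)) \<partial>M)"
    using stopped_Markov[OF s(1), of "\<lambda>_. True" \<Psi> y] by simp
  also have "\<dots> = (\<integral>\<^sup>+w. (if ?A w then g (y + path w t) else 0) \<partial>M)"
    unfolding \<Psi>_def fst_conv snd_conv using s by (intro nn_integral_cong) (simp add: shifted_def)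
  finally have free: "(\<integral>\<^sup>+w. killed D (t - s) g (y + path w s) \<partial>M) = (\<integral>\<^sup>+w. (if ?A w then g (y + path w t) else 0) \<partial>M)" .
  have al: "alive D t (path_from y w) \<longleftrightarrow> alive D s (path_from y w) \<and> ?A w" for w
    using alive_add_path[of s "t - s" D y w] s by simp
  show "killed D t g y \<le> (\<integral>\<^sup>+w. killed D (t - s) g (y + path w s) \<partial>M)"
    unfolding free unfolding killed_def al by (intro nn_integral_mono) auto
  have "(\<integral>\<^sup>+w. (if ?A w then g (y + path w t) else 0) \<partial>M) \<le>
      (\<integral>\<^sup>+w. (if alive D t (path_from y w) then g (y + path w t) else 0) + ennreal B * indicator ?N w \<partial>M)"
  proof (rule nn_integral_mono)
    fix w assume w: "w \<in> space M"
    show "(if ?A w then g (y + path w t) else 0) \<le>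
      (if alive D t (path_from y w) then g (y + path w t) else 0) + ennreal B * indicator ?N w"
    proof (cases "alive (ball 0 c) s (path w)")
      case True
      then show ?thesis using alive_translate[OF s(1) True y c] al by simp
    next
      case False
      then have "(if ?A w then g (y + path w t) else 0) \<le> ennreal B * indicator ?N w"
        using gB w by simp
      then show ?thesis by (rule order_trans) simp
    qed
  qed
  also have "\<dots> = killed D t g y + ennreal B * emeasure M ?N"
    unfolding killed_def by (subst nn_integral_add) (auto simp: nn_integral_cmult)
  finally show "(\<integral>\<^sup>+w. killed D (t - s) g (y + path w s) \<partial>M) \<le> killed D t g y + ennreal B * emeasure M ?N"
    unfolding free .
qed

definition has_continuous_densities :: bool where
  "has_continuous_densities \<longleftrightarrow> (\<forall>s>0. \<exists>q. (\<forall>y. isCont q y \<and> 0 \<le> q y) \<and>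
     distr M borel (X s) = density lborel (\<lambda>y. ennreal (q y)))"

text \<open>The functions \<open>Q s\<close>, in which killing starts only at time
  \<open>s > 0\<close>, are continuous because \<open>X s\<close> has a continuous density. As
  \<open>s\<close> tends to 0 they converge to the killed semigroup, uniformly near
  \<open>x\<close>.\<close>

theorem killed_strong_Feller:
  assumes dens: has_continuous_densities
    and D: "open D" "- D \<noteq> {}" and t: "t > 0" and g[measurable]: "g \<in> borel_measurable borel"
    and gB: "\<And>y. g y \<le> ennreal B" and B: "B \<ge> 0"
  shows "continuous_on D (\<lambda>x. enn2real (killed D t g x))"
  unfolding continuous_on_eq_continuous_at[OF D(1)] continuous_at_sequentially
proof (intro ballI allI impI)
  fix x u assume x: "x \<in> D" and u: "u \<longlonglongrightarrow> x"
  \<comment> \<open>A third of the distance, so that \<open>2 * c\<close> stays below it at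
    \<open>x\<close> and, by continuity, at all nearby points.\<close>
  define c where "c = infdist x (- D) / 3"
  have c: "c > 0"
    using x D in_closed_iff_infdist_zero[of "- D" x] infdist_nonneg[of x "- D"] by (auto simp: c_def order_less_le)
  define K where "K y = enn2real (killed D t g y)" for y
  define Q where "Q s y = enn2real (\<integral>\<^sup>+w. killed D (t - s) g (y + path w s) \<partial>M)" for s y
  define \<epsilon> where "\<epsilon> s = measure M {w\<in>space M. \<not> alive (ball 0 c) s (path w)}" for s
  have QK: "\<bar>Q s y - K y\<bar> \<le> B * \<epsilon> s" if s: "0 \<le> s" "s \<le> t" and y: "2 * c \<le> infdist y (- D)" for s y
  proof -
    let ?I = "\<integral>\<^sup>+w. killed D (t - s) g (y + path w s) \<partial>M"
    note b = killed_free_bounds[OF s g gB y c]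
    have "?I \<le> (\<integral>\<^sup>+w. ennreal B \<partial>M)" by (intro nn_integral_mono killed_le gB)
    then have "?I \<le> ennreal B" by (simp add: emeasure_space_1)
    then have I_fin: "?I < top" by (rule order_le_less_trans) simp
    have K_fin: "killed D t g y < top" using b(1) I_fin by (rule order_le_less_trans)
    have 1: "?I = ennreal (Q s y)" "killed D t g y = ennreal (K y)"
      unfolding Q_def K_def using I_fin K_fin by simp_all
    have 0: "0 \<le> Q s y" "0 \<le> K y" "0 \<le> B * \<epsilon> s" unfolding Q_def K_def \<epsilon>_def using B by simp_all
    have "ennreal (K y) \<le> ennreal (Q s y)" using b(1) unfolding 1 .
    then have "K y \<le> Q s y" using 0 by simp
    moreover have "ennreal (Q s y) \<le> ennreal (K y + B * \<epsilon> s)"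
      using b(2) 0 B unfolding 1 by (simp add: \<epsilon>_def emeasure_eq_measure ennreal_mult)
    then have "Q s y \<le> K y + B * \<epsilon> s" using 0 by (subst (asm) ennreal_le_iff) auto
    ultimately show ?thesis by simp
  qed
  have \<epsilon>_lim: "(\<lambda>i. \<epsilon> (recip i)) \<longlonglongrightarrow> 0" unfolding \<epsilon>_def by (rule measure_not_alive_tendsto_0[OF c])
  have Q_lim: "(\<lambda>n. Q s (u n)) \<longlonglongrightarrow> Q s x" if s: "s > 0" for s
  proof -
    obtain q where q: "\<And>y. isCont q y" "\<And>y. 0 \<le> q y" "distr M borel (X s) = density lborel (\<lambda>y. ennreal (q y))"
      using dens s unfolding has_continuous_densities_def by blast
    show ?thesis unfolding Q_def
      by (rule free_strong_Feller[OF q _ _ B u]) (measurable, rule killed_le[OF gB])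
  qed
  have "(\<lambda>n. K (u n)) \<longlonglongrightarrow> K x"
  proof (rule LIMSEQ_I)
    fix r :: real assume r: "r > 0"
    have "(\<lambda>i. B * \<epsilon> (recip i)) \<longlonglongrightarrow> B * 0" by (intro tendsto_intros \<epsilon>_lim)
    then have "eventually (\<lambda>i. B * \<epsilon> (recip i) < r / 3) sequentially"
      by (rule order_tendstoD(2)) (use r in simp)
    moreover have "eventually (\<lambda>i. recip i < t) sequentially"
      using order_tendstoD(2)[OF LIMSEQ_Suc[OF lim_1_over_n] t] by simp
    ultimately have "eventually (\<lambda>i. B * \<epsilon> (recip i) < r / 3 \<and> recip i < t) sequentially"
      by eventually_elim simp
    then obtain i where i: "B * \<epsilon> (recip i) < r / 3" "recip i < t"
      unfolding eventually_sequentially by blast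
    define s where "s = recip i"
    have s: "0 < s" "s \<le> t" "B * \<epsilon> s < r / 3" using i by (simp_all add: s_def)
    have "(\<lambda>n. infdist (u n) (- D)) \<longlonglongrightarrow> infdist x (- D)" by (intro tendsto_intros u)
    then have "eventually (\<lambda>n. 2 * c < infdist (u n) (- D)) sequentially"
      by (rule order_tendstoD(1)) (use c in \<open>simp add: c_def\<close>)
    moreover have "eventually (\<lambda>n. \<bar>Q s (u n) - Q s x\<bar> < r / 3) sequentially"
      using LIMSEQ_D[OF Q_lim[OF s(1)], of "r / 3"] r by (auto simp: eventually_sequentially)
    ultimately have "eventually (\<lambda>n. norm (K (u n) - K x) < r) sequentially"
    proof eventually_elim
      case (elim n)
      have "\<bar>Q s (u n) - K (u n)\<bar> \<le> B * \<epsilon> s" using s elim by (intro QK) auto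
      moreover have "\<bar>Q s x - K x\<bar> \<le> B * \<epsilon> s" using s c by (intro QK) (auto simp: c_def)
      ultimately show ?case using elim s(3) by (simp add: abs_if split: if_splits)
    qed
    then show "\<exists>no. \<forall>n\<ge>no. norm (K (u n) - K x) < r" by (simp add: eventually_sequentially)
  qed
  then show "((\<lambda>x. enn2real (killed D t g x)) \<circ> u) \<longlonglongrightarrow> enn2real (killed D t g x)"
    unfolding K_def comp_def .
qed

end

section \<open>Harmonic functions are excessive\<close>

text \<open>It takes countably many values, so a path can be evaluated there measurably even at a
  random time. It lies strictly above \<open>t\<close>, so right continuity recovers the value at
  \<open>t\<close> in the limit.\<close>

definition dyadic_above :: "nat \<Rightarrow> real \<Rightarrow> real" where
  "dyadic_above m t = (real_of_int \<lfloor>2 ^ m * t\<rfloor> + 1) / 2 ^ m"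

lemma filterlim_dyadic_above: "filterlim (\<lambda>m. dyadic_above m t) (at_right t) sequentially"
proof -
  have gt: "t < dyadic_above m t" and le: "dyadic_above m t \<le> t + (1 / 2) ^ m" for m
  proof -
    have "2 ^ m * t < real_of_int \<lfloor>2 ^ m * t\<rfloor> + 1" "real_of_int \<lfloor>2 ^ m * t\<rfloor> \<le> 2 ^ m * t" by linarith+
    then show "t < dyadic_above m t" "dyadic_above m t \<le> t + (1 / 2) ^ m"
      by (simp_all add: dyadic_above_def field_simps power_one_over)
  qed
  have "(\<lambda>m. dyadic_above m t) \<longlonglongrightarrow> t"
  proof (rule tendsto_sandwich[OF _ _ tendsto_const])
    have "(\<lambda>m. t + (1 / 2) ^ m) \<longlonglongrightarrow> t + 0" by (intro tendsto_intros LIMSEQ_realpow_zero) auto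
    then show "(\<lambda>m. t + (1 / 2) ^ m) \<longlonglongrightarrow> t" by simp
  qed (use gt le in \<open>auto intro!: always_eventually less_imp_le\<close>)
  then show ?thesis using gt by (auto simp: filterlim_at less_imp_neq[symmetric])
qed

lemma dyadic_above_tendsto: "right_cont p \<Longrightarrow> 0 \<le> t \<Longrightarrow> (\<lambda>m. p (dyadic_above m t)) \<longlonglongrightarrow> p t"
  by (rule filterlim_compose[OF right_contD filterlim_dyadic_above])

lemma measurable_dyadic_above_eval:
  assumes [measurable]: "\<And>r. (\<lambda>z. P z r) \<in> borel_measurable N" and [measurable]: "T \<in> borel_measurable N"
  shows "(\<lambda>z. P z (dyadic_above m (T z)) :: 'a::euclidean_space) \<in> borel_measurable N"
proof -
  have "(\<lambda>z. (\<lambda>i z. P z ((real_of_int i + 1) / 2 ^ m)) \<lfloor>2 ^ m * T z\<rfloor> z) \<in> borel_measurable N"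
    by (rule measurable_compose_countable) measurable
  then show ?thesis by (simp add: dyadic_above_def)
qed

text \<open>The measurable counterpart of the exit time on all paths. Rational times that are not
  survived contribute 0, which does no harm because lifetimes are nonnegative.\<close>

definition lifespan :: "'a::euclidean_space set \<Rightarrow> (real \<Rightarrow> 'a) \<Rightarrow> ereal" where
  "lifespan U p = (SUP q::rat. if 0 \<le> real_of_rat q \<and> alive U (real_of_rat q) p then ereal (real_of_rat q) else 0)"

text \<open>A version of \<open>at_exit\<close> that is measurable on the product space of all paths, because it
  evaluates the path at countably many times only.\<close>

definition exit_value :: "('a::euclidean_space \<Rightarrow> real) \<Rightarrow> 'a set \<Rightarrow> (real \<Rightarrow> 'a) \<Rightarrow> ennreal" where
  "exit_value h U p = (if lifespan U p < \<infinity>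
     then ennreal (h (lim (\<lambda>m. p (dyadic_above m (real_of_ereal (lifespan U p)))))) else 0)"

lemma measurable_exit_value:
  assumes [measurable]: "\<And>r. (\<lambda>z. P z r) \<in> borel_measurable N" and [measurable]: "h \<in> borel_measurable borel"
  shows "(\<lambda>z. exit_value h U (P z)) \<in> borel_measurable N"
proof -
  have [measurable]: "(\<lambda>z. lifespan U (P z)) \<in> borel_measurable N"
    unfolding lifespan_def by measurable
  have [measurable]: "(\<lambda>z. P z (dyadic_above m (real_of_ereal (lifespan U (P z))))) \<in> borel_measurable N" for m
    by (rule measurable_dyadic_above_eval) measurable
  have [measurable]: "(\<lambda>z. lim (\<lambda>m. P z (dyadic_above m (real_of_ereal (lifespan U (P z)))))) \<in> borel_measurable N"
    by (rule borel_measurable_lim_metric) measurable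
  show ?thesis unfolding exit_value_def by measurable
qed

lemma lifespan_nonneg: "0 \<le> lifespan U p"
  unfolding lifespan_def by (rule SUP_upper2[of 0]) auto

lemma lifespan_upper: "0 \<le> real_of_rat q \<Longrightarrow> alive U (real_of_rat q) p \<Longrightarrow> ereal (real_of_rat q) \<le> lifespan U p"
  unfolding lifespan_def by (rule SUP_upper2[of q]) auto

lemma lifespan_eq:
  assumes \<zeta>: "\<zeta> \<ge> 0" and alive: "\<And>u. 0 \<le> u \<Longrightarrow> alive U u p \<longleftrightarrow> u < \<zeta>"
  shows "lifespan U p = ereal \<zeta>"
proof (rule antisym)
  show "lifespan U p \<le> ereal \<zeta>"
    unfolding lifespan_def using \<zeta> alive by (intro SUP_least) (auto intro: less_imp_le)
  show "ereal \<zeta> \<le> lifespan U p"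
  proof (rule ccontr)
    assume "\<not> ereal \<zeta> \<le> lifespan U p"
    then have l: "lifespan U p < ereal \<zeta>" by simp
    then obtain s where s: "lifespan U p = ereal s" "0 \<le> s"
      using lifespan_nonneg[of U p] by (cases "lifespan U p") auto
    then obtain q where q: "s < real_of_rat q" "real_of_rat q < \<zeta>" using of_rat_dense[of s \<zeta>] l by auto
    then have nn: "0 \<le> real_of_rat q" using s by linarith
    then have "ereal (real_of_rat q) \<le> lifespan U p" using q alive by (intro lifespan_upper) auto
    then show False using s q by simp
  qed
qed

lemma lifespan_top:
  assumes "\<And>u. 0 \<le> u \<Longrightarrow> alive U u p"
  shows "lifespan U p = \<infinity>"
proof (rule ccontr)
  assume "lifespan U p \<noteq> \<infinity>"
  then obtain s where s: "lifespan U p = ereal s" "0 \<le> s"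
    using lifespan_nonneg[of U p] by (cases "lifespan U p") auto
  then obtain q where q: "s < real_of_rat q" using of_rat_dense[of s "s + 1"] by auto
  then have nn: "0 \<le> real_of_rat q" using s by linarith
  then have "ereal (real_of_rat q) \<le> lifespan U p" using assms by (intro lifespan_upper) auto
  then show False using s q by simp
qed

lemma exit_value_eq:
  assumes "right_cont p" "\<zeta> \<ge> 0" "\<And>u. 0 \<le> u \<Longrightarrow> alive U u p \<longleftrightarrow> u < \<zeta>"
  shows "exit_value h U p = ennreal (h (p \<zeta>))"
proof -
  have "lifespan U p = ereal \<zeta>" by (rule lifespan_eq) (use assms in auto)
  then show ?thesis
    using limI[OF dyadic_above_tendsto[OF assms(1,2)]] by (simp add: exit_value_def)
qed

lemma exit_value_top: "(\<And>u. 0 \<le> u \<Longrightarrow> alive U u p) \<Longrightarrow> exit_value h U p = 0"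
  unfolding exit_value_def by (simp add: lifespan_top)

lemma lifetime_cases:
  assumes p: "right_cont p" and U: "open U" "- U \<noteq> {}" "p 0 \<in> U"
  obtains (immortal) "\<And>u. 0 \<le> u \<Longrightarrow> alive U u p"
    | (mortal) \<zeta> where "\<zeta> > 0" "\<And>u. 0 \<le> u \<Longrightarrow> alive U u p \<longleftrightarrow> u < \<zeta>"
  using lifetime(4,5)[OF p U] by metis

text \<open>The shifted path has remaining lifetime \<open>\<zeta> - t\<close> and thus exits at the
  same point; immortal paths give 0 on both sides.\<close>

lemma exit_value_shift:
  assumes p: "right_cont p" and U: "open U" "- U \<noteq> {}" "p 0 \<in> U" and t: "0 \<le> t" and alive: "alive U t p"
  shows "exit_value h U (\<lambda>r. p (t + max r 0)) = exit_value h U p"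
proof (cases rule: lifetime_cases[OF p U, case_names immortal mortal])
  case immortal
  then have "alive U u (\<lambda>r. p (t + max r 0))" if "0 \<le> u" for u
    using alive_add_iff[OF p t that, of U] t that by simp
  then show ?thesis using immortal by (simp add: exit_value_top)
next
  case (mortal \<zeta>)
  have \<zeta>: "t < \<zeta>" using mortal(2)[OF t] alive by simp
  have "alive U u (\<lambda>r. p (t + max r 0)) \<longleftrightarrow> u < \<zeta> - t" if "0 \<le> u" for u
    using alive_add_iff[OF p t that, of U] mortal(2)[of "t + u"] t that alive by auto
  then have "exit_value h U (\<lambda>r. p (t + max r 0)) = ennreal (h (p (t + max (\<zeta> - t) 0)))"
    using \<zeta> by (intro exit_value_eq[OF right_cont_shift[OF p t]]) auto
  also have "\<dots> = ennreal (h (p \<zeta>))" using \<zeta> by simp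
  also have "\<dots> = exit_value h U p" using mortal by (intro exit_value_eq[OF p, symmetric]) auto
  finally show ?thesis .
qed

lemma at_exit_eq_exit_value:
  assumes p: "right_cont p" and U: "open U" "- U \<noteq> {}" "p 0 \<in> U"
    and exit: "\<And>t. 0 \<le> t \<Longrightarrow> ereal t < exit_time U p \<longleftrightarrow> alive U t p"
  shows "at_exit h U p = exit_value h U p"
proof (cases rule: lifetime_cases[OF p U, case_names immortal mortal])
  case immortal
  have "exit_time U p = \<infinity>"
  proof (rule ccontr)
    assume "exit_time U p \<noteq> \<infinity>"
    moreover have "0 < exit_time U p" using exit[of 0] immortal by (simp add: zero_ereal_def)
    ultimately obtain s where "exit_time U p = ereal s" "s > 0" by (cases "exit_time U p") auto
    then show False using exit[of s] immortal[of s] by simp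
  qed
  then show ?thesis using immortal by (simp add: at_exit_def exit_value_top)
next
  case (mortal \<zeta>)
  have "\<not> ereal \<zeta> < exit_time U p" using exit[of \<zeta>] mortal by simp
  moreover have "0 < exit_time U p" using exit[of 0] mortal by (simp add: zero_ereal_def)
  ultimately obtain s where s: "exit_time U p = ereal s" "s > 0" "s \<le> \<zeta>" by (cases "exit_time U p") auto
  have "\<not> s < \<zeta>" using exit[of s] mortal(2)[of s] s by simp
  then have "exit_time U p = ereal \<zeta>" using s by simp
  moreover have "exit_value h U p = ennreal (h (p \<zeta>))" using mortal by (intro exit_value_eq[OF p]) auto
  ultimately show ?thesis by (simp add: at_exit_def)
qed

text \<open>These sets exhaust an open \<open>D\<close> and have closure in \<open>D\<close>, as
  harmonicity requires.\<close>

definition shrink :: "'a::euclidean_space set \<Rightarrow> nat \<Rightarrow> 'a set" where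
  "shrink D n = {y. recip n < infdist y (- D)}"

lemma shrink:
  assumes "- D \<noteq> {}"
  shows "open (shrink D n)" and "closure (shrink D n) \<subseteq> D" and "shrink D n \<subseteq> D"
    and "- shrink D n \<noteq> {}"
proof -
  show "open (shrink D n)" unfolding shrink_def by (rule open_infdist_greater)
  have cl: "closed {y. recip n \<le> infdist y (- D)}"
    by (intro closed_Collect_le continuous_intros)
  have sub: "{y. recip n \<le> infdist y (- D)} \<subseteq> D"
  proof
    fix y assume y: "y \<in> {y. recip n \<le> infdist y (- D)}"
    show "y \<in> D"
    proof (rule ccontr)
      assume "y \<notin> D" then have "infdist y (- D) = 0" by simp
      moreover have "recip n > 0" by simp
      ultimately show False using y by simp
    qed
  qed
  have "closure (shrink D n) \<subseteq> {y. recip n \<le> infdist y (- D)}"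
    by (rule closure_minimal[OF _ cl]) (auto simp: shrink_def)
  then show c: "closure (shrink D n) \<subseteq> D" using sub by blast
  then show "shrink D n \<subseteq> D" using closure_subset by blast
  then show "- shrink D n \<noteq> {}" using assms by blast
qed

lemma shrink_mono: "n \<le> m \<Longrightarrow> shrink D n \<subseteq> shrink D m"
proof
  fix y assume "n \<le> m" "y \<in> shrink D n"
  moreover have "recip m \<le> recip n" using \<open>n \<le> m\<close> by (intro divide_left_mono) auto
  ultimately show "y \<in> shrink D m" by (simp add: shrink_def)
qed

lemma alive_subset:
  assumes "U \<subseteq> V" "- V \<noteq> {}" "alive U t p" shows "alive V t p"
proof -
  have "infdist y (- U) \<le> infdist y (- V)" for y
    using assms by (intro infdist_mono) auto
  then show ?thesis using assms(3) unfolding alive_def alive_in_def by (meson order_trans)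
qed

text \<open>The distance to the complement of \<open>D\<close> is 1-Lipschitz, so points at distance
  at least \<open>recip n\<close> keep the margin \<kappa>, the gap between two levels, from the
  complement of \<open>shrink D (Suc n)\<close>.\<close>

lemma alive_iff_shrink:
  assumes D: "- D \<noteq> {}"
  shows "alive D t p \<longleftrightarrow> (\<exists>n. alive (shrink D n) t p)"
proof
  assume "\<exists>n. alive (shrink D n) t p"
  then show "alive D t p" using alive_subset[OF shrink(3)[OF D] D] by blast
next
  assume "alive D t p"
  then obtain n where n: "alive_in D n t p" by (auto simp: alive_def)
  define \<kappa> where "\<kappa> = recip n - recip (Suc n)"
  have "\<kappa> > 0" unfolding \<kappa>_def by (simp add: divide_strict_left_mono)
  then obtain m where m: "recip m < \<kappa>" using nat_approx_posE by blast
  have *: "recip m \<le> infdist y (- shrink D (Suc n))" if y: "recip n \<le> infdist y (- D)" for y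
  proof -
    have "\<kappa> \<le> infdist y (- shrink D (Suc n))"
      unfolding infdist_notempty[OF shrink(4)[OF D]]
    proof (rule cINF_greatest[OF shrink(4)[OF D]])
      fix z assume "z \<in> - shrink D (Suc n)"
      then have "infdist z (- D) \<le> recip (Suc n)" by (simp add: shrink_def)
      then show "\<kappa> \<le> dist y z" unfolding \<kappa>_def using infdist_triangle[of y "- D" z] y by linarith
    qed
    then show ?thesis using m by linarith
  qed
  have "alive_in (shrink D (Suc n)) m t p"
    using n * unfolding alive_in_def by blast
  then show "\<exists>n. alive (shrink D n) t p" unfolding alive_def by blast
qed

context rc_levy
begin

lemma path_0: "x + path w 0 = x" by (simp add: path_def X_nonpos)

text \<open>Exit time and lifetime agree up to a null set, so the integrand can be replaced by one
  measurable for \<open>M\<close>, on which the completion has the same integral.\<close>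

lemma nn_integral_exit_value:
  assumes U: "open U" "- U \<noteq> {}" and x: "x \<in> U" and [measurable]: "h \<in> borel_measurable borel"
  shows "expectation_from M X x (at_exit h U) = (\<integral>\<^sup>+w. exit_value h U (path_from x w) \<partial>M)"
proof -
  have m: "(\<lambda>w. exit_value h U (path_from x w)) \<in> borel_measurable M"
    by (rule measurable_exit_value) measurable
  have "AE w in M. at_exit h U (path_from x w) = exit_value h U (path_from x w)"
    using AE_less_exit_time_iff_alive[OF U x]
  proof eventually_elim
    case (elim w)
    then show ?case using right_cont_path U x by (intro at_exit_eq_exit_value) (auto simp: path_0)
  qed
  then have "AE w in completion M. at_exit h U (path_from x w) = exit_value h U (path_from x w)"
    by (rule AE_completion)
  then have "expectation_from M X x (at_exit h U) = (\<integral>\<^sup>+w. exit_value h U (path_from x w) \<partial>completion M)"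
    unfolding expectation_from_def by (intro nn_integral_cong_AE) (simp add: path_def)
  also have "\<dots> = (\<integral>\<^sup>+w. exit_value h U (path_from x w) \<partial>M)"
    by (rule nn_integral_completion)
  finally show ?thesis .
qed

text \<open>On survival up to time \<open>t\<close> the exit position is that of the path shifted by \<open>t\<close>.\<close>

lemma nn_integral_exit_value_alive:
  assumes U: "open U" "- U \<noteq> {}" and x: "x \<in> U" and [measurable]: "h \<in> borel_measurable borel" and t: "0 \<le> t"
  shows "(\<integral>\<^sup>+w. (if alive U t (path_from x w) then exit_value h U (path_from x w) else 0) \<partial>M) =
    killed U t (\<lambda>y. \<integral>\<^sup>+w. exit_value h U (path_from y w) \<partial>M) x"
proof -
  define \<Psi> where "\<Psi> z = exit_value h U (\<lambda>r. fst z + snd z r)" for z :: "'a \<times> (real \<Rightarrow> 'a)"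
  have [measurable]: "\<Psi> \<in> borel_measurable (borel \<Otimes>\<^sub>M path_space)"
    unfolding \<Psi>_def[abs_def] by (rule measurable_exit_value) measurable
  have "(\<integral>\<^sup>+w. (if alive U t (path_from x w) then exit_value h U (path_from x w) else 0) \<partial>M) =
     (\<integral>\<^sup>+w. (if alive U t (path_from x w) then \<Psi> (x + path w t, shifted t (path w)) else 0) \<partial>M)"
  proof (rule nn_integral_cong)
    fix w
    have "\<Psi> (x + path w t, shifted t (path w)) = exit_value h U (\<lambda>r. x + path w (t + max r 0))"
      by (simp add: \<Psi>_def shifted_def add.assoc)
    also have "\<dots> = exit_value h U (path_from x w)" if "alive U t (path_from x w)"
      using exit_value_shift[OF right_cont_path U _ t that] x by (simp add: path_0)
    finally show "(if alive U t (path_from x w) then exit_value h U (path_from x w) else 0) =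
       (if alive U t (path_from x w) then \<Psi> (x + path w t, shifted t (path w)) else 0)" by simp
  qed
  also have "\<dots> = killed U t (\<lambda>y. \<integral>\<^sup>+w. \<Psi> (y, path w) \<partial>M) x"
    by (rule killed_Markov[OF t]) measurable
  finally show ?thesis unfolding \<Psi>_def fst_conv snd_conv .
qed

context
  fixes D :: "'a set" and h :: "'a \<Rightarrow> real"
  assumes D: "open D" "- D \<noteq> {}" and meas_h [measurable]: "h \<in> borel_measurable borel"
    and harmonic: "\<And>U x. open U \<Longrightarrow> closure U \<subseteq> D \<Longrightarrow> x \<in> U \<Longrightarrow>
      ennreal (h x) = expectation_from M X x (at_exit h U)"
begin

text \<open>Given survival up to \<open>t\<close>, the exit value is that of the process restarted
  at its current position, and by harmonicity its mean is the value of \<open>h\<close>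
  there.\<close>

lemma killed_interior_harmonic:
  assumes x: "x \<in> shrink D n" and t: "0 \<le> t"
  shows "killed (shrink D n) t (\<lambda>y. ennreal (h y)) x =
    (\<integral>\<^sup>+w. (if alive (shrink D n) t (path_from x w)
       then exit_value h (shrink D n) (path_from x w) else 0) \<partial>M)"
proof -
  note U = shrink[OF D(2), of n]
  show ?thesis
    unfolding nn_integral_exit_value_alive[OF U(1,4) x meas_h t]
  proof (rule killed_cong[OF t])
    fix y assume y: "y \<in> shrink D n"
    show "ennreal (h y) = (\<integral>\<^sup>+w. exit_value h (shrink D n) (path_from y w) \<partial>M)"
      using harmonic[OF U(1,2) y] nn_integral_exit_value[OF U(1,4) y meas_h] by simp
  qed
qed

text \<open>In \<open>shrink D n\<close> the survivors carry only a part of the exit value, whose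
  full mean is \<open>h x\<close>. Survival in \<open>D\<close> is the increasing union of survivals
  in these sets, so monotone convergence concludes.\<close>

lemma killed_harmonic_le:
  assumes t: "0 \<le> t"
  shows "killed D t (\<lambda>y. ennreal (h y)) x \<le> ennreal (h x)"
proof -
  have n_le: "killed (shrink D n) t (\<lambda>y. ennreal (h y)) x \<le> ennreal (h x)" for n
  proof (cases "x \<in> shrink D n")
    case True
    note U = shrink[OF D(2), of n]
    have "killed (shrink D n) t (\<lambda>y. ennreal (h y)) x \<le>
        (\<integral>\<^sup>+w. exit_value h (shrink D n) (path_from x w) \<partial>M)"
      unfolding killed_interior_harmonic[OF True t] by (intro nn_integral_mono) auto
    also have "\<dots> = ennreal (h x)"
      using harmonic[OF U(1,2) True] nn_integral_exit_value[OF U(1,4) True meas_h] by simp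
    finally show ?thesis .
  qed (simp add: killed_outside[OF _ t])
  have "killed D t (\<lambda>y. ennreal (h y)) x = (\<integral>\<^sup>+w. (SUP n. if alive (shrink D n) t (path_from x w)
      then ennreal (h (x + path w t)) else 0) \<partial>M)"
    unfolding killed_def
  proof (rule nn_integral_cong)
    fix w
    show "(if alive D t (path_from x w) then ennreal (h (x + path w t)) else 0) =
      (SUP n. if alive (shrink D n) t (path_from x w) then ennreal (h (x + path w t)) else 0)"
    proof (cases "alive D t (path_from x w)")
      case True
      then obtain n where n: "alive (shrink D n) t (path_from x w)"
        using alive_iff_shrink[OF D(2)] by blast
      show ?thesis using True n
        by (intro antisym SUP_upper2[of n] SUP_least) auto
    next
      case False
      then have "\<not> alive (shrink D n) t (path_from x w)" for n
        using alive_iff_shrink[OF D(2)] by blast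
      then show ?thesis using False by simp
    qed
  qed
  also have "\<dots> = (SUP n. killed (shrink D n) t (\<lambda>y. ennreal (h y)) x)"
    unfolding killed_def
  proof (rule nn_integral_monotone_convergence_SUP)
    show "incseq (\<lambda>n w. if alive (shrink D n) t (path_from x w) then ennreal (h (x + path w t)) else 0)"
      unfolding incseq_def le_fun_def
      using alive_subset[OF shrink_mono shrink(4)[OF D(2)]] by fastforce
  qed measurable
  also have "\<dots> \<le> ennreal (h x)" by (rule SUP_least) (rule n_le)
  finally show ?thesis .
qed

text \<open>A single \<open>U\<close> around \<open>x\<close> suffices: by right continuity every
  path from \<open>x\<close> survives in \<open>U\<close> for some positive time, so the mean of the
  exit value over the survivors up to \<open>recip i\<close> increases to
  \<open>h x\<close>.\<close>

lemma killed_harmonic_SUP: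
  assumes x: "x \<in> D"
  shows "ennreal (h x) \<le> (SUP i. killed D (recip i) (\<lambda>y. ennreal (h y)) x)"
proof -
  have "alive D 0 (\<lambda>_. x)" by (rule alive_0) (use D x in auto)
  then have "infdist x (- D) > 0" unfolding alive_def alive_in_def
    by (metis less_le_trans zero_less_divide_1_iff of_nat_0_less_iff zero_less_Suc)
  then obtain n where n: "recip n < infdist x (- D)" using nat_approx_posE by blast
  define U where "U = shrink D n"
  note U = shrink[OF D(2), of n, folded U_def]
  have xU: "x \<in> U" using n by (simp add: U_def shrink_def)
  have [measurable]: "(\<lambda>w. exit_value h U (path_from x w)) \<in> borel_measurable M"
    by (rule measurable_exit_value) measurable
  let ?e = "\<lambda>i w. if alive U (recip i) (path_from x w) then exit_value h U (path_from x w) else 0"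
  have "ennreal (h x) = (\<integral>\<^sup>+w. exit_value h U (path_from x w) \<partial>M)"
    using harmonic[OF U(1,2) xU] nn_integral_exit_value[OF U(1,4) xU meas_h] by simp
  also have "\<dots> = (\<integral>\<^sup>+w. (SUP i. ?e i w) \<partial>M)"
  proof (rule nn_integral_cong)
    fix w
    have "alive U 0 (path_from x w)" by (rule alive_0) (use U xU in \<open>auto simp: path_0\<close>)
    then obtain u where u: "u > 0" "alive U u (path_from x w)"
      using alive_extend[OF right_cont_path] by blast
    obtain i where i: "recip i < u" using nat_approx_posE[OF u(1)] by blast
    have "alive U (recip i) (path_from x w)"
      by (rule alive_mono[OF right_cont_path u(2)]) (use i in auto)
    then show "exit_value h U (path_from x w) = (SUP i. ?e i w)"
      by (intro antisym SUP_upper2[of i] SUP_least) auto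
  qed
  also have "\<dots> = (SUP i. \<integral>\<^sup>+w. ?e i w \<partial>M)"
  proof (rule nn_integral_monotone_convergence_SUP)
    have "alive U (recip j) (path_from x w)"
      if "i \<le> j" "alive U (recip i) (path_from x w)" for i j w
      using that by (intro alive_mono[OF right_cont_path that(2)]) (auto intro!: divide_left_mono)
    then show "incseq (\<lambda>i w. ?e i w)"
      unfolding incseq_def le_fun_def by auto
  qed measurable
  also have "\<dots> = (SUP i. killed U (recip i) (\<lambda>y. ennreal (h y)) x)"
    unfolding U_def by (subst killed_interior_harmonic) (use xU in \<open>auto simp: U_def\<close>)
  also have "\<dots> \<le> (SUP i. killed D (recip i) (\<lambda>y. ennreal (h y)) x)"
    unfolding killed_def using alive_subset[OF U(3) D(2)]
    by (intro SUP_mono' nn_integral_mono) auto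
  finally show ?thesis .
qed

end
end

section \<open>Approximation by Green potentials\<close>

text \<open>Integrated up to \<open>T\<close>, the difference leaves the window
  \<open>{a<..a + a}\<close> minus the window \<open>{T + a<..T + a + a}\<close>, which vanishes as
  \<open>T\<close> grows. In \<open>ennreal\<close> this is written with sums.\<close>

lemma nn_integral_telescope:
  fixes F :: "real \<Rightarrow> ennreal"
  assumes [measurable]: "F \<in> borel_measurable borel"
    and anti: "\<And>s t. 0 \<le> s \<Longrightarrow> s \<le> t \<Longrightarrow> F t \<le> F s"
    and bound: "\<And>t. F t \<le> ennreal c"
    and lim: "(\<lambda>k. F (real (Suc k))) \<longlonglongrightarrow> 0" and a: "a > 0"
  shows "(\<integral>\<^sup>+t\<in>{0<..}. (F (t + a) - F (t + a + a)) \<partial>lborel) = (\<integral>\<^sup>+t\<in>{a<..a + a}. F t \<partial>lborel)"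
proof -
  let ?d = "\<lambda>t. F (t + a) - F (t + a + a)"
  define I where "I u v = (\<integral>\<^sup>+t\<in>{u<..v}. F t \<partial>lborel)" for u v
  define A where "A T = (\<integral>\<^sup>+t\<in>{0<..T}. ?d t \<partial>lborel)" for T
  have I_split: "I u w = I u v + I v w" if "u \<le> v" "v \<le> w" for u v w
    unfolding I_def using that
    by (subst nn_integral_add[symmetric]) (auto intro!: nn_integral_cong simp: indicator_def)
  have I_le: "I u v \<le> b * ennreal (v - u)" if "u \<le> v" "\<And>t. u < t \<Longrightarrow> F t \<le> b" for u v b
  proof -
    have "I u v \<le> (\<integral>\<^sup>+t. b * indicator {u<..v} t \<partial>lborel)"
      unfolding I_def using that(2) by (intro nn_integral_mono) (auto simp: indicator_def)
    then show ?thesis using that(1) by (simp add: nn_integral_cmult)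
  qed
  have I_fin: "I u v \<noteq> \<infinity>" if "u \<le> v" for u v
  proof -
    have "I u v \<le> ennreal c * ennreal (v - u)" using that bound by (intro I_le)
    also have "\<dots> < \<infinity>" by (simp add: ennreal_mult_less_top)
    finally show ?thesis by simp
  qed
  have shift: "(\<integral>\<^sup>+t\<in>{0<..T}. F (t + b) \<partial>lborel) = I b (T + b)" for T b
    unfolding I_def
    by (subst nn_integral_real_affine[where c=1 and t=b])
       (auto intro!: nn_integral_cong simp: indicator_def add.commute)
  have A_eq: "A T + I (T + a) (T + a + a) = I a (a + a)" if T: "T \<ge> 0" for T
  proof -
    have "A T + I (a + a) (T + (a + a)) =
        (\<integral>\<^sup>+t. ?d t * indicator {0<..T} t + F (t + (a + a)) * indicator {0<..T} t \<partial>lborel)"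
      unfolding A_def shift[symmetric] by (rule nn_integral_add[symmetric]) measurable
    also have "\<dots> = (\<integral>\<^sup>+t\<in>{0<..T}. F (t + a) \<partial>lborel)"
      using anti a by (intro nn_integral_cong) (auto simp: indicator_def diff_add_cancel_ennreal add.assoc)
    finally have 1: "A T + I (a + a) (T + (a + a)) = I a (T + a)" unfolding shift .
    have "I (a + a) (T + (a + a)) + (A T + I (T + a) (T + a + a)) = I a (T + a) + I (T + a) (T + a + a)"
      unfolding 1[symmetric] by (simp add: ac_simps)
    also have "\<dots> = I a (a + a) + I (a + a) (T + (a + a))"
      using I_split[of a "T + a" "T + a + a"] I_split[of a "a + a" "T + (a + a)"] T a by (simp add: add.assoc)
    \<comment> \<open>The common term \<open>I (a + a) (T + (a + a))\<close> is finite and may be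
      cancelled.\<close>
    finally show ?thesis
      using I_fin[of "a + a" "T + (a + a)"] T
      by (metis add.commute ennreal_add_left_cancel infinity_ennreal_def le_add_same_cancel2)
  qed
  have "(\<lambda>k. A (real (Suc k)) + I (real (Suc k) + a) (real (Suc k) + a + a)) \<longlonglongrightarrow>
      (\<integral>\<^sup>+t\<in>{0<..}. ?d t \<partial>lborel) + 0"
  proof (rule tendsto_add)
    have inc: "incseq (\<lambda>k t. ?d t * indicator {0<..real (Suc k)} t)"
      by (auto simp: incseq_def le_fun_def indicator_def)
    have "(\<integral>\<^sup>+t\<in>{0<..}. ?d t \<partial>lborel) =
        (\<integral>\<^sup>+t. (SUP k. ?d t * indicator {0<..real (Suc k)} t) \<partial>lborel)"
    proof (rule nn_integral_cong)
      fix t :: real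
      obtain k where "t \<le> real k" using real_arch_simple by blast
      then have "t \<le> real (Suc k)" by simp
      then show "?d t * indicator {0<..} t =
          (SUP k. ?d t * indicator {0<..real (Suc k)} t)"
        by (intro antisym SUP_upper2[of k] SUP_least) (auto simp: indicator_def)
    qed
    also have "\<dots> = (SUP k. A (real (Suc k)))"
      unfolding A_def by (rule nn_integral_monotone_convergence_SUP[OF inc]) measurable
    finally have eq: "(\<integral>\<^sup>+t\<in>{0<..}. ?d t \<partial>lborel) = (SUP k. A (real (Suc k)))" .
    have "incseq (\<lambda>k. A (real (Suc k)))"
      unfolding A_def incseq_def using inc by (auto simp: incseq_def le_fun_def intro!: nn_integral_mono)
    then show "(\<lambda>k. A (real (Suc k))) \<longlonglongrightarrow> (\<integral>\<^sup>+t\<in>{0<..}. ?d t \<partial>lborel)"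
      unfolding eq by (rule LIMSEQ_SUP)
    show "(\<lambda>k. I (real (Suc k) + a) (real (Suc k) + a + a)) \<longlonglongrightarrow> 0"
    proof (rule tendsto_sandwich[OF _ _ tendsto_const])
      have "(\<lambda>k. ennreal a * F (real (Suc k))) \<longlonglongrightarrow> ennreal a * 0"
        by (rule ennreal_tendsto_cmult[OF _ lim]) simp
      then show "(\<lambda>k. ennreal a * F (real (Suc k))) \<longlonglongrightarrow> 0" by simp
      have "I (real (Suc k) + a) (real (Suc k) + a + a) \<le> F (real (Suc k)) * ennreal (real (Suc k) + a + a - (real (Suc k) + a))" for k
        using a anti by (intro I_le) auto
      then show "eventually (\<lambda>k. I (real (Suc k) + a) (real (Suc k) + a + a) \<le> ennreal a * F (real (Suc k))) sequentially"
        by (simp add: mult.commute)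
    qed simp
  qed
  moreover have "A (real (Suc k)) + I (real (Suc k) + a) (real (Suc k) + a + a) = I a (a + a)" for k
    by (rule A_eq) simp
  ultimately show ?thesis unfolding I_def by (simp add: LIMSEQ_const_iff)
qed

context rc_levy
begin

text \<open>Right continuity makes the process a limit of its values at \<open>dyadic_above\<close>,
  which are jointly measurable; at negative times both are eventually 0.\<close>

lemma measurable_joint_path [measurable]: "(\<lambda>z. path (snd z) (fst z)) \<in> borel_measurable (borel \<Otimes>\<^sub>M M)"
proof (rule borel_measurable_LIMSEQ_metric)
  show "(\<lambda>z. path (snd z) (dyadic_above m (fst z))) \<in> borel_measurable (borel \<Otimes>\<^sub>M M)" for m
    by (rule measurable_dyadic_above_eval) measurable
  fix z
  show "(\<lambda>m. path (snd z) (dyadic_above m (fst z))) \<longlonglongrightarrow> path (snd z) (fst z)"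
  proof (cases "fst z \<ge> 0")
    case True
    have "right_cont (path (snd z))" using right_cont_path[of 0 "snd z"] by simp
    then show ?thesis using True by (rule dyadic_above_tendsto)
  next
    case False
    have "((\<lambda>m. dyadic_above m (fst z)) \<longlongrightarrow> fst z) sequentially"
      using filterlim_dyadic_above[of "fst z"] by (simp add: filterlim_at)
    then have "eventually (\<lambda>m. dyadic_above m (fst z) < 0) sequentially"
      using False by (auto dest!: order_tendstoD(2)[of _ _ _ 0])
    then have "eventually (\<lambda>m. path (snd z) (dyadic_above m (fst z)) = path (snd z) (fst z)) sequentially"
      by eventually_elim (use False in \<open>simp add: path_def X_nonpos\<close>)
    then show ?thesis by (rule tendsto_eventually)
  qed
qed

lemma measurable_joint_alive [measurable]:
  "Measurable.pred (borel \<Otimes>\<^sub>M M) (\<lambda>z. alive D (fst z) (\<lambda>r. x + path (snd z) r))"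
  unfolding alive_def alive_in_def by measurable

lemma measurable_killed_time:
  assumes [measurable]: "f \<in> borel_measurable borel"
  shows "(\<lambda>t. killed D t f x) \<in> borel_measurable borel"
proof -
  have "(\<lambda>z. if alive D (fst z) (\<lambda>r. x + path (snd z) r) then f (x + path (snd z) (fst z)) else 0)
      \<in> borel_measurable (borel \<Otimes>\<^sub>M M)" by measurable
  then show ?thesis unfolding killed_def
    by (intro borel_measurable_nn_integral) (simp add: case_prod_beta')
qed

text \<open>Once survival replaces the exit time, the integrand is jointly measurable in time and
  outcome, and Tonelli's theorem exchanges the integrals.\<close>

lemma green_potential_eq:
  assumes D: "open D" "- D \<noteq> {}" and x: "x \<in> D" and [measurable]: "f \<in> borel_measurable borel"
  shows "green_potential M X D f x = (\<integral>\<^sup>+t\<in>{0<..}. killed D t (\<lambda>y. ennreal (f y)) x \<partial>lborel)"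
proof -
  interpret P: pair_sigma_finite "lborel :: real measure" M ..
  define G where "G t w = (if alive D t (path_from x w) then ennreal (f (x + path w t)) else 0) * indicator {0<..} t"
    for t w
  have "(\<lambda>z. G (fst z) (snd z)) \<in> borel_measurable (lborel \<Otimes>\<^sub>M M)"
  proof -
    have "(\<lambda>z. G (fst z) (snd z)) \<in> borel_measurable (borel \<Otimes>\<^sub>M M)" unfolding G_def by measurable
    then show ?thesis
      by (simp cong: measurable_cong_sets add: measurable_cong_sets[OF sets_pair_measure_cong[OF sets_lborel refl] refl])
  qed
  then have G: "(\<lambda>(t, w). G t w) \<in> borel_measurable (lborel \<Otimes>\<^sub>M M)" by (simp add: case_prod_beta')
  have "AE w in completion M. \<forall>t\<ge>0. ereal t < exit_time D (path_from x w) \<longleftrightarrow> alive D t (path_from x w)"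
    by (rule AE_completion[OF AE_less_exit_time_iff_alive[OF D x]])
  then have "AE w in completion M. (\<integral>\<^sup>+ t\<in>{t. 0 < t \<and> ereal t < exit_time D (path_from x w)}. ennreal (f (x + path w t)) \<partial>lborel) =
     (\<integral>\<^sup>+ t. G t w \<partial>lborel)"
    by eventually_elim (auto intro!: nn_integral_cong simp: G_def indicator_def)
  then have "green_potential M X D f x = (\<integral>\<^sup>+w. (\<integral>\<^sup>+ t. G t w \<partial>lborel) \<partial>completion M)"
    unfolding green_potential_def expectation_from_def path_def by (intro nn_integral_cong_AE) auto
  also have "\<dots> = (\<integral>\<^sup>+w. (\<integral>\<^sup>+ t. G t w \<partial>lborel) \<partial>M)"
    by (rule nn_integral_completion)
  also have "\<dots> = (\<integral>\<^sup>+t. (\<integral>\<^sup>+w. G t w \<partial>M) \<partial>lborel)"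
    by (rule P.Fubini'[OF G])
  also have "\<dots> = (\<integral>\<^sup>+t\<in>{0<..}. killed D t (\<lambda>y. ennreal (f y)) x \<partial>lborel)"
    unfolding G_def killed_def by (intro nn_integral_cong) (auto simp: indicator_def)
  finally show ?thesis .
qed

text \<open>With a = 1/n, the Green potential of \<open>f n\<close> is n times the integral of
  \<open>K n (t + a) x - K n (t + a + a) x\<close> over positive \<open>t\<close>, hence n times the
  integral of \<open>K n t x\<close> over \<open>{a<..a + a}\<close>. The substitution t = u/n gives
  a domain independent of n, so monotone convergence applies.\<close>

theorem harmonic_approximation:
  assumes dens: has_continuous_densities and D: "open D" "- D \<noteq> {}"
    and extinct: "\<And>x. (\<lambda>k. emeasure M {w\<in>space M. x + path w (real (Suc k)) \<in> D}) \<longlonglongrightarrow> 0"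
    and meas_h[measurable]: "h \<in> borel_measurable borel"
    and harmonic: "\<And>U x. open U \<Longrightarrow> closure U \<subseteq> D \<Longrightarrow> x \<in> U \<Longrightarrow>
      ennreal (h x) = expectation_from M X x (at_exit h U)"
  shows "\<exists>f :: nat \<Rightarrow> 'a \<Rightarrow> real.
    (\<forall>k\<ge>1. (\<forall>x. 0 \<le> f k x) \<and> bounded (range (f k)) \<and> continuous_on D (f k)) \<and>
    (\<forall>x\<in>D. (\<forall>k\<ge>1. green_potential M X D (f k) x \<le> green_potential M X D (f (Suc k)) x) \<and>
           (\<lambda>k. green_potential M X D (f k) x) \<longlonglongrightarrow> ennreal (h x))"
proof -
  let ?P = "\<lambda>t x. emeasure M {w\<in>space M. x + path w t \<in> D}"
  define H where "H n y = min (ennreal (h y)) (ennreal (real n))" for n y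
  have H_meas[measurable]: "H n \<in> borel_measurable borel" for n unfolding H_def[abs_def] by measurable
  have H_le: "H n y \<le> ennreal (real n)" "H n y \<le> ennreal (h y)" for n y unfolding H_def by simp_all
  have H_mono: "n \<le> m \<Longrightarrow> H n y \<le> H m y" for n m y
    unfolding H_def by (intro min.mono ennreal_leI) auto
  define K where "K n t = killed D t (H n)" for n t
  have K_meas[measurable]: "K n t \<in> borel_measurable borel" for n t unfolding K_def by measurable
  have [measurable]: "(\<lambda>t. K n t x) \<in> borel_measurable borel" for n x
    unfolding K_def by (rule measurable_killed_time) measurable
  \<comment> \<open>Truncation preserves the inequality: the semigroup increases neither
    \<open>h\<close> nor a nonnegative constant.\<close>
  have K_le_H: "K n t y \<le> H n y" if "0 \<le> t" for n t y
  proof -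
    have "K n t y \<le> killed D t (\<lambda>y. ennreal (h y)) y"
      unfolding K_def by (intro killed_mono that H_le)
    also have "\<dots> \<le> ennreal (h y)" by (rule killed_harmonic_le[OF D meas_h harmonic that])
    finally show ?thesis unfolding H_def K_def using H_le(1) by (auto intro: killed_le simp: H_def)
  qed
  have K_le: "K n t y \<le> ennreal (real n)" for n t y unfolding K_def by (rule killed_le[OF H_le(1)])
  have K_semi: "killed D s (K n t) y = K n (s + t) y" if "0 \<le> s" "0 \<le> t" for n s t y
    unfolding K_def using killed_semigroup[OF that H_meas] by simp
  have K_anti: "K n t y \<le> K n s y" if "0 \<le> s" "s \<le> t" for n s t y
  proof -
    have "K n t y = killed D s (K n (t - s)) y" using K_semi[of s "t - s" n y] that by simp
    also have "\<dots> \<le> killed D s (H n) y" using that by (intro killed_mono K_le_H) auto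
    finally show ?thesis by (simp add: K_def)
  qed
  have K_mono: "K n t y \<le> K m t y" if "n \<le> m" "0 \<le> t" for n m t y
    unfolding K_def using that by (intro killed_mono H_mono)
  \<comment> \<open>A difference quotient of the semigroup at time 0; truncating \<open>h\<close> is
    what makes it bounded.\<close>
  define g where "g n z = ennreal (real n) * (H n z - K n (1 / real n) z)" for n z
  have g_meas[measurable]: "g n \<in> borel_measurable borel" for n unfolding g_def[abs_def] by measurable
  have g_le: "g n z \<le> ennreal (real n * real n)" for n z
  proof -
    have "H n z - K n (1 / real n) z \<le> ennreal (real n)"
      by (rule order_trans[OF diff_le_self_ennreal H_le(1)])
    then show ?thesis unfolding g_def by (simp add: ennreal_mult mult_left_mono)
  qed
  \<comment> \<open>For \<open>n = 0\<close> the time \<open>1 / real n\<close> is 0 and gives no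
    smoothing, so the claims begin at \<open>n = 1\<close>.\<close>
  define f where "f n y = enn2real (killed D (1 / real n) (g n) y)" for n y
  have f_meas[measurable]: "f n \<in> borel_measurable borel" for n unfolding f_def[abs_def] by measurable
  have kg_le: "killed D (1 / real n) (g n) y \<le> ennreal (real n * real n)" for n y by (rule killed_le[OF g_le])
  have f_eq: "ennreal (f n y) = killed D (1 / real n) (g n) y" for n y
    unfolding f_def using order_le_less_trans[OF kg_le ennreal_less_top] by (intro ennreal_enn2real) auto
  have f_le: "f n y \<le> real n * real n" for n y
    unfolding f_def using kg_le by (intro enn2real_leI) auto
  let ?G = "\<lambda>n x. green_potential M X D (f n) x" and ?S = "\<lambda>u x. SUP j. K (Suc j) (u / real (Suc j)) x"
  have green: "?G n x = (\<integral>\<^sup>+u\<in>{1<..2}. K n (u / real n) x \<partial>lborel)"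
    if n: "n \<ge> 1" and x: "x \<in> D" for n x
  proof -
    define a where "a = 1 / real n"
    have a: "a > 0" using n by (simp add: a_def)
    have na: "ennreal (real n) * ennreal a = 1" using n by (simp add: a_def ennreal_mult[symmetric])
    have "?G n x = (\<integral>\<^sup>+t\<in>{0<..}. killed D t (killed D a (g n)) x \<partial>lborel)"
      unfolding green_potential_eq[OF D x f_meas] f_eq a_def ..
    also have "\<dots> = (\<integral>\<^sup>+t. ennreal (real n) * ((K n (t + a) x - K n (t + a + a) x) * indicator {0<..} t) \<partial>lborel)"
    proof (rule nn_integral_cong)
      fix t :: real
      show "killed D t (killed D a (g n)) x * indicator {0<..} t =
          ennreal (real n) * ((K n (t + a) x - K n (t + a + a) x) * indicator {0<..} t)"
      proof (cases "t > 0")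
        case True
        have "killed D t (killed D a (g n)) x = killed D (t + a) (g n) x"
          using killed_semigroup[of t a "g n" D x] True a by simp
        also have "\<dots> = ennreal (real n) * killed D (t + a) (\<lambda>z. H n z - K n a z) x"
          unfolding g_def a_def[symmetric] by (rule killed_cmult) measurable
        also have "killed D (t + a) (\<lambda>z. H n z - K n a z) x = killed D (t + a) (H n) x - killed D (t + a) (K n a) x"
          using a by (intro killed_diff[OF H_meas K_meas K_le_H K_le]) auto
        also have "\<dots> = K n (t + a) x - K n (t + a + a) x"
          using K_semi[of "t + a" a n x] True a by (simp add: K_def)
        finally show ?thesis using True by simp
      qed simp
    qed
    also have "\<dots> = ennreal (real n) * (\<integral>\<^sup>+t\<in>{0<..}. (K n (t + a) x - K n (t + a + a) x) \<partial>lborel)"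
    proof (rule nn_integral_cmult)
      show "(\<lambda>t. (K n (t + a) x - K n (t + a + a) x) * indicator {0<..} t) \<in> borel_measurable lborel"
        by measurable
    qed
    also have "(\<integral>\<^sup>+t\<in>{0<..}. (K n (t + a) x - K n (t + a + a) x) \<partial>lborel) = (\<integral>\<^sup>+t\<in>{a<..a + a}. K n t x \<partial>lborel)"
    proof (rule nn_integral_telescope[OF _ K_anti K_le _ a])
      show "(\<lambda>t. K n t x) \<in> borel_measurable borel" by measurable
      show "(\<lambda>k. K n (real (Suc k)) x) \<longlonglongrightarrow> 0"
      proof (rule tendsto_sandwich[OF _ _ tendsto_const])
        have "(\<lambda>k. ennreal (real n) * ?P (real (Suc k)) x) \<longlonglongrightarrow> ennreal (real n) * 0"
          by (rule ennreal_tendsto_cmult[OF _ extinct]) simp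
        then show "(\<lambda>k. ennreal (real n) * ?P (real (Suc k)) x) \<longlonglongrightarrow> 0" by simp
        have [measurable]: "D \<in> sets borel" using D by simp
        have "K n t x \<le> ennreal (real n) * ?P t x" if t: "0 \<le> t" for t
        proof -
          have "K n t x \<le> (\<integral>\<^sup>+w. ennreal (real n) * indicator {w\<in>space M. x + path w t \<in> D} w \<partial>M)"
            unfolding K_def killed_def using alive_path_imp_in[of D t x _ t] t H_le(1)
            by (intro nn_integral_mono) (auto simp: indicator_def)
          then show ?thesis by (simp add: nn_integral_cmult)
        qed
        then show "eventually (\<lambda>k. K n (real (Suc k)) x \<le> ennreal (real n) * ?P (real (Suc k)) x) sequentially"
          by simp
      qed simp
    qed
    also have "ennreal (real n) * (\<integral>\<^sup>+t\<in>{a<..a + a}. K n t x \<partial>lborel) =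
        ennreal (real n) * (ennreal \<bar>a\<bar> * (\<integral>\<^sup>+u. K n (0 + a * u) x * indicator {a<..a + a} (0 + a * u) \<partial>lborel))"
    proof (subst nn_integral_real_affine[where c=a and t=0])
      show "(\<lambda>t. K n t x * indicator {a<..a + a} t) \<in> borel_measurable borel" by measurable
    qed (use a in auto)
    also have "\<dots> = (\<integral>\<^sup>+u. K n (0 + a * u) x * indicator {a<..a + a} (0 + a * u) \<partial>lborel)"
      using a na by (simp add: mult.assoc[symmetric])
    also have "\<dots> = (\<integral>\<^sup>+u\<in>{1<..2}. K n (u / real n) x \<partial>lborel)"
    proof (rule nn_integral_cong)
      fix u :: real
      have "a < a * u \<longleftrightarrow> 1 < u" "a * u \<le> a + a \<longleftrightarrow> u \<le> 2"
        using a mult_less_cancel_left_pos[of a 1 u] mult_le_cancel_left_pos[of a u 2] by simp_all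
      then show "K n (0 + a * u) x * indicator {a<..a + a} (0 + a * u) = K n (u / real n) x * indicator {1<..2} u"
        by (simp add: a_def indicator_def)
    qed
    finally show ?thesis .
  qed
  \<comment> \<open>Both changes increase the value: the shorter time and the higher
    truncation.\<close>
  have K_step: "K n (u / real n) x \<le> K (Suc n) (u / real (Suc n)) x" if "n \<ge> 1" "u > 0" for n u x
  proof -
    have "K n (u / real n) x \<le> K n (u / real (Suc n)) x" using that by (intro K_anti divide_left_mono) auto
    also have "\<dots> \<le> K (Suc n) (u / real (Suc n)) x" using that by (intro K_mono) auto
    finally show ?thesis .
  qed
  have K_SUP: "?S u x = ennreal (h x)" if u: "1 < u" "u \<le> 2" and x: "x \<in> D" for u x
  proof (rule antisym)
    show "?S u x \<le> ennreal (h x)"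
      using u by (intro SUP_least order_trans[OF K_le_H H_le(2)]) auto
    have "ennreal (h x) \<le> (SUP i. killed D (recip i) (\<lambda>y. ennreal (h y)) x)"
      by (rule killed_harmonic_SUP[OF D meas_h harmonic x])
    also have "\<dots> \<le> ?S u x"
    proof (rule SUP_least)
      fix i :: nat
      have hS: "ennreal (h y) = (SUP m. H m y)" for y
      proof (rule antisym)
        obtain m where "h y \<le> real m" using real_arch_simple by blast
        then show "ennreal (h y) \<le> (SUP m. H m y)"
          by (intro SUP_upper2[of m]) (auto simp: H_def ennreal_leI)
      qed (use H_le(2) in \<open>auto intro: SUP_least\<close>)
      have "killed D (recip i) (\<lambda>y. ennreal (h y)) x =
          (\<integral>\<^sup>+w. (SUP m. if alive D (recip i) (path_from x w) then H m (x + path w (recip i)) else 0) \<partial>M)"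
        unfolding killed_def hS by (intro nn_integral_cong) auto
      also have "\<dots> = (SUP m. K m (recip i) x)"
        unfolding K_def killed_def
      proof (rule nn_integral_monotone_convergence_SUP)
        show "incseq (\<lambda>m w. if alive D (recip i) (path_from x w) then H m (x + path w (recip i)) else 0)"
          unfolding incseq_def le_fun_def using H_mono by auto
      qed measurable
      also have "\<dots> \<le> ?S u x"
      proof (rule SUP_least)
        fix m :: nat
        \<comment> \<open>The index must reach the truncation level \<open>m\<close>, and since
          \<open>u \<le> 2\<close>, an index of at least \<open>2 * Suc i\<close> makes
          \<open>u / real (Suc j)\<close> at most \<open>recip i\<close>.\<close>
        define j where "j = max m (2 * Suc i)"
        have j1: "m \<le> Suc j" by (simp add: j_def)
        have "2 * real (Suc i) \<le> real (Suc j)" unfolding j_def by simp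
        then have "u * real (Suc i) \<le> real (Suc j)" using u by (meson mult_right_mono of_nat_0_le_iff order_trans)
        then have j2: "u / real (Suc j) \<le> recip i" by (simp add: field_simps del: of_nat_Suc)
        have "K m (recip i) x \<le> K m (u / real (Suc j)) x" using j2 u by (intro K_anti) auto
        also have "\<dots> \<le> K (Suc j) (u / real (Suc j)) x" using j1 u by (intro K_mono) auto
        finally show "K m (recip i) x \<le> ?S u x"
          by (rule SUP_upper2[OF UNIV_I])
      qed
      finally show "killed D (recip i) (\<lambda>y. ennreal (h y)) x \<le> ?S u x" .
    qed
    finally show "ennreal (h x) \<le> ?S u x" .
  qed
  have mono: "?G n x \<le> ?G (Suc n) x" if "n \<ge> 1" "x \<in> D" for n x
    using that K_step[of n] by (subst (1 2) green) (auto intro!: nn_integral_mono simp: indicator_def simp del: of_nat_Suc)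
  have lim: "(\<lambda>k. ?G k x) \<longlonglongrightarrow> ennreal (h x)" if x: "x \<in> D" for x
  proof (rule LIMSEQ_imp_Suc)
    have "incseq (\<lambda>j. ?G (Suc j) x)" by (rule incseq_SucI) (use mono x in auto)
    then have "(\<lambda>j. ?G (Suc j) x) \<longlonglongrightarrow> (SUP j. ?G (Suc j) x)"
      by (rule LIMSEQ_SUP)
    also have "(SUP j. ?G (Suc j) x) = (SUP j. \<integral>\<^sup>+u\<in>{1<..2}. K (Suc j) (u / real (Suc j)) x \<partial>lborel)"
      by (subst green) (use x in auto)
    also have "\<dots> = (\<integral>\<^sup>+u. (SUP j. K (Suc j) (u / real (Suc j)) x * indicator {1<..2} u) \<partial>lborel)"
    proof (rule nn_integral_monotone_convergence_SUP[symmetric])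
      show "incseq (\<lambda>j u. K (Suc j) (u / real (Suc j)) x * indicator {1<..2} u)"
        by (rule incseq_SucI) (auto simp: le_fun_def indicator_def K_step simp del: of_nat_Suc)
      show "(\<lambda>u. K (Suc j) (u / real (Suc j)) x * indicator {1<..2} u) \<in> borel_measurable lborel" for j
        by measurable
    qed
    also have "\<dots> = (\<integral>\<^sup>+u. ennreal (h x) * indicator {1<..2} u \<partial>(lborel :: real measure))"
    proof (rule nn_integral_cong)
      fix u :: real
      show "(SUP j. K (Suc j) (u / real (Suc j)) x * indicator {1<..2} u) = ennreal (h x) * indicator {1<..2} u"
        using K_SUP[of u x] x by (cases "u \<in> {1<..2}") auto
    qed
    also have "\<dots> = ennreal (h x)" by (simp add: nn_integral_cmult)
    finally show "(\<lambda>j. ?G (Suc j) x) \<longlonglongrightarrow> ennreal (h x)" .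
  qed
  have "continuous_on D (f n)" if "n \<ge> 1" for n
    unfolding f_def[abs_def]
    by (rule killed_strong_Feller[OF dens D _ g_meas g_le]) (use that in auto)
  moreover have "bounded (range (f n))" for n
    using f_le by (intro boundedI[of _ "real n * real n"]) (auto simp: f_def)
  ultimately show ?thesis using mono lim by (intro exI[of _ f]) (auto simp: f_def)
qed

end

section \<open>Right-continuous versions\<close>

text \<open>For a nonempty index set, independence is a property of the joint law and its marginals,
  which changes on null sets do not affect.\<close>

lemma (in prob_space) indep_vars_cong_AE_borel:
  fixes Y Z :: "nat \<Rightarrow> 'a \<Rightarrow> 'b::{second_countable_topology, topological_space}"
  assumes ind: "indep_vars (\<lambda>_. borel) Y I"
    and Z: "\<And>i. i \<in> I \<Longrightarrow> Z i \<in> borel_measurable M"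
    and eq: "AE w in M. \<forall>i\<in>I. Y i w = Z i w"
  shows "indep_vars (\<lambda>_. borel) Z I"
proof (cases "I = {}")
  case True
  then show ?thesis by (simp add: indep_vars_def indep_sets_def)
next
  case False
  have Y: "Y i \<in> borel_measurable M" if "i \<in> I" for i
    using ind that unfolding indep_vars_def by auto
  have "distr M (PiM I (\<lambda>_. borel)) (\<lambda>w. \<lambda>i\<in>I. Z i w) = distr M (PiM I (\<lambda>_. borel)) (\<lambda>w. \<lambda>i\<in>I. Y i w)"
  proof (rule distr_cong_AE)
    show "AE w in M. (\<lambda>i\<in>I. Z i w) = (\<lambda>i\<in>I. Y i w)"
      using eq by eventually_elim (auto intro: restrict_ext)
  qed (auto intro!: measurable_restrict Y Z)
  also have "\<dots> = PiM I (\<lambda>i. distr M borel (Y i))"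
    using ind indep_vars_iff_distr_eq_PiM'[OF False, of Y "\<lambda>_. borel"] Y by auto
  also have "\<dots> = PiM I (\<lambda>i. distr M borel (Z i))"
  proof (rule PiM_cong)
    fix i assume i: "i \<in> I"
    have "AE w in M. Y i w = Z i w" using eq by eventually_elim (use i in auto)
    then show "distr M borel (Y i) = distr M borel (Z i)"
      by (intro distr_cong_AE Y Z i) auto
  qed simp
  finally show ?thesis
    using indep_vars_iff_distr_eq_PiM'[OF False, of Z "\<lambda>_. borel"] Z by auto
qed

lemma exit_time_cong: "(\<And>t. 0 \<le> t \<Longrightarrow> p t = p' t) \<Longrightarrow> exit_time U p = exit_time U p'"
  unfolding exit_time_def by (intro arg_cong[where f=Inf] image_cong) auto

lemma at_exit_cong:
  assumes "\<And>t. 0 \<le> t \<Longrightarrow> p t = p' t" shows "at_exit h U p = at_exit h U p'"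
proof -
  have "0 \<le> exit_time U p" unfolding exit_time_def by (rule Inf_greatest) auto
  moreover have "exit_time U p = exit_time U p'" by (rule exit_time_cong) (rule assms)
  ultimately show ?thesis
    using assms[of "real_of_ereal (exit_time U p)"] real_of_ereal_pos[of "exit_time U p"] by (simp add: at_exit_def)
qed

lemma expectation_from_cong:
  assumes "AE w in M. \<forall>t\<ge>0. X t w = X' t w"
    and "\<And>p p'. (\<And>t. 0 \<le> t \<Longrightarrow> p t = p' t) \<Longrightarrow> F p = F p'"
  shows "expectation_from M X x F = expectation_from M X' x F"
  unfolding expectation_from_def
proof (rule nn_integral_cong_AE)
  show "AE w in completion M. F (\<lambda>t. x + X t w) = F (\<lambda>t. x + X' t w)"
    using AE_completion[OF assms(1)] by eventually_elim (rule assms(2), simp)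
qed

lemma green_potential_cong:
  fixes X X' :: "real \<Rightarrow> 'w \<Rightarrow> 'a::euclidean_space"
  assumes "AE w in M. \<forall>t\<ge>0. X t w = X' t w"
  shows "green_potential M X D f x = green_potential M X' D f x"
  unfolding green_potential_def
proof (rule expectation_from_cong[OF assms])
  fix p p' :: "real \<Rightarrow> 'a" assume eq: "\<And>t. 0 \<le> t \<Longrightarrow> p t = p' t"
  have "exit_time D p = exit_time D p'" by (rule exit_time_cong) (rule eq)
  then show "(\<integral>\<^sup>+ t\<in>{t. 0 < t \<and> ereal t < exit_time D p}. ennreal (f (p t)) \<partial>lborel) =
      (\<integral>\<^sup>+ t\<in>{t. 0 < t \<and> ereal t < exit_time D p'}. ennreal (f (p' t)) \<partial>lborel)"
    using eq by (intro nn_integral_cong) (auto simp: indicator_def)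
qed

text \<open>Setting the process to 0 on a null set of outcomes and at times \<open>t \<le> 0\<close>
  makes every path right-continuous and preserves the joint laws at nonnegative times.\<close>

lemma levy_process_rc_version:
  fixes X :: "real \<Rightarrow> 'w \<Rightarrow> 'a::euclidean_space"
  assumes levy: "levy_process M X"
  obtains X' where "rc_levy M X'" "AE w in M. \<forall>t\<ge>0. X t w = X' t w"
proof -
  interpret prob_space M using levy by (simp add: levy_process_def)
  have X: "X t \<in> borel_measurable M" if "0 \<le> t" for t using levy that by (simp add: levy_process_def)
  have "AE w in M. X 0 w = 0 \<and> cadlag (\<lambda>t. X t w)"
    using levy unfolding levy_process_def by auto
  \<comment> \<open>The set of bad outcomes need not be measurable, so a measurable null set
    covering it is removed.\<close>
  then obtain N where N: "{w\<in>space M. \<not> (X 0 w = 0 \<and> cadlag (\<lambda>t. X t w))} \<subseteq> N" "N \<in> null_sets M"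
    unfolding eventually_ae_filter by blast
  define \<Omega> where "\<Omega> = space M - N"
  have \<Omega>[measurable]: "\<Omega> \<in> sets M" using N by (auto simp: \<Omega>_def)
  have good: "X 0 w = 0" "cadlag (\<lambda>t. X t w)" if "w \<in> \<Omega>" for w using N that by (auto simp: \<Omega>_def)
  define X' where "X' t w = (if w \<in> \<Omega> \<and> 0 < t then X t w else 0)" for t w
  have eq: "X t w = X' t w" if "0 \<le> t" "w \<in> \<Omega>" for t w
    using that good by (cases "t = 0") (auto simp: X'_def)
  have "AE w in M. w \<in> \<Omega>"
    using AE_not_in[OF N(2)] AE_space by eventually_elim (simp add: \<Omega>_def)
  then have AE_eq: "AE w in M. \<forall>t\<ge>0. X t w = X' t w" by eventually_elim (use eq in auto)
  have X'_meas: "X' t \<in> borel_measurable M" for t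
  proof (cases "t > 0")
    case True
    then have [measurable]: "X t \<in> borel_measurable M" by (intro X) simp
    show ?thesis unfolding X'_def by measurable
  next
    case False
    then have "X' t = (\<lambda>_. 0)" by (simp add: X'_def fun_eq_iff)
    then show ?thesis by simp
  qed
  have "rc_levy M X'"
  proof
    show "X' t \<in> borel_measurable M" for t by (rule X'_meas)
    show "X' t w = 0" if "t \<le> 0" for t w using that by (simp add: X'_def)
    show "((\<lambda>s. X' s w) \<longlongrightarrow> X' t w) (at_right t)" if t: "0 \<le> t" for t w
    proof (cases "w \<in> \<Omega>")
      case True
      have "((\<lambda>s. X s w) \<longlongrightarrow> X t w) (at_right t)"
        using good(2)[OF True] t unfolding cadlag_def by simp
      moreover have "eventually (\<lambda>s. X s w = X' s w) (at_right t)"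
        using t eq[OF _ True] by (auto simp: eventually_at_right_field intro!: exI[of _ "t + 1"])
      ultimately show ?thesis using eq[OF t True] by (simp add: tendsto_cong)
    qed (simp add: X'_def)
    show "indep_vars (\<lambda>_. borel) (\<lambda>i w. X' (t (Suc i)) w - X' (t i) w) {..<n}"
      if t: "0 \<le> t 0" "\<And>i. i < n \<Longrightarrow> t i < t (Suc i)" for n and t :: "nat \<Rightarrow> real"
    proof (rule indep_vars_cong_AE_borel)
      show "indep_vars (\<lambda>_. borel) (\<lambda>i w. X (t (Suc i)) w - X (t i) w) {..<n}"
        using levy t unfolding levy_process_def by blast
      have nn: "0 \<le> t i" if "i \<le> n" for i
        using that by (induction i) (use t in \<open>auto intro: order_trans[OF _ less_imp_le]\<close>)
      show "AE w in M. \<forall>i\<in>{..<n}. X (t (Suc i)) w - X (t i) w = X' (t (Suc i)) w - X' (t i) w"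
        using AE_eq by eventually_elim (use nn in auto)
    qed (intro borel_measurable_diff X'_meas)
    show "distr M borel (\<lambda>w. X' (s + t) w - X' s w) = distr M borel (X' t)" if st: "0 \<le> s" "0 \<le> t" for s t
    proof -
      have "distr M borel (\<lambda>w. X' (s + t) w - X' s w) = distr M borel (\<lambda>w. X (s + t) w - X s w)"
      proof (rule distr_cong_AE)
        show "AE w in M. X' (s + t) w - X' s w = X (s + t) w - X s w"
          using AE_eq by eventually_elim (use st in auto)
      qed (use st in \<open>auto intro!: borel_measurable_diff X'_meas X\<close>)
      also have "\<dots> = distr M borel (X t)" using levy st unfolding levy_process_def by blast
      also have "\<dots> = distr M borel (X' t)"
      proof (rule distr_cong_AE)
        show "AE w in M. X t w = X' t w" using AE_eq by eventually_elim (use st in auto)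
      qed (use st in \<open>auto intro!: X'_meas X\<close>)
      finally show ?thesis .
    qed
  qed
  then show thesis using AE_eq by (rule that)
qed

theorem lemma3p9:
  fixes \<mu> \<phi> :: "real \<Rightarrow> real"
    and R0 \<delta>1 \<delta>2 a1 a2 :: real
    and M :: "'w measure"
    and X :: "real \<Rightarrow> 'w \<Rightarrow> 'a::euclidean_space"
    and D :: "'a set"
    and h :: "'a \<Rightarrow> real"
  assumes dim: "DIM('a) \<ge> 2"
    and mu_pos: "\<And>t. t > 0 \<Longrightarrow> \<mu> t > 0"
    and mu_cm: "completely_monotone \<mu>"
    and mu_int: "set_integrable lborel {0<..} (\<lambda>t. min 1 t * \<mu> t)"
    and phi: "\<phi> = bernstein_fun \<mu>"
    and params: "R0 > 0" "0 < \<delta>1" "\<delta>1 \<le> \<delta>2" "\<delta>2 < 1" "a1 > 0" "a2 > 0"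
    and scaling: "weak_scaling \<phi> R0 \<delta>1 \<delta>2 a1 a2"
    and transience: "DIM('a) = 2 \<Longrightarrow>
      set_integrable lborel {0<..1} (\<lambda>l. l powr (real DIM('a) / 2 - 1) / \<phi> l)"
    and levy: "levy_process M X"
    and char_exponent: "\<And>t \<xi>. t \<ge> 0 \<Longrightarrow>
      (CLINT \<omega>|M. iexp (\<xi> \<bullet> X t \<omega>)) = complex_of_real (exp (- t * \<phi> ((norm \<xi>)\<^sup>2)))"
    and D: "open D" "bounded D"
    and harm: "harmonic_killed \<mu> M X D h"
  shows "\<exists>f :: nat \<Rightarrow> 'a \<Rightarrow> real.
    (\<forall>k\<ge>1. (\<forall>x\<in>D. 0 \<le> f k x) \<and> bounded (f k ` D) \<and> continuous_on D (f k)) \<and>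
    (\<forall>x\<in>D. (\<forall>k\<ge>1. green_potential M X D (f k) x \<le> green_potential M X D (f (Suc k)) x) \<and>
           (\<lambda>k. green_potential M X D (f k) x) \<longlonglongrightarrow> ennreal (h x))"
proof -
  obtain X' where X': "rc_levy M X'" and X_eq: "AE w in M. \<forall>t\<ge>0. X t w = X' t w"
    using levy_process_rc_version[OF levy] by blast
  interpret rc_levy M X' by (rule X')
  have X_meas: "X t \<in> borel_measurable M" if "0 \<le> t" for t using levy that by (simp add: levy_process_def)
  have law_eq: "distr M borel (X t) = distr M borel (X' t)" if t: "0 \<le> t" for t
  proof (rule distr_cong_AE)
    show "AE w in M. X t w = X' t w" using X_eq by eventually_elim (use t in auto)
  qed (use t X_meas in auto)
  have phi_pos: "\<phi> r > 0" if "r > 0" for r unfolding phi by (rule bernstein_fun_pos[OF mu_pos mu_int that])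
  have phi_nonneg: "\<phi> r \<ge> 0" if "r \<ge> 0" for r unfolding phi by (rule bernstein_fun_nonneg[OF mu_pos that])
  have char: "(CLINT w|M. iexp (\<xi> \<bullet> X t w)) = complex_of_real (exp (- (t * \<phi> ((norm \<xi>)\<^sup>2))))" if "0 \<le> t" for t \<xi>
    using char_exponent[OF that] by simp
  \<comment> \<open>Up to its form this is the real part of a characteristic function, measurable in
    \<xi> as a parameter integral.\<close>
  have meas: "(\<lambda>\<xi>::'a. exp (- (t * \<phi> ((norm \<xi>)\<^sup>2)))) \<in> borel_measurable borel" if t: "0 \<le> t" for t
  proof -
    have [measurable]: "X t \<in> borel_measurable M" by (rule X_meas[OF t])
    have "(\<lambda>\<xi>::'a. Re (CLINT w|M. iexp (\<xi> \<bullet> X t w))) \<in> borel_measurable borel" by measurable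
    then show ?thesis unfolding char[OF t] by simp
  qed
  \<comment> \<open>The constant comes from weak scaling with base point \<open>R0\<close>.\<close>
  define c where "c = a1 * \<phi> R0 * R0 powr (- \<delta>1)"
  have c: "c > 0" unfolding c_def using params phi_pos by simp
  have growth: "c * r powr \<delta>1 \<le> \<phi> r" if "R0 \<le> r" for r
    unfolding c_def using weak_scaling_growth[OF scaling _ _ _ that] params phi_pos by simp
  have int: "integrable lborel (\<lambda>\<xi>::'a. exp (- (t * \<phi> ((norm \<xi>)\<^sup>2))))" if t: "0 < t" for t
    by (rule integrable_exp_neg_radial[OF meas phi_nonneg t c params(2) growth]) (use t in auto)
  \<comment> \<open>The bound on the density of \<open>X' t\<close> given by Fourier
    inversion.\<close>
  define b where "b t = (1 / (2 * pi)) ^ DIM('a) * (LINT \<xi>::'a|lborel. exp (- (t * \<phi> ((norm \<xi>)\<^sup>2))))" for t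
  have density: "\<exists>q. (\<forall>y. isCont q y \<and> 0 \<le> q y \<and> q y \<le> b t) \<and>
      distr M borel (X' t) = density lborel (\<lambda>y. ennreal (q y))" if t: "0 < t" for t
    unfolding b_def law_eq[OF less_imp_le[OF t], symmetric]
    by (rule density_of_integrable_char[OF prob_space_axioms X_meas char int[OF t]]) (use t in auto)
  then have dens: has_continuous_densities unfolding has_continuous_densities_def by blast
  \<comment> \<open>Survival is measured by the distance to the complement, which must therefore be
    nonempty.\<close>
  have D_ne: "- D \<noteq> {}"
    using D(2) not_bounded_UNIV[where 'a='a] by (metis double_compl Compl_empty_eq)
  have b_lim: "(\<lambda>k. b (real (Suc k))) \<longlonglongrightarrow> 0"
  proof -
    have "(\<lambda>k. b (real (Suc k))) \<longlonglongrightarrow> (1 / (2 * pi)) ^ DIM('a) * 0"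
      unfolding b_def
      by (intro tendsto_mult tendsto_const integral_exp_neg_radial_tendsto_0 int meas phi_nonneg phi_pos) auto
    then show ?thesis by simp
  qed
  \<comment> \<open>The probability of being in \<open>D\<close> at time \<open>t\<close> is at most
    the volume of \<open>D\<close> times \<open>b t\<close>.\<close>
  have extinct: "(\<lambda>k. emeasure M {w\<in>space M. x + path w (real (Suc k)) \<in> D}) \<longlonglongrightarrow> 0" for x
  proof (rule tendsto_sandwich[OF _ _ tendsto_const])
    define A where "A = {z. x + z \<in> D}"
    have [measurable]: "A \<in> sets borel"
    proof -
      have "open ((\<lambda>z. x + z) -` D)" by (intro open_vimage D continuous_intros)
      then show ?thesis by (simp add: A_def vimage_def)
    qed
    have "A = (\<lambda>y. y - x) ` D" unfolding A_def by (auto simp: image_iff algebra_simps intro: bexI[of _ "x + _"])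
    then have "bounded A" using bounded_translation_minus[OF D(2), of x] by simp
    then have A_fin: "emeasure lborel A < \<infinity>" by (rule emeasure_bounded_finite)
    have "(\<lambda>k. emeasure lborel A * ennreal (b (real (Suc k)))) \<longlonglongrightarrow> emeasure lborel A * ennreal 0"
      using A_fin by (intro ennreal_tendsto_cmult tendsto_ennrealI b_lim) auto
    then show "(\<lambda>k. emeasure lborel A * ennreal (b (real (Suc k)))) \<longlonglongrightarrow> 0" by simp
    have "emeasure M {w\<in>space M. x + path w t \<in> D} \<le> emeasure lborel A * ennreal (b t)" if t: "0 < t" for t
    proof -
      obtain q where q: "\<And>y. isCont q y" "\<And>y. q y \<le> b t" "distr M borel (X' t) = density lborel (\<lambda>y. ennreal (q y))"
        using density[OF t] by blast
      have [measurable]: "q \<in> borel_measurable borel"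
        by (intro borel_measurable_continuous_onI continuous_at_imp_continuous_on ballI q(1))
      have "emeasure M {w\<in>space M. x + path w t \<in> D} = emeasure (distr M borel (X' t)) A"
      proof (subst emeasure_distr)
        show "emeasure M {w\<in>space M. x + path w t \<in> D} = emeasure M (X' t -` A \<inter> space M)"
          by (rule arg_cong[where f="emeasure M"]) (auto simp: A_def path_def)
      qed auto
      also have "\<dots> = (\<integral>\<^sup>+y\<in>A. ennreal (q y) \<partial>lborel)"
        unfolding q(3) by (rule emeasure_density) auto
      also have "\<dots> \<le> (\<integral>\<^sup>+y. ennreal (b t) * indicator A y \<partial>lborel)"
        using q(2) by (intro nn_integral_mono mult_right_mono ennreal_leI) auto
      also have "\<dots> = emeasure lborel A * ennreal (b t)"
        by (simp add: nn_integral_cmult mult.commute)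
      finally show ?thesis .
    qed
    then show "eventually (\<lambda>k. emeasure M {w\<in>space M. x + path w (real (Suc k)) \<in> D} \<le>
        emeasure lborel A * ennreal (b (real (Suc k)))) sequentially" by simp
  qed simp
  have meas_h: "zero_ext D h \<in> borel_measurable borel" using harm by (simp add: harmonic_killed_def)
  \<comment> \<open>The exit value ignores negative times, so harmonicity passes from the given
    process to its version.\<close>
  have harmonic: "ennreal (zero_ext D h x) = expectation_from M X' x (at_exit (zero_ext D h) U)"
    if U: "open U" "closure U \<subseteq> D" "x \<in> U" for U x
  proof -
    have "x \<in> D" using U closure_subset by blast
    then have "ennreal (zero_ext D h x) = expectation_from M X x (at_exit (zero_ext D h) U)"
      using harm U unfolding harmonic_killed_def zero_ext_def by simp
    also have "\<dots> = expectation_from M X' x (at_exit (zero_ext D h) U)"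
      by (rule expectation_from_cong[OF X_eq at_exit_cong])
    finally show ?thesis .
  qed
  obtain f :: "nat \<Rightarrow> 'a \<Rightarrow> real" where f: "\<And>k. k \<ge> 1 \<Longrightarrow> (\<forall>x. 0 \<le> f k x) \<and> bounded (range (f k)) \<and> continuous_on D (f k)"
    and lim: "\<And>x. x \<in> D \<Longrightarrow> (\<forall>k\<ge>1. green_potential M X' D (f k) x \<le> green_potential M X' D (f (Suc k)) x) \<and>
           (\<lambda>k. green_potential M X' D (f k) x) \<longlonglongrightarrow> ennreal (zero_ext D h x)"
    using harmonic_approximation[OF dens D(1) D_ne extinct meas_h harmonic] by blast
  have "f k ` D \<subseteq> range (f k)" for k by blast
  then have "bounded (f k ` D)" if "k \<ge> 1" for k using f[OF that] bounded_subset by blast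
  moreover have "zero_ext D h x = h x" if "x \<in> D" for x using that by (simp add: zero_ext_def)
  ultimately show ?thesis
    using f lim unfolding green_potential_cong[OF X_eq] by (intro exI[of _ f]) simp
qed

end
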